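(* Let $s\in\mathbb N$, let $\varphi$ be a probability density function on $\mathbb R$ and $\psi,\omega:\mathbb R\to(0,\infty)$ weight functions such that $(\varphi,\psi,\omega)$ satisfies Assumption A (see context) with constants $C>0$ and $\beta\in(0,1]$, and let $C_1:=\max(C,\frac12)$. Let $F\in L_2(\mathbb R^s,\varphi)$. Let $\emptyset\ne\mathfrak u\subseteq[s]$ and $\mathfrak v\subseteq\mathfrak u$, and for $j\in\mathfrak u$ let $k_j\in N_2\setminus\{0\}$ be such that $k_j=2^{a_{j,1}}+2^{a_{j,2}}\in N_2\setminus N_1$ with $a_{j,1}>a_{j,2}\ge0$ for $j\in\mathfrak v$, and $k_j=2^{a_{j,1}}\in N_1\setminus N_0$ with $a_{j,1}\ge0$ for $j\in\mathfrak u\setminus\mathfrak v$. Then $$\sum_{\boldsymbol m_{\mathfrak v}\in L_{\boldsymbol k_{\mathfrak v},2}}\big|\widehat F^{(\varphi)}((\boldsymbol k_{\mathfrak u},\boldsymbol0),(\boldsymbol m_{\mathfrak v},\boldsymbol0))\big|\le C_1^{|\mathfrak u|}\,\|F\|_{\mathfrak u,\mathfrak v}\prod_{j\in\mathfrak v}\frac{2^{a_{j,2}/2}}{2^{a_{j,1}+\beta a_{j,2}}}\prod_{j\in\mathfrak u\setminus\mathfrak v}\frac1{2^{a_{j,1}}}.$$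
   Context: Notation: $\mathbb N=\{1,2,\dots\}$, $\mathbb N_0=\mathbb N\cup\{0\}$, $[s]=\{1,\dots,s\}$. $\varphi:\mathbb R\to(0,\infty)$ is a differentiable probability density with CDF $\Phi(x)=\int_{-\infty}^x\varphi(t)\,dt$ having a well-defined inverse $\Phi^{-1}:(0,1)\to\mathbb R$; $\varphi(\boldsymbol x)=\prod_{j=1}^s\varphi(x_j)$. Walsh functions: for $k=\sum_{i\ge0}\kappa_i2^i\in\mathbb N_0$ and $x=\sum_{i\ge1}\xi_i2^{-i}\in[0,1)$ (binary digits, infinitely many $\xi_i\ne1$), $\mathrm{wal}_k(x)=(-1)^{\sum_{i\ge0}\kappa_i\xi_{i+1}}$. $N_0=\{0\}$, $N_1=\{0\}\cup\{2^{a}:a\in\mathbb N_0\}$, $N_2=N_1\cup\{2^{a_1}+2^{a_2}:a_1>a_2\ge0\text{ integers}\}$. $L_{k,2}=\{0\}$ for $k\in N_1$ and $L_{k,2}=\{0,\dots,2^{a_2}-1\}$ for $k=2^{a_1}+2^{a_2}\in N_2\setminus N_1$; $L_{\boldsymbol k_{\mathfrak v},2}=\prod_{j\in\mathfrak v}L_{k_j,2}$. Order 2 localized Walsh functions on $[0,1)$: $w_{k,0,2}=\mathrm{wal}_k$ for $k\in N_1$; $w_{k,m,2}(x)=2^{a_2/2}\mathbf 1_{[m/2^{a_2},(m+1)/2^{a_2})}(x)\,\mathrm{wal}_k(x)$ for $k=2^{a_1}+2^{a_2}\in N_2\setminus N_1$, $m\in L_{k,2}$. Cumulated: $W_{k,m,2}(x)=\int_0^xw_{k,m,2}(y)\,dy$,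 $\widetilde W_{k,m,2}(x)=\int_0^xW_{k,m,2}(y)\,dy$. With respect to $\varphi$: $w^{(\varphi)}_{k,m,2}(x)=w_{k,m,2}(\Phi(x))$ and $\widetilde W^{(\varphi)}_{k,m,2}(x)=\widetilde W_{k,m,2}(\Phi(x))$ for $x\in\mathbb R$. Localized Walsh coefficient: $$\widehat F^{(\varphi)}((\boldsymbol k_{\mathfrak u},\boldsymbol0),(\boldsymbol m_{\mathfrak v},\boldsymbol0))=\int_{\mathbb R^s}F(\boldsymbol x)\prod_{j\in\mathfrak v}w^{(\varphi)}_{k_j,m_j,2}(x_j)\prod_{j\in\mathfrak u\setminus\mathfrak v}w^{(\varphi)}_{k_j,0,2}(x_j)\,\varphi(\boldsymbol x)\,d\boldsymbol x.$$ Assumption A (with constants $C>0$, $\beta\in(0,1]$): for every $k=2^{a_1}+2^{a_2}\in N_2\setminus N_1$ ($a_1>a_2\ge0$) and $m\in L_{k,2}$, $$\sup_{x\in\mathbb R}\frac{|\widetilde W^{(\varphi)}_{k,m,2}(x)|}{\varphi(x)\psi(x)}\le C\frac{2^{a_2/2}}{2^{a_1+\beta a_2}}\quad\text{and}\quad\sup_{x\in\mathbb R}\frac{|\widetilde W^{(\varphi)}_{k,m,2}(x)\varphi'(x)|}{\varphi^2(x)\omega(x)}\le C\frac{2^{a_2/2}}{2^{a_1+\beta a_2}}.$$ $F:\mathbb R^s\to\mathbb R$ is assumed sufficiently smooth, meaning the partial derivatives $\frac{\partial^{|\mathfrak u|+|\mathfrak w|}F}{\partial\boldsymbol x_{\mathfrak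 w}\partial\boldsymbol x_{\mathfrak u}}$, $\mathfrak w\subseteq\mathfrak u\subseteq[s]$ (twice in $x_j$ for $j\in\mathfrak w$, once for $j\in\mathfrak u\setminus\mathfrak w$), exist and are continuous, and $$\|F\|_{\mathfrak u,\mathfrak v}=\sum_{\mathfrak w\subseteq\mathfrak v}\int_{\mathbb R^{|\mathfrak u|}}\Big|\int_{\mathbb R^{s-|\mathfrak u|}}\frac{\partial^{|\mathfrak u|+|\mathfrak w|}F}{\partial\boldsymbol x_{\mathfrak w}\partial\boldsymbol x_{\mathfrak u}}(\boldsymbol x)\prod_{j\in[s]\setminus\mathfrak u}\varphi(x_j)\,d\boldsymbol x_{[s]\setminus\mathfrak u}\Big|\prod_{j\in\mathfrak w}\psi(x_j)\prod_{j\in\mathfrak v\setminus\mathfrak w}\omega(x_j)\,d\boldsymbol x_{\mathfrak u}.$$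
   Formalization: Added hypothesis: for each w ⊆ v, the mixed derivative of F times the product of φ(x_j) over j outside u is integrable over {|x_j| ≤ r for j in u} for every r (automatic if u = [s]); without it the bound can fail. *)

theory Defs
  imports "HOL-Analysis.Analysis"
begin

section \<open>Walsh functions\<close>

text \<open>For $x \in [0,1)$ the floor formula yields the digits of the binary expansion of $x$
  that does not end in a tail of ones.\<close>

definition binary_digit :: "real \<Rightarrow> nat \<Rightarrow> nat" where
  "binary_digit x i = nat (\<lfloor>2 ^ i * x\<rfloor> mod 2)"

definition wal :: "nat \<Rightarrow> real \<Rightarrow> real" where
  "wal k x = (-1) ^ (\<Sum>i\<in>{i. bit k i}. binary_digit x (Suc i))"

definition N0 :: "nat set" where
  "N0 = {0}"

definition N1 :: "nat set" where
  "N1 = {0} \<union> range (\<lambda>a. 2 ^ a)"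

definition N2 :: "nat set" where
  "N2 = N1 \<union> {2 ^ a1 + 2 ^ a2 | a1 a2. a2 < a1}"

text \<open>The exponent $a_2$ of $k = 2^{a_1} + 2^{a_2}$, $a_1 > a_2$; only meaningful for
  \<open>k \<in> N2 - N1\<close>.\<close>

definition low_exp :: "nat \<Rightarrow> nat" where
  "low_exp k = (THE a2. \<exists>a1>a2. k = 2 ^ a1 + 2 ^ a2)"

definition L2_idx :: "nat \<Rightarrow> nat set" where
  "L2_idx k = (if k \<in> N1 then {0} else {0..<2 ^ low_exp k})"

definition loc_wal :: "nat \<Rightarrow> nat \<Rightarrow> real \<Rightarrow> real" where
  "loc_wal k m x =
     (if k \<in> N1 then wal k x
      else 2 powr (real (low_exp k) / 2)
           * indicator {real m / 2 ^ low_exp k ..< (real m + 1) / 2 ^ low_exp k} x * wal k x)"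

definition cum_wal :: "nat \<Rightarrow> nat \<Rightarrow> real \<Rightarrow> real" where
  "cum_wal k m x = (LINT y:{0..x}|lborel. loc_wal k m y)"

definition cum2_wal :: "nat \<Rightarrow> nat \<Rightarrow> real \<Rightarrow> real" where
  "cum2_wal k m x = (LINT y:{0..x}|lborel. cum_wal k m y)"


section \<open>Densities and the weight condition\<close>

definition diff_density :: "(real \<Rightarrow> real) \<Rightarrow> bool" where
  "diff_density \<phi> \<longleftrightarrow>
     (\<forall>x. \<phi> x > 0) \<and> (\<forall>x. \<phi> differentiable (at x)) \<and>
     integrable lborel \<phi> \<and> (LINT x|lborel. \<phi> x) = 1"

definition CDF :: "(real \<Rightarrow> real) \<Rightarrow> real \<Rightarrow> real" where
  "CDF \<phi> x = (LINT t:{..x}|lborel. \<phi> t)"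

text \<open>The suprema are taken in the extended reals, so that an unbounded quotient has
  supremum \<open>\<infinity>\<close> and violates the condition.\<close>

definition assumption_A ::
  "(real \<Rightarrow> real) \<Rightarrow> (real \<Rightarrow> real) \<Rightarrow> (real \<Rightarrow> real) \<Rightarrow> real \<Rightarrow> real \<Rightarrow> bool" where
  "assumption_A \<phi> \<psi> \<omega> C \<beta> \<longleftrightarrow>
     (\<forall>k a1 a2 m. k \<in> N2 - N1 \<and> k = 2 ^ a1 + 2 ^ a2 \<and> a2 < a1 \<and> m \<in> L2_idx k \<longrightarrow>
        (SUP x. ereal (\<bar>cum2_wal k m (CDF \<phi> x)\<bar> / (\<phi> x * \<psi> x)))
          \<le> ereal (C * (2 powr (real a2 / 2) / 2 powr (real a1 + \<beta> * real a2))) \<and>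
        (SUP x. ereal (\<bar>cum2_wal k m (CDF \<phi> x) * deriv \<phi> x\<bar> / ((\<phi> x)\<^sup>2 * \<omega> x)))
          \<le> ereal (C * (2 powr (real a2 / 2) / 2 powr (real a1 + \<beta> * real a2))))"


section \<open>Functions on $\mathbb{R}^s$\<close>

text \<open>The index set $[s]$ is the finite type \<open>'s\<close>.\<close>

definition in_L2 :: "(real \<Rightarrow> real) \<Rightarrow> (real ^ 's::finite \<Rightarrow> real) \<Rightarrow> bool" where
  "in_L2 \<phi> F \<longleftrightarrow> F \<in> borel_measurable lborel \<and>
     integrable lborel (\<lambda>x. (F x)\<^sup>2 * (\<Prod>j\<in>UNIV. \<phi> (x $ j)))"

definition loc_wal_coeff ::
  "(real \<Rightarrow> real) \<Rightarrow> (real ^ 's::finite \<Rightarrow> real) \<Rightarrow> 's set \<Rightarrow> 's set \<Rightarrow> ('s \<Rightarrow> nat) \<Rightarrow> ('s \<Rightarrow> nat) \<Rightarrow> real"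
  where
  "loc_wal_coeff \<phi> F u v k m =
     (LINT x|lborel. F x * (\<Prod>j\<in>v. loc_wal (k j) (m j) (CDF \<phi> (x $ j)))
        * (\<Prod>j\<in>u - v. loc_wal (k j) 0 (CDF \<phi> (x $ j))) * (\<Prod>j\<in>UNIV. \<phi> (x $ j)))"


subsection \<open>Mixed partial derivatives\<close>

definition partial_deriv :: "'s::finite \<Rightarrow> (real ^ 's \<Rightarrow> real) \<Rightarrow> real ^ 's \<Rightarrow> real" where
  "partial_deriv j f x = deriv (\<lambda>t. f (x + t *\<^sub>R axis j 1)) 0"

text \<open>The last element of the list is the variable differentiated first.\<close>

definition iter_partial :: "'s::finite list \<Rightarrow> (real ^ 's \<Rightarrow> real) \<Rightarrow> real ^ 's \<Rightarrow> real" where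
  "iter_partial js f = foldr partial_deriv js f"

fun iter_partial_exists :: "'s::finite list \<Rightarrow> (real ^ 's \<Rightarrow> real) \<Rightarrow> bool" where
  "iter_partial_exists [] f \<longleftrightarrow> True"
| "iter_partial_exists (j # js) f \<longleftrightarrow> iter_partial_exists js f \<and>
     (\<forall>x. (\<lambda>t. iter_partial js f (x + t *\<^sub>R axis j 1)) differentiable (at 0))"

definition suff_smooth :: "(real ^ 's::finite \<Rightarrow> real) \<Rightarrow> bool" where
  "suff_smooth F \<longleftrightarrow>
     (\<forall>ws us. distinct ws \<and> distinct us \<and> set ws \<subseteq> set us \<longrightarrow>
        iter_partial_exists (ws @ us) F \<and> continuous_on UNIV (iter_partial (ws @ us) F))"

definition enum_list :: "'s::finite set \<Rightarrow> 's list" where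
  "enum_list A = (SOME js. distinct js \<and> set js = A)"

text \<open>$\partial^{|u|+|w|} F / \partial x_w \partial x_u$. By Schwarz's theorem the chosen
  enumerations do not matter if \<open>suff_smooth F\<close>.\<close>

definition mixed_deriv :: "'s::finite set \<Rightarrow> 's set \<Rightarrow> (real ^ 's \<Rightarrow> real) \<Rightarrow> real ^ 's \<Rightarrow> real" where
  "mixed_deriv w u F = iter_partial (enum_list w @ enum_list u) F"


subsection \<open>The norm\<close>

text \<open>\<open>join u y z\<close> is the point with coordinates \<open>y\<close> in \<open>u\<close> and \<open>z\<close> outside \<open>u\<close>;
  $\mathbb{R}^{|u|}$ carries the product measure of copies of \<open>lborel\<close> indexed by \<open>u\<close>.\<close>

definition join :: "'s::finite set \<Rightarrow> ('s \<Rightarrow> real) \<Rightarrow> ('s \<Rightarrow> real) \<Rightarrow> real ^ 's" where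
  "join u y z = (\<chi> j. if j \<in> u then y j else z j)"

text \<open>The outer integral is a nonnegative Lebesgue integral, so the norm may be \<open>\<infinity>\<close>.\<close>

definition uv_norm ::
  "(real \<Rightarrow> real) \<Rightarrow> (real \<Rightarrow> real) \<Rightarrow> (real \<Rightarrow> real) \<Rightarrow> 's::finite set \<Rightarrow> 's set
   \<Rightarrow> (real ^ 's \<Rightarrow> real) \<Rightarrow> ennreal" where
  "uv_norm \<phi> \<psi> \<omega> u v F =
     (\<Sum>w\<in>Pow v. \<integral>\<^sup>+ y. ennreal (
        \<bar>LINT z|(\<Pi>\<^sub>M j\<in>UNIV - u. lborel).
            mixed_deriv w u F (join u y z) * (\<Prod>j\<in>UNIV - u. \<phi> (z j))\<bar>
        * (\<Prod>j\<in>w. \<psi> (y j)) * (\<Prod>j\<in>v - w. \<omega> (y j))) \<partial>(\<Pi>\<^sub>M j\<in>u. lborel))"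

text \<open>The inner integrals of the norm converge absolutely, locally integrably in $x_u$: this
  makes them genuine integrals and allows differentiating $\int F \prod_{j \notin u}
  \varphi(x_j)\,dx_{[s] \setminus u}$ (weakly) under the integral sign. For \<open>u = UNIV\<close> it is
  automatic, the derivatives being continuous.\<close>

definition inner_locally_integrable ::
  "(real \<Rightarrow> real) \<Rightarrow> 's::finite set \<Rightarrow> 's set \<Rightarrow> (real ^ 's \<Rightarrow> real) \<Rightarrow> bool" where
  "inner_locally_integrable \<phi> u v F \<longleftrightarrow>
     (\<forall>w\<subseteq>v. \<forall>r. set_integrable lborel {x. \<forall>j\<in>u. \<bar>x $ j\<bar> \<le> r}
        (\<lambda>x. mixed_deriv w u F x * (\<Prod>j\<in>UNIV - u. \<phi> (x $ j))))"

end

theory Submission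
  imports Defs
begin

text \<open>
Let \<open>\<Phi>\<close> be the distribution function and \<open>\<rho> = 1 / \<phi>\<close>. For every coordinate the Walsh factor
\<open>w(\<Phi>) \<phi>\<close> is the derivative of \<open>W(\<Phi>)\<close>, and for \<open>j \<in> v\<close> the function \<open>W(\<Phi>)\<close> is in
turn \<open>\<rho>\<close> times the derivative of the twice cumulated function \<open>W2(\<Phi>)\<close>. One integration by parts in
each coordinate of \<open>u\<close> turns \<open>F\<close> into its mixed derivative in the directions of \<open>u\<close>. A second one in
each coordinate of \<open>v\<close> differentiates the product of that derivative with all the factors \<open>\<rho>\<close>: the
product rule gives a sum over \<open>w \<subseteq> v\<close>, in which the coordinates of \<open>w\<close> carry the kernel
\<open>W2(\<Phi>) \<rho>\<close> and those of \<open>v - w\<close> carry \<open>W2(\<Phi>) \<rho>'\<close> with \<open>\<rho>' = - \<phi>' / \<phi>\<^sup>2\<close>. Assumption A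
bounds these kernels by the weights \<open>\<psi>\<close> and \<open>\<omega>\<close>, and a coordinate in \<open>u - v\<close> keeps
\<open>\<bar>W\<bar> \<le> 1/2 * 2^(-a1)\<close>. This is the norm of \<open>F\<close> with the stated constants. The sum over the localizations
\<open>m\<close> is free of charge because the functions \<open>W2\<close> for different \<open>m\<close> have disjoint supports
(\<open>sum_abs_cum2_wal_le\<close>).

The boundary terms at infinity are avoided by truncation. Since \<open>W2\<close> vanishes to second order at 0
and at 1, it can be multiplied by cutoffs on the unit interval such that its second derivative stays
bounded and converges pointwise (\<open>cutV_facts\<close>). Hence the coefficient is the limit of coefficients with
compactly supported kernels (\<open>coeff_limit\<close>), and these obey a bound in which the truncation no longer
appears (\<open>truncated_coeff_le\<close>).

The delicate point is the second integration by parts. The density is only differentiable, so \<open>\<phi>'\<close> may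
fail to be locally integrable; finiteness of the norm controls it only after multiplication with the
inner integral over the coordinates outside \<open>u\<close>. That inner integral, in turn, is merely absolutely
continuous in each coordinate, and differentiable in a weak sense. Integration by parts still holds for
the product of an everywhere differentiable function and an absolutely continuous one, in the sense of the
gauge integral (\<open>ibp_HK\<close>), and the Lebesgue integrability of the whole integrand converts this into a
statement on Lebesgue integrals (\<open>parametric_ibp\<close>). In several variables the coordinates of \<open>v\<close> are
treated one at a time, each on almost every line, and Fubini's theorem transfers the integrability from one
stage to the next (\<open>rough_integration_by_parts\<close>).
\<close>

section \<open>Integration by parts against an everywhere differentiable function\<close>

text \<open>The derivative \<open>\<rho>'\<close> need not be Lebesgue integrable, so the rule is proved for the
gauge integral, in which every derivative is integrable. For an increasing \<open>g = \<integral>h\<close> the second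
mean value theorem evaluates \<open>\<integral>\<rho>' g\<close> on a short interval up to replacing \<open>\<rho>\<close> by one of its
values there. The defect of the integration by parts formula is therefore an additive interval
function bounded by \<open>\<epsilon> \<integral>h\<close> on all short intervals, hence on \<open>{a..b}\<close>, for every \<open>\<epsilon>\<close>.\<close>
lemma ibp_HK_nonneg:
  fixes \<rho> \<rho>' h :: "real \<Rightarrow> real"
  assumes ab: "a \<le> b"
    and d: "\<And>x. x \<in> {a..b} \<Longrightarrow> (\<rho> has_real_derivative \<rho>' x) (at x)"
    and h: "h integrable_on {a..b}" and h0: "\<And>x. x \<in> {a..b} \<Longrightarrow> 0 \<le> h x"
  shows "((\<lambda>x. \<rho>' x * integral {a..x} h + \<rho> x * h x) has_integral \<rho> b * integral {a..b} h) {a..b}"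
proof -
  define g where "g x = integral {a..x} h" for x
  have cont: "continuous_on {a..b} \<rho>"
    using d by (meson DERIV_isCont continuous_at_imp_continuous_on)
  have hsub: "h integrable_on {c..e}" if "a \<le> c" "e \<le> b" for c e
    using integrable_subinterval_real[OF h] that by auto
  have gdiff: "g e - g c = integral {c..e} h" if "a \<le> c" "c \<le> e" "e \<le> b" for c e
    using Henstock_Kurzweil_Integration.integral_combine[of a c e h] that hsub unfolding g_def by auto
  have gmono: "g x \<le> g y" if "a \<le> x" "x \<le> y" "y \<le> b" for x y
    using gdiff[OF that] integral_nonneg[of h "{x..y}"] hsub h0 that by force
  have r': "(\<rho>' has_integral \<rho> e - \<rho> c) {c..e}" if "a \<le> c" "c \<le> e" "e \<le> b" for c e
    using that by (intro fundamental_theorem_of_calculus)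
      (auto intro!: d[THEN DERIV_subset] simp flip: has_real_derivative_iff_has_vector_derivative)
  have smv: "\<exists>\<xi>\<in>{c..e}. ((\<lambda>x. \<rho>' x * g x) has_integral
      g e * \<rho> e - g c * \<rho> c - \<rho> \<xi> * (g e - g c)) {c..e}" if ce: "a \<le> c" "c \<le> e" "e \<le> b" for c e
  proof -
    have *: "\<rho>' integrable_on {c..e}" using r'[OF ce] by blast
    obtain \<xi> where \<xi>: "\<xi> \<in> {c..e}"
      "((\<lambda>x. g x * \<rho>' x) has_integral (g c * integral {c..\<xi>} \<rho>' + g e * integral {\<xi>..e} \<rho>')) {c..e}"
      by (rule second_mean_value_theorem_full[OF *, of g]) (use ce gmono in auto)
    have "integral {c..\<xi>} \<rho>' = \<rho> \<xi> - \<rho> c" "integral {\<xi>..e} \<rho>' = \<rho> e - \<rho> \<xi>"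
      using r' \<xi>(1) ce by (auto intro!: integral_unique)
    with \<xi> show ?thesis by (intro bexI[of _ \<xi>]) (auto simp: algebra_simps)
  qed
  have int1: "(\<lambda>x. \<rho>' x * g x) integrable_on {c..e}" if "a \<le> c" "c \<le> e" "e \<le> b" for c e
    using smv[OF that] by blast
  have h_abs: "h absolutely_integrable_on {a..b}"
    using h h0 by (intro nonnegative_absolutely_integrable_1) auto
  have "\<rho> \<in> borel_measurable (lebesgue_on {a..b})"
    using cont by (rule continuous_imp_measurable_on_sets_lebesgue) simp
  then have int2: "(\<lambda>x. \<rho> x * h x) absolutely_integrable_on {a..b}"
    by (rule absolutely_integrable_bounded_measurable_product_real)
      (auto intro!: compact_imp_bounded compact_continuous_image cont h_abs)
  have int2': "(\<lambda>x. \<rho> x * h x) integrable_on {c..e}" if "a \<le> c" "e \<le> b" for c e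
    using integrable_subinterval_real[OF set_lebesgue_integral_eq_integral(1)[OF int2]] that by auto
  define I where "I x = integral {a..x} (\<lambda>x. \<rho>' x * g x + \<rho> x * h x)" for x
  \<comment> \<open>the defect of the formula on \<open>{a..x}\<close>\<close>
  define E where "E x = \<rho> x * g x - I x" for x
  have Idiff: "I e - I c = integral {c..e} (\<lambda>x. \<rho>' x * g x) + integral {c..e} (\<lambda>x. \<rho> x * h x)"
    if "a \<le> c" "c \<le> e" "e \<le> b" for c e
  proof -
    have "(\<lambda>x. \<rho>' x * g x + \<rho> x * h x) integrable_on {a..e}"
      using int1 int2' that by (intro integrable_add) auto
    then have "I e - I c = integral {c..e} (\<lambda>x. \<rho>' x * g x + \<rho> x * h x)"
      unfolding I_def using Henstock_Kurzweil_Integration.integral_combine[of a c e] that by force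
    then show ?thesis using int1 int2' that by (simp add: Henstock_Kurzweil_Integration.integral_add)
  qed
  have key: "\<bar>E b - E a\<bar> \<le> \<epsilon> * (g b - g a)" if eps: "\<epsilon> > 0" for \<epsilon>
  proof -
    \<comment> \<open>an additive estimate, so it passes from short intervals to long ones by bisection\<close>
    define P where "P c e \<longleftrightarrow> (a \<le> c \<longrightarrow> c \<le> e \<longrightarrow> e \<le> b \<longrightarrow> \<bar>E e - E c\<bar> \<le> \<epsilon> * (g e - g c))" for c e
    have "P a b"
    proof (induction rule: Bolzano[OF ab])
      case (1 x y z)
      show ?case unfolding P_def
      proof (intro impI)
        assume "a \<le> x" "x \<le> z" "z \<le> b"
        then have "\<bar>E y - E x\<bar> \<le> \<epsilon> * (g y - g x)" "\<bar>E z - E y\<bar> \<le> \<epsilon> * (g z - g y)"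
          using 1 by (auto simp: P_def)
        moreover have "\<epsilon> * (g z - g x) = \<epsilon> * (g y - g x) + \<epsilon> * (g z - g y)"
          by (simp add: algebra_simps)
        ultimately show "\<bar>E z - E x\<bar> \<le> \<epsilon> * (g z - g x)" by linarith
      qed
    next
      case (2 x)
      have "isCont \<rho> x" using d 2 by (auto intro: DERIV_isCont)
      then have "\<exists>\<delta>>0. \<forall>y. \<bar>y - x\<bar> < \<delta> \<longrightarrow> \<bar>\<rho> y - \<rho> x\<bar> < \<epsilon>/2"
        using half_gt_zero[OF eps] unfolding continuous_at_eps_delta dist_real_def by blast
      then obtain \<delta> where \<delta>: "\<delta> > 0" "\<And>y. \<bar>y - x\<bar> < \<delta> \<Longrightarrow> \<bar>\<rho> y - \<rho> x\<bar> < \<epsilon>/2"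
        by blast
      show ?case
      proof (intro exI conjI allI impI)
        fix c e assume ce: "c \<le> x \<and> x \<le> e \<and> e - c < \<delta>"
        show "P c e" unfolding P_def
        proof (intro impI)
          assume *: "a \<le> c" "c \<le> e" "e \<le> b"
          obtain \<xi> where \<xi>: "\<xi> \<in> {c..e}" "integral {c..e} (\<lambda>x. \<rho>' x * g x) =
              g e * \<rho> e - g c * \<rho> c - \<rho> \<xi> * (g e - g c)"
            using smv[OF *] by (auto dest: integral_unique)
          have near: "\<bar>\<rho> y - \<rho> \<xi>\<bar> \<le> \<epsilon>" if "y \<in> {c..e}" for y
          proof -
            have "\<bar>\<rho> y - \<rho> x\<bar> < \<epsilon>/2" "\<bar>\<rho> \<xi> - \<rho> x\<bar> < \<epsilon>/2"
              using \<delta>(2) ce that \<xi>(1) by auto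
            then show ?thesis by linarith
          qed
          have "E e - E c = \<rho> \<xi> * integral {c..e} h - integral {c..e} (\<lambda>x. \<rho> x * h x)"
            using Idiff[OF *] \<xi>(2) gdiff[OF *] unfolding E_def by (simp add: algebra_simps)
          also have "\<dots> = - integral {c..e} (\<lambda>x. (\<rho> x - \<rho> \<xi>) * h x)"
            using hsub[of c e] int2'[of c e] * 
            by (simp add: left_diff_distrib Henstock_Kurzweil_Integration.integral_diff integrable_on_mult_right)
          finally have eq: "\<bar>E e - E c\<bar> = \<bar>integral {c..e} (\<lambda>x. (\<rho> x - \<rho> \<xi>) * h x)\<bar>" by simp
          also have "\<dots> \<le> integral {c..e} (\<lambda>x. \<epsilon> * h x)"
          proof -
            have "(\<lambda>x. (\<rho> x - \<rho> \<xi>) * h x) integrable_on {c..e}"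
              unfolding left_diff_distrib using hsub[of c e] int2'[of c e] *
              by (intro integrable_diff) (auto intro: integrable_on_mult_right)
            moreover have "(\<lambda>x. \<epsilon> * h x) integrable_on {c..e}"
              using hsub[of c e] * by (auto intro: integrable_on_mult_right)
            moreover have "norm ((\<rho> x - \<rho> \<xi>) * h x) \<le> \<epsilon> * h x" if "x \<in> {c..e}" for x
              using near[OF that] h0[of x] that * by (auto simp: abs_mult intro!: mult_right_mono)
            ultimately have "norm (integral {c..e} (\<lambda>x. (\<rho> x - \<rho> \<xi>) * h x)) \<le> integral {c..e} (\<lambda>x. \<epsilon> * h x)"
              by (rule integral_norm_bound_integral)
            then show ?thesis by simp
          qed
          finally show "\<bar>E e - E c\<bar> \<le> \<epsilon> * (g e - g c)" using gdiff[OF *] by simp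
        qed
      qed (use \<delta> in auto)
    qed
    then show ?thesis using ab by (simp add: P_def)
  qed
  have "E b - E a = 0"
  proof (rule ccontr)
    assume "E b - E a \<noteq> 0"
    then have pos: "\<bar>E b - E a\<bar> > 0" by simp
    define G where "G = \<bar>g b - g a\<bar> + 1"
    have G: "G > 0" unfolding G_def by simp
    have "\<bar>E b - E a\<bar> \<le> (\<bar>E b - E a\<bar> / (2 * G)) * (g b - g a)"
      using pos G by (intro key) (auto simp: divide_simps)
    also have "\<dots> \<le> (\<bar>E b - E a\<bar> / (2 * G)) * G"
      using pos G by (intro mult_left_mono) (auto simp: G_def)
    also have "\<dots> = \<bar>E b - E a\<bar> / 2" using G by simp
    finally show False using pos by simp
  qed
  then have "I b = \<rho> b * g b" by (simp add: E_def g_def I_def)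
  moreover have "(\<lambda>x. \<rho>' x * g x + \<rho> x * h x) integrable_on {a..b}"
    using int1 int2' ab by (intro integrable_add) auto
  ultimately show ?thesis unfolding I_def g_def by (metis integrable_integral)
qed

text \<open>An absolutely continuous \<open>g\<close> is a difference of two increasing ones.\<close>
lemma ibp_HK:
  fixes \<rho> \<rho>' h g :: "real \<Rightarrow> real"
  assumes ab: "a \<le> b"
    and d: "\<And>x. x \<in> {a..b} \<Longrightarrow> (\<rho> has_real_derivative \<rho>' x) (at x)"
    and h: "h absolutely_integrable_on {a..b}"
    and g: "\<And>x. x \<in> {a..b} \<Longrightarrow> g x = g a + integral {a..x} h"
  shows "((\<lambda>x. \<rho>' x * g x + \<rho> x * h x) has_integral \<rho> b * g b - \<rho> a * g a) {a..b}"
proof -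
  define hp hm where "hp x = max (h x) 0" and "hm x = max (- h x) 0" for x
  have hi: "hp integrable_on {a..b}" "hm integrable_on {a..b}"
    unfolding hp_def hm_def
    using absolutely_integrable_max_1[OF h, of "\<lambda>_. 0"] absolutely_integrable_max_1[of "{a..b}" "\<lambda>x. - h x" "\<lambda>_. 0"] h
    by (auto intro!: set_lebesgue_integral_eq_integral(1) simp: set_integrable_def)
  have sub: "hp integrable_on {a..x}" "hm integrable_on {a..x}" if "x \<in> {a..b}" for x
    using integrable_subinterval_real[OF hi(1), of a x] integrable_subinterval_real[OF hi(2), of a x] that by auto
  have hd: "h x = hp x - hm x" for x by (auto simp: hp_def hm_def)
  have gd: "g x = g a + (integral {a..x} hp - integral {a..x} hm)" if "x \<in> {a..b}" for x
    unfolding g[OF that] using sub[OF that]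
    by (simp add: hd[abs_def] Henstock_Kurzweil_Integration.integral_diff)
  have p: "((\<lambda>x. \<rho>' x * integral {a..x} hp + \<rho> x * hp x) has_integral \<rho> b * integral {a..b} hp) {a..b}"
    by (rule ibp_HK_nonneg[OF ab d hi(1)]) (auto simp: hp_def)
  have m: "((\<lambda>x. \<rho>' x * integral {a..x} hm + \<rho> x * hm x) has_integral \<rho> b * integral {a..b} hm) {a..b}"
    by (rule ibp_HK_nonneg[OF ab d hi(2)]) (auto simp: hm_def)
  have "(\<rho>' has_integral \<rho> b - \<rho> a) {a..b}"
    using ab by (intro fundamental_theorem_of_calculus)
      (auto intro!: d[THEN DERIV_subset] simp flip: has_real_derivative_iff_has_vector_derivative)
  from has_integral_add[OF has_integral_mult_right[OF this, of "g a"] has_integral_diff[OF p m]]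
  have "((\<lambda>x. g a * \<rho>' x + (\<rho>' x * integral {a..x} hp + \<rho> x * hp x - (\<rho>' x * integral {a..x} hm + \<rho> x * hm x)))
    has_integral g a * (\<rho> b - \<rho> a) + (\<rho> b * integral {a..b} hp - \<rho> b * integral {a..b} hm)) {a..b}" .
  moreover have "g a * (\<rho> b - \<rho> a) + (\<rho> b * integral {a..b} hp - \<rho> b * integral {a..b} hm) = \<rho> b * g b - \<rho> a * g a"
  proof -
    have "g b = g a + (integral {a..b} hp - integral {a..b} hm)" using gd[of b] ab by simp
    then show ?thesis by (simp only:) (simp add: algebra_simps)
  qed
  moreover have "g a * \<rho>' x + (\<rho>' x * integral {a..x} hp + \<rho> x * hp x - (\<rho>' x * integral {a..x} hm + \<rho> x * hm x))
     = \<rho>' x * g x + \<rho> x * h x" if "x \<in> {a..b}" for x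
    unfolding gd[OF that] hd by (simp add: algebra_simps)
  ultimately show ?thesis by (auto intro: has_integral_eq[rotated])
qed

lemma integrable_lborel_imp_HK:
  fixes f :: "real \<Rightarrow> real"
  assumes "integrable lborel (\<lambda>x. indicator S x * f x)"
  shows "(f has_integral (LINT x|lborel. indicator S x * f x)) S"
proof -
  have "((\<lambda>x. indicator S x * f x) has_integral (LINT x|lborel. indicator S x * f x)) UNIV"
    by (rule has_integral_integral_lborel[OF assms])
  then have "((\<lambda>x. if x \<in> S then f x else 0) has_integral (LINT x|lborel. indicator S x * f x)) UNIV"
    by (rule back_subst[where P="\<lambda>h. (h has_integral _) UNIV"]) (auto simp: indicator_def)
  then show ?thesis unfolding has_integral_restrict_UNIV .
qed

lemma integrable_lborel_imp_absolutely_integrable: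
  fixes f :: "real \<Rightarrow> real"
  assumes "integrable lborel (\<lambda>x. indicator S x * f x)"
  shows "f absolutely_integrable_on S"
  using integrable_completion[of "\<lambda>x. indicator S x * f x" lborel] assms
  by (simp add: set_integrable_def)

text \<open>The one-coordinate step of the second integration by parts. The parameter \<open>z\<close> collects the
coordinates that are integrated out; after that integration the family \<open>f\<close> is known to be smooth
in \<open>t\<close> only in the weak sense that its average \<open>g\<close> is absolutely continuous with derivative
\<open>g'\<close>. Integrability is assumed only for the complete integrand \<open>V (\<rho> g' + \<rho>' g)\<close>,
because \<open>\<rho>'\<close> alone may fail to be locally integrable.\<close>
lemma parametric_ibp:
  fixes M :: "'z measure" and f f' :: "real \<Rightarrow> 'z \<Rightarrow> real" and \<rho> \<rho>' V V' :: "real \<Rightarrow> real"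
  defines "g \<equiv> \<lambda>t. LINT z|M. f t z" and "g' \<equiv> \<lambda>t. LINT z|M. f' t z"
  assumes M: "sigma_finite_measure M" and R: "0 < R"
    and f: "integrable (lborel \<Otimes>\<^sub>M M) (\<lambda>(t, z). indicator {-R..R} t * f t z)"
    and f': "integrable (lborel \<Otimes>\<^sub>M M) (\<lambda>(t, z). indicator {-R..R} t * f' t z)"
    and der: "\<And>t z. z \<in> space M \<Longrightarrow> ((\<lambda>t. f t z) has_real_derivative f' t z) (at t)"
    and \<rho>: "\<And>t. (\<rho> has_real_derivative \<rho>' t) (at t)"
    and V: "\<And>t. (V has_real_derivative V' t) (at t)" "V (-R) = 0" "V R = 0"
    and V': "continuous_on UNIV V'"
    and int: "integrable lborel (\<lambda>t. indicator {-R..R} t * (V t * (\<rho> t * g' t + \<rho>' t * g t)))"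
  shows "(LINT t|lborel. indicator {-R..R} t * (V t * (\<rho> t * g' t + \<rho>' t * g t)))
       = - (LINT t|lborel. indicator {-R..R} t * (V' t * \<rho> t * g t))"
proof -
  interpret M: sigma_finite_measure M by fact
  interpret P: pair_sigma_finite lborel M ..
  have AEf: "AE t in lborel. integrable M (\<lambda>z. indicator {-R..R} t * f t z)"
    using P.AE_integrable_fst'[OF f] by simp
  have g_int: "integrable lborel (\<lambda>t. indicator {-R..R} t * g t)"
    using P.integrable_fst'[OF f] by (simp add: g_def)
  have g'_int: "integrable lborel (\<lambda>t. indicator {-R..R} t * g' t)"
    using P.integrable_fst'[OF f'] by (simp add: g'_def)
  have "AE z in M. integrable lborel (\<lambda>t. indicator {-R..R} t * f' t z)"
    using P.AE_integrable_snd[of "\<lambda>t z. indicator {-R..R} t * f' t z"] f' by simp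
  then have AEz: "AE z in M. z \<in> space M \<longrightarrow> (\<forall>t\<in>{-R..R}. f t z - f (-R) z = (LINT s|lborel. indicator {-R..t} s * f' s z))"
  proof eventually_elim
    case (elim z)
    show ?case
    proof (intro impI ballI)
      fix t assume z: "z \<in> space M" and t: "t \<in> {-R..R}"
      have "((\<lambda>s. f' s z) has_integral f t z - f (-R) z) {-R..t}"
        using t by (intro fundamental_theorem_of_calculus)
          (auto intro!: der[OF z, THEN DERIV_subset] simp flip: has_real_derivative_iff_has_vector_derivative)
      moreover have "integrable lborel (\<lambda>s. indicator {-R..t} s * f' s z)"
      proof -
        have "integrable lborel (\<lambda>s. indicator {-R..t} s *\<^sub>R (indicator {-R..R} s * f' s z))"
          by (rule integrable_mult_indicator[OF _ elim]) simp
        then show ?thesis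
          by (rule back_subst[where P="integrable lborel"]) (use t in \<open>auto simp: fun_eq_iff indicator_def\<close>)
      qed
      ultimately show "f t z - f (-R) z = (LINT s|lborel. indicator {-R..t} s * f' s z)"
        by (intro has_integral_unique[OF _ integrable_lborel_imp_HK])
    qed
  qed
  have int_t: "integrable M (\<lambda>z. LINT s|lborel. indicator {-R..t} s * f' s z)"
      "(LINT z|M. LINT s|lborel. indicator {-R..t} s * f' s z) = (LINT s|lborel. indicator {-R..t} s * g' s)"
      if "t \<in> {-R..R}" for t
  proof -
    have *: "integrable (lborel \<Otimes>\<^sub>M M) (\<lambda>(s, z). indicator {-R..t} s * f' s z)"
    proof (rule Bochner_Integration.integrable_cong[THEN iffD1, OF refl])
      show "integrable (lborel \<Otimes>\<^sub>M M) (\<lambda>p. indicator ({-R..t} \<times> space M) p *\<^sub>R (case p of (s, z) \<Rightarrow> indicator {-R..R} s * f' s z))"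
        by (intro integrable_mult_indicator f') auto
    qed (use that in \<open>auto simp: indicator_def space_pair_measure\<close>)
    show "integrable M (\<lambda>z. LINT s|lborel. indicator {-R..t} s * f' s z)"
      using P.integrable_snd[OF *] .
    show "(LINT z|M. LINT s|lborel. indicator {-R..t} s * f' s z) = (LINT s|lborel. indicator {-R..t} s * g' s)"
      using P.Fubini_integral[OF *] by (simp add: g'_def)
  qed
  \<comment> \<open>almost every section of \<open>f\<close> is integrable; transporting one of them along \<open>f'\<close> makes them all so\<close>
  have "\<exists>c\<in>{-R..R}. integrable M (f c)"
  proof (rule ccontr)
    assume "\<not> (\<exists>c\<in>{-R..R}. integrable M (f c))"
    then have no: "\<not> integrable M (f c)" if "c \<in> {-R..R}" for c using that by blast
    from AEf have "AE t in lborel. t \<notin> {-R..R}"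
      by eventually_elim (use no in \<open>auto simp: indicator_def\<close>)
    then have "emeasure lborel {-R..R} = 0"
      by (subst AE_iff_measurable[symmetric, where P="\<lambda>t. t \<notin> {-R..R}"]) auto
    then show False using R by simp
  qed
  then obtain c where c: "c \<in> {-R..R}" "integrable M (f c)" by blast
  have fM: "f t \<in> borel_measurable M" if "t \<in> {-R..R}" for t
  proof -
    have "(\<lambda>z. indicator {-R..R} t * f t z) \<in> borel_measurable M"
      using borel_measurable_integrable[OF f] by measurable
    then show ?thesis using that by simp
  qed
  have f0: "integrable M (f (-R))"
  proof (rule Bochner_Integration.integrable_cong_AE_imp)
    show "integrable M (\<lambda>z. f c z - (LINT s|lborel. indicator {-R..c} s * f' s z))"
      using c int_t(1)[OF c(1)] by simp
    show "AE z in M. f c z - (LINT s|lborel. indicator {-R..c} s * f' s z) = f (-R) z"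
      using AEz AE_space by eventually_elim (use c in force)
  qed (use fM R in auto)
  have gg: "g t = g (-R) + integral {-R..t} g'" if t: "t \<in> {-R..R}" for t
  proof -
    have "g t = (LINT z|M. f (-R) z + (LINT s|lborel. indicator {-R..t} s * f' s z))"
      unfolding g_def
    proof (rule integral_cong_AE)
      show "AE z in M. f t z = f (-R) z + (LINT s|lborel. indicator {-R..t} s * f' s z)"
        using AEz AE_space by eventually_elim (use t in force)
    qed (use fM[OF t] fM[of "-R"] R borel_measurable_integrable[OF int_t(1)[OF t]] in auto)
    also have "\<dots> = g (-R) + (LINT s|lborel. indicator {-R..t} s * g' s)"
      using f0 int_t[OF t] by (simp add: g_def)
    also have "(LINT s|lborel. indicator {-R..t} s * g' s) = integral {-R..t} g'"
    proof -
      have "integrable lborel (\<lambda>s. indicator {-R..t} s *\<^sub>R (indicator {-R..R} s * g' s))"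
        by (rule integrable_mult_indicator[OF _ g'_int]) simp
      then have "integrable lborel (\<lambda>s. indicator {-R..t} s * g' s)"
        by (rule back_subst[where P="integrable lborel"]) (use t in \<open>auto simp: fun_eq_iff indicator_def\<close>)
      from integrable_lborel_imp_HK[OF this] show ?thesis by (simp add: integral_unique)
    qed
    finally show ?thesis .
  qed
  have ibp: "((\<lambda>t. (V' t * \<rho> t + \<rho>' t * V t) * g t + (V t * \<rho> t) * g' t) has_integral
      (V R * \<rho> R) * g R - (V (-R) * \<rho> (-R)) * g (-R)) {-R..R}"
  proof (rule ibp_HK[OF _ DERIV_mult[OF V(1) \<rho>] _ gg])
    show "g' absolutely_integrable_on {-R..R}"
      by (rule integrable_lborel_imp_absolutely_integrable[OF g'_int])
  qed (use R in auto)
  have contV\<rho>: "continuous_on {-R..R} (\<lambda>t. V' t * \<rho> t)"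
    by (intro continuous_on_mult continuous_on_subset[OF V'] continuous_at_imp_continuous_on ballI DERIV_isCont[OF \<rho>]) auto
  have int2: "integrable lborel (\<lambda>t. indicator {-R..R} t * (V' t * \<rho> t * g t))"
  proof -
    have "bounded ((\<lambda>t. V' t * \<rho> t) ` {-R..R})"
      by (intro compact_imp_bounded compact_continuous_image contV\<rho>) simp
    then have "\<exists>B. \<forall>t\<in>{-R..R}. \<bar>V' t * \<rho> t\<bar> \<le> B"
      unfolding bounded_iff by auto
    then obtain B where B: "\<And>t. t \<in> {-R..R} \<Longrightarrow> \<bar>V' t * \<rho> t\<bar> \<le> B"
      by blast
    have m: "(\<lambda>t. indicator {-R..R} t * (V' t * \<rho> t)) \<in> borel_measurable lborel"
      using borel_measurable_continuous_on_indicator[OF _ contV\<rho>] by simp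
    show ?thesis
    proof (rule Bochner_Integration.integrable_bound)
      show "integrable lborel (\<lambda>t. B * (indicator {-R..R} t * g t))" using g_int by simp
      have "(\<lambda>t. (indicator {-R..R} t * (V' t * \<rho> t)) * (indicator {-R..R} t * g t)) \<in> borel_measurable lborel"
        using m borel_measurable_integrable[OF g_int] by measurable
      then show "(\<lambda>t. indicator {-R..R} t * (V' t * \<rho> t * g t)) \<in> borel_measurable lborel"
        by (rule back_subst[where P="\<lambda>h. h \<in> borel_measurable lborel"]) (auto simp: fun_eq_iff indicator_def)
      show "AE t in lborel. norm (indicator {-R..R} t * (V' t * \<rho> t * g t)) \<le> norm (B * (indicator {-R..R} t * g t))"
        using B by (intro AE_I2) (auto simp: indicator_def abs_mult intro!: mult_right_mono intro: order_trans[OF _ abs_ge_self])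
    qed
  qed
  have "((\<lambda>t. V' t * \<rho> t * g t + V t * (\<rho> t * g' t + \<rho>' t * g t)) has_integral
      (LINT t|lborel. indicator {-R..R} t * (V' t * \<rho> t * g t)) +
      (LINT t|lborel. indicator {-R..R} t * (V t * (\<rho> t * g' t + \<rho>' t * g t)))) {-R..R}"
    by (intro has_integral_add integrable_lborel_imp_HK int int2)
  moreover have "((\<lambda>t. V' t * \<rho> t * g t + V t * (\<rho> t * g' t + \<rho>' t * g t)) has_integral 0) {-R..R}"
    using ibp V by (simp add: algebra_simps)
  ultimately have "(LINT t|lborel. indicator {-R..R} t * (V' t * \<rho> t * g t)) +
      (LINT t|lborel. indicator {-R..R} t * (V t * (\<rho> t * g' t + \<rho>' t * g t))) = 0"
    by (rule has_integral_unique)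
  then show ?thesis by linarith
qed

section \<open>Mixed partial derivatives\<close>

lemma mixed_difference_mean_value:
  fixes h hs hst :: "real \<Rightarrow> real \<Rightarrow> real"
  assumes hs: "\<And>s t. ((\<lambda>s. h s t) has_real_derivative hs s t) (at s)"
    and hst: "\<And>s t. ((\<lambda>t. hs s t) has_real_derivative hst s t) (at t)"
    and a: "0 < a"
  shows "\<exists>\<xi> \<eta>. 0 < \<xi> \<and> \<xi> < a \<and> 0 < \<eta> \<and> \<eta> < a \<and> h a a - h 0 a - h a 0 + h 0 0 = a * a * hst \<xi> \<eta>"
proof -
  have "\<exists>\<xi>. 0 < \<xi> \<and> \<xi> < a \<and> (h a a - h a 0) - (h 0 a - h 0 0) = (a - 0) * (hs \<xi> a - hs \<xi> 0)"
    by (rule MVT2[OF a, of "\<lambda>s. h s a - h s 0"]) (intro DERIV_diff hs)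
  then obtain \<xi> where \<xi>: "0 < \<xi>" "\<xi> < a" "(h a a - h a 0) - (h 0 a - h 0 0) = (a - 0) * (hs \<xi> a - hs \<xi> 0)"
    by blast
  have "\<exists>\<eta>. 0 < \<eta> \<and> \<eta> < a \<and> hs \<xi> a - hs \<xi> 0 = (a - 0) * hst \<xi> \<eta>"
    by (rule MVT2[OF a]) (rule hst)
  then obtain \<eta> where \<eta>: "0 < \<eta>" "\<eta> < a" "hs \<xi> a - hs \<xi> 0 = (a - 0) * hst \<xi> \<eta>"
    by blast
  have "h a a - h 0 a - h a 0 + h 0 0 = (h a a - h a 0) - (h 0 a - h 0 0)" by simp
  also have "\<dots> = a * a * hst \<xi> \<eta>" unfolding \<xi>(3) \<eta>(3) by simp
  finally show ?thesis using \<xi> \<eta> by blast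
qed

text \<open>Both mixed derivatives are limits of the same second difference quotient
\<open>(h a a - h 0 a - h a 0 + h 0 0) / a\<^sup>2\<close>.\<close>
lemma schwarz_plane:
  fixes h hs ht hst hts :: "real \<Rightarrow> real \<Rightarrow> real"
  assumes hs: "\<And>s t. ((\<lambda>s. h s t) has_real_derivative hs s t) (at s)"
    and hst: "\<And>s t. ((\<lambda>t. hs s t) has_real_derivative hst s t) (at t)"
    and ht: "\<And>s t. ((\<lambda>t. h s t) has_real_derivative ht s t) (at t)"
    and hts: "\<And>s t. ((\<lambda>s. ht s t) has_real_derivative hts s t) (at s)"
    and c1: "isCont (\<lambda>p. hst (fst p) (snd p)) (0, 0)"
    and c2: "isCont (\<lambda>p. hts (fst p) (snd p)) (0, 0)"
  shows "hst 0 0 = hts 0 0"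
proof (rule ccontr)
  assume "hst 0 0 \<noteq> hts 0 0"
  define e where "e = \<bar>hst 0 0 - hts 0 0\<bar> / 2"
  have e: "e > 0" using \<open>hst 0 0 \<noteq> hts 0 0\<close> by (simp add: e_def)
  obtain d1 where d1: "d1 > 0" "\<And>p. dist p (0,0) < d1 \<Longrightarrow> dist (hst (fst p) (snd p)) (hst 0 0) < e"
    using c1 e unfolding continuous_at_eps_delta by fastforce
  obtain d2 where d2: "d2 > 0" "\<And>p. dist p (0,0) < d2 \<Longrightarrow> dist (hts (fst p) (snd p)) (hts 0 0) < e"
    using c2 e unfolding continuous_at_eps_delta by fastforce
  define a where "a = min d1 d2 / 2"
  have a: "a > 0" "2 * a \<le> d1" "2 * a \<le> d2" using d1 d2 by (auto simp: a_def)
  have small: "dist (x, y) (0, 0) < 2 * a" if "0 < x" "x < a" "0 < y" "y < a" for x y :: real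
    using that sqrt_sum_squares_le_sum_abs[of x y] by (simp add: dist_Pair_Pair)
  obtain \<xi> \<eta> where 1: "0 < \<xi>" "\<xi> < a" "0 < \<eta>" "\<eta> < a" "h a a - h 0 a - h a 0 + h 0 0 = a * a * hst \<xi> \<eta>"
    using mixed_difference_mean_value[of h hs hst, OF hs hst a(1)] by blast
  obtain \<eta>' \<xi>' where 2: "0 < \<xi>'" "\<xi>' < a" "0 < \<eta>'" "\<eta>' < a" "h a a - h a 0 - h 0 a + h 0 0 = a * a * hts \<xi>' \<eta>'"
    using mixed_difference_mean_value[of "\<lambda>t s. h s t" "\<lambda>t s. ht s t" "\<lambda>t s. hts s t", OF ht hts a(1)] by blast
  have "a * a * hst \<xi> \<eta> = a * a * hts \<xi>' \<eta>'" using 1(5) 2(5) by linarith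
  then have eq: "hst \<xi> \<eta> = hts \<xi>' \<eta>'" using a by simp
  have "\<bar>hst \<xi> \<eta> - hst 0 0\<bar> < e"
    using d1(2)[of "(\<xi>, \<eta>)"] small[OF 1(1-4)] a by (simp add: dist_real_def)
  moreover have "\<bar>hts \<xi>' \<eta>' - hts 0 0\<bar> < e"
    using d2(2)[of "(\<xi>', \<eta>')"] small[OF 2(1-4)] a by (simp add: dist_real_def)
  ultimately have "\<bar>hst 0 0 - hts 0 0\<bar> < 2 * e" using eq by linarith
  then show False by (simp add: e_def)
qed

lemma partial_deriv_DERIV:
  assumes "\<forall>x. (\<lambda>t. f (x + t *\<^sub>R axis j 1)) differentiable (at 0)"
  shows "((\<lambda>t. f (x + t *\<^sub>R axis j 1)) has_real_derivative partial_deriv j f (x + t *\<^sub>R axis j 1)) (at t)"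
proof -
  have "((\<lambda>s. f ((x + t *\<^sub>R axis j 1) + s *\<^sub>R axis j 1)) has_real_derivative partial_deriv j f (x + t *\<^sub>R axis j 1)) (at 0)"
    unfolding partial_deriv_def using assms DERIV_deriv_iff_real_differentiable by blast
  then have "((\<lambda>s. f (x + (t + s) *\<^sub>R axis j 1)) has_real_derivative partial_deriv j f (x + t *\<^sub>R axis j 1)) (at 0)"
    by (simp add: algebra_simps)
  then show ?thesis
    using DERIV_shift[of "\<lambda>t. f (x + t *\<^sub>R axis j 1)" _ 0 t] by (simp add: add.commute[of _ t])
qed

lemma partial_deriv_commute:
  fixes f :: "real ^ 's::finite \<Rightarrow> real"
  assumes "\<forall>x. (\<lambda>t. f (x + t *\<^sub>R axis i 1)) differentiable (at 0)"
    and "\<forall>x. (\<lambda>t. f (x + t *\<^sub>R axis j 1)) differentiable (at 0)"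
    and "\<forall>x. (\<lambda>t. partial_deriv i f (x + t *\<^sub>R axis j 1)) differentiable (at 0)"
    and "\<forall>x. (\<lambda>t. partial_deriv j f (x + t *\<^sub>R axis i 1)) differentiable (at 0)"
    and c: "continuous_on UNIV (partial_deriv j (partial_deriv i f))"
      "continuous_on UNIV (partial_deriv i (partial_deriv j f))"
  shows "partial_deriv j (partial_deriv i f) = partial_deriv i (partial_deriv j f)"
proof
  fix x :: "real ^ 's"
  let ?p = "\<lambda>s t. x + s *\<^sub>R axis i 1 + t *\<^sub>R axis j 1"
  have sw: "?p s t = (x + t *\<^sub>R axis j 1) + s *\<^sub>R axis i 1" for s t by simp
  have cont: "isCont (\<lambda>p. g (?p (fst p) (snd p))) (0, 0)" if "continuous_on UNIV g" for g :: "real^'s \<Rightarrow> real"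
    by (rule continuous_on_interior[of UNIV])
      (auto intro!: continuous_on_compose2[OF that] continuous_intros)
  have "partial_deriv j (partial_deriv i f) (?p 0 0) = partial_deriv i (partial_deriv j f) (?p 0 0)"
  proof (rule schwarz_plane[where h="\<lambda>s t. f (?p s t)" and hs="\<lambda>s t. partial_deriv i f (?p s t)"
      and hst="\<lambda>s t. partial_deriv j (partial_deriv i f) (?p s t)"
      and ht="\<lambda>s t. partial_deriv j f (?p s t)"
      and hts="\<lambda>s t. partial_deriv i (partial_deriv j f) (?p s t)"])
    show "((\<lambda>s. f (?p s t)) has_real_derivative partial_deriv i f (?p s t)) (at s)" for s t
      unfolding sw by (rule partial_deriv_DERIV) fact
    show "((\<lambda>t. partial_deriv i f (?p s t)) has_real_derivative partial_deriv j (partial_deriv i f) (?p s t)) (at t)" for s t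
      by (rule partial_deriv_DERIV) fact
    show "((\<lambda>t. f (?p s t)) has_real_derivative partial_deriv j f (?p s t)) (at t)" for s t
      by (rule partial_deriv_DERIV) fact
    show "((\<lambda>s. partial_deriv j f (?p s t)) has_real_derivative partial_deriv i (partial_deriv j f) (?p s t)) (at s)" for s t
      unfolding sw by (rule partial_deriv_DERIV) fact
  qed (intro cont c)+
  then show "partial_deriv j (partial_deriv i f) x = partial_deriv i (partial_deriv j f) x" by simp
qed

lemma iter_partial_Cons: "iter_partial (j # js) F = partial_deriv j (iter_partial js F)"
  by (simp add: iter_partial_def)

lemma suff_smooth_cont:
  assumes "suff_smooth F" "distinct ws" "distinct us" "set ws \<subseteq> set us"
  shows "continuous_on UNIV (iter_partial (ws @ us) F)"
  using assms unfolding suff_smooth_def by blast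

lemma suff_smooth_diff:
  assumes "suff_smooth F" "distinct (j # ws)" "distinct us" "set (j # ws) \<subseteq> set us"
  shows "\<forall>x. (\<lambda>t. iter_partial (ws @ us) F (x + t *\<^sub>R axis j 1)) differentiable (at 0)"
proof -
  have "iter_partial_exists ((j # ws) @ us) F" using assms unfolding suff_smooth_def by blast
  then show ?thesis by simp
qed

lemma suff_smooth_diff0:
  assumes "suff_smooth F" "distinct (j # us)"
  shows "\<forall>x. (\<lambda>t. iter_partial us F (x + t *\<^sub>R axis j 1)) differentiable (at 0)"
proof -
  have "iter_partial_exists ([] @ (j # us)) F" using assms unfolding suff_smooth_def by (metis empty_set empty_subsetI distinct.simps(1))
  then show ?thesis by simp
qed

lemma iter_partial_swap:
  fixes F :: "real ^ 's::finite \<Rightarrow> real"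
  assumes F: "suff_smooth F" and us: "distinct us" and l: "distinct (i # j # l)" "set (i # j # l) \<subseteq> set us"
  shows "iter_partial ((i # j # l) @ us) F = iter_partial ((j # i # l) @ us) F"
  unfolding append_Cons iter_partial_Cons
proof (rule partial_deriv_commute)
  show "\<forall>x. (\<lambda>t. iter_partial (l @ us) F (x + t *\<^sub>R axis j 1)) differentiable (at 0)"
    by (rule suff_smooth_diff) (use assms in auto)
  show "\<forall>x. (\<lambda>t. iter_partial (l @ us) F (x + t *\<^sub>R axis i 1)) differentiable (at 0)"
    by (rule suff_smooth_diff) (use assms in auto)
  show "\<forall>x. (\<lambda>t. partial_deriv j (iter_partial (l @ us) F) (x + t *\<^sub>R axis i 1)) differentiable (at 0)"
    using suff_smooth_diff[OF F, of i "j # l" us] assms by (simp add: iter_partial_Cons)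
  show "\<forall>x. (\<lambda>t. partial_deriv i (iter_partial (l @ us) F) (x + t *\<^sub>R axis j 1)) differentiable (at 0)"
    using suff_smooth_diff[OF F, of j "i # l" us] assms by (auto simp: iter_partial_Cons)
  show "continuous_on UNIV (partial_deriv i (partial_deriv j (iter_partial (l @ us) F)))"
    using suff_smooth_cont[OF F, of "i # j # l" us] assms by (simp add: iter_partial_Cons)
  show "continuous_on UNIV (partial_deriv j (partial_deriv i (iter_partial (l @ us) F)))"
    using suff_smooth_cont[OF F, of "j # i # l" us] assms by (auto simp: iter_partial_Cons)
qed

text \<open>Any rearrangement is a chain of adjacent swaps: both lists are compared, via shorter lists, with
one that starts with the two leading variables.\<close>
lemma iter_partial_perm:
  fixes F :: "real ^ 's::finite \<Rightarrow> real"
  assumes F: "suff_smooth F" and us: "distinct us"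
  shows "distinct ws \<Longrightarrow> distinct ws' \<Longrightarrow> set ws = set ws' \<Longrightarrow> set ws \<subseteq> set us \<Longrightarrow>
    iter_partial (ws @ us) F = iter_partial (ws' @ us) F"
proof (induction "length ws" arbitrary: ws ws' rule: less_induct)
  case less
  show ?case
  proof (cases ws)
    case Nil
    then show ?thesis using less.prems by simp
  next
    case (Cons i l)
    then obtain i' l' where ws': "ws' = i' # l'" using less.prems by (cases ws') auto
    show ?thesis
    proof (cases "i = i'")
      case True
      then have "iter_partial (l @ us) F = iter_partial (l' @ us) F"
        using less.prems Cons ws' by (intro less.hyps) auto
      then show ?thesis using True Cons ws' by (simp add: iter_partial_Cons)
    next
      case False
      obtain m where m: "distinct m" "set m = set ws - {i, i'}"
        using finite_distinct_list[of "set ws - {i, i'}"] by auto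
      have "iter_partial (l @ us) F = iter_partial ((i' # m) @ us) F"
        using less.prems Cons ws' False m by (intro less.hyps) auto
      moreover have "length l' = length l"
        using less.prems Cons ws' by (metis distinct_card length_Cons nat.inject)
      then have "iter_partial (l' @ us) F = iter_partial ((i # m) @ us) F"
        using less.prems Cons ws' False m by (intro less.hyps) auto
      moreover have "iter_partial ((i # i' # m) @ us) F = iter_partial ((i' # i # m) @ us) F"
        using less.prems Cons ws' False m by (intro iter_partial_swap F us) auto
      ultimately show ?thesis using Cons ws' by (simp add: iter_partial_Cons)
    qed
  qed
qed

lemma enum_list: "distinct (enum_list A)" "set (enum_list A) = A"
  using someI_ex[of "\<lambda>js. distinct js \<and> set js = A"] finite_distinct_list[of A]
  unfolding enum_list_def by auto

lemma mixed_deriv_cont: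
  assumes "suff_smooth F" "w \<subseteq> u"
  shows "continuous_on UNIV (mixed_deriv w u F)"
  unfolding mixed_deriv_def using assms by (intro suff_smooth_cont) (auto simp: enum_list)

lemma mixed_deriv_empty:
  fixes u :: "'s::finite set"
  shows "mixed_deriv {} u F = iter_partial (enum_list u) F"
  using enum_list(2)[of "{} :: 's set"] by (simp add: mixed_deriv_def)

text \<open>\<open>enum_list (insert i w)\<close> bears no relation to \<open>i # enum_list w\<close>; this is where symmetry
of the mixed derivatives enters.\<close>
lemma mixed_deriv_DERIV:
  fixes F :: "real ^ 's::finite \<Rightarrow> real"
  assumes F: "suff_smooth F" and w: "i \<notin> w" "insert i w \<subseteq> u"
  shows "((\<lambda>t. mixed_deriv w u F (x + t *\<^sub>R axis i 1)) has_real_derivative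
      mixed_deriv (insert i w) u F (x + t *\<^sub>R axis i 1)) (at t)"
proof -
  have "mixed_deriv (insert i w) u F = iter_partial ((i # enum_list w) @ enum_list u) F"
    unfolding mixed_deriv_def using w by (intro iter_partial_perm F) (auto simp: enum_list)
  also have "\<dots> = partial_deriv i (mixed_deriv w u F)"
    by (simp add: mixed_deriv_def iter_partial_Cons)
  finally show ?thesis
    using partial_deriv_DERIV[of "mixed_deriv w u F" i x t] suff_smooth_diff[OF F, of i "enum_list w" "enum_list u"] w
    by (simp add: mixed_deriv_def enum_list)
qed

lemma iter_partial_DERIV:
  fixes F :: "real ^ 's::finite \<Rightarrow> real"
  assumes F: "suff_smooth F" and "distinct (i # us)"
  shows "((\<lambda>t. iter_partial us F (x + t *\<^sub>R axis i 1)) has_real_derivative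
      iter_partial (i # us) F (x + t *\<^sub>R axis i 1)) (at t)"
  unfolding iter_partial_Cons by (intro partial_deriv_DERIV suff_smooth_diff0 assms)

lemma iter_partial_cont:
  assumes "suff_smooth F" "distinct us"
  shows "continuous_on UNIV (iter_partial us F)"
  using suff_smooth_cont[of F "[]" us] assms by simp

section \<open>Lebesgue measure on blocks of coordinates\<close>

abbreviation LP :: "'i set \<Rightarrow> ('i \<Rightarrow> real) measure" where
  "LP I \<equiv> PiM I (\<lambda>_. lborel)"

lemma product_sigma_finite_lborel: "product_sigma_finite (\<lambda>_. lborel :: real measure)"
  by standard

lemma sigma_finite_LP: "finite I \<Longrightarrow> sigma_finite_measure (LP I)"
  by (rule product_sigma_finite.sigma_finite[OF product_sigma_finite_lborel])

lemma pair_sigma_finiteI: "sigma_finite_measure M \<Longrightarrow> sigma_finite_measure N \<Longrightarrow> pair_sigma_finite M N"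
  by (simp add: pair_sigma_finite_def)

lemma vec_lambda_measurable:
  assumes "\<And>j. (\<lambda>p. f p j) \<in> borel_measurable M"
  shows "(\<lambda>p. (\<chi> j. f p j) :: real ^ 's::finite) \<in> borel_measurable M"
proof -
  have "(\<chi> j. f p j) = (\<Sum>j\<in>UNIV. f p j *\<^sub>R axis j 1 :: real ^ 's)" for p
    by (simp add: vec_eq_iff axis_def if_distrib[of "\<lambda>x. _ * x"] cong: if_cong)
  then show ?thesis using assms by simp
qed

lemma LP_component_measurable: "(\<lambda>y. y j) \<in> borel_measurable (LP I)" if "j \<in> I"
  using measurable_component_singleton[OF that, of "\<lambda>_. lborel :: real measure"] by simp

lemma vec_lambda_borel: "vec_lambda \<in> borel_measurable (LP (UNIV :: 's::finite set))"
  using vec_lambda_measurable[of "\<lambda>f. f" "LP UNIV", OF LP_component_measurable] by simp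

lemma lborel_vec: "distr (LP UNIV) borel vec_lambda = (lborel :: (real ^ 's::finite) measure)"
proof (rule lborel_eqI[symmetric])
  interpret product_sigma_finite "\<lambda>_. lborel :: real measure" by (rule product_sigma_finite_lborel)
  note meas = vec_lambda_borel
  fix l h :: "real ^ 's" assume lh: "\<And>b. b \<in> Basis \<Longrightarrow> l \<bullet> b \<le> h \<bullet> b"
  have le: "l $ j \<le> h $ j" for j
    using lh[of "axis j 1"] by (simp add: axis_in_Basis_iff inner_axis)
  have "emeasure (distr (LP UNIV) borel vec_lambda) (box l h) =
      emeasure (LP UNIV) (\<Pi>\<^sub>E j\<in>UNIV. {l $ j <..< h $ j})"
    by (subst emeasure_distr[OF meas])
       (auto simp: space_PiM mem_box_cart PiE_iff intro!: arg_cong[where f="emeasure _"])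
  also have "\<dots> = (\<Prod>j\<in>UNIV. emeasure lborel {l $ j <..< h $ j})"
    by (rule emeasure_PiM) auto
  also have "\<dots> = (\<Prod>j\<in>UNIV. ennreal (h $ j - l $ j))"
    using le by simp
  also have "\<dots> = ennreal (\<Prod>j\<in>UNIV. h $ j - l $ j)"
    using le by (intro prod_ennreal) simp
  also have "(\<Prod>j\<in>UNIV. h $ j - l $ j) = (\<Prod>b\<in>Basis. (h - l) \<bullet> b)"
    unfolding Basis_vec_def
    by (subst prod.reindex_bij_betw[symmetric, where h="\<lambda>j. axis j (1::real)" and S=UNIV])
       (auto simp: inner_axis bij_betw_def inj_on_def axis_eq_axis)
  finally show "emeasure (distr (LP UNIV) borel vec_lambda) (box l h) = ennreal (\<Prod>b\<in>Basis. (h - l) \<bullet> b)" .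
qed simp

lemma join_measurable:
  fixes S :: "'s::finite set"
  shows "(\<lambda>(y, z). join S y z) \<in> borel_measurable (LP S \<Otimes>\<^sub>M LP (UNIV - S))"
  unfolding join_def case_prod_unfold
proof (rule vec_lambda_measurable)
  fix j show "(\<lambda>p. if j \<in> S then fst p j else snd p j) \<in> borel_measurable (LP S \<Otimes>\<^sub>M LP (UNIV - S))"
    using LP_component_measurable[of j S] LP_component_measurable[of j "UNIV - S"]
    by (cases "j \<in> S") auto
qed

lemma distr_join:
  fixes S :: "'s::finite set"
  shows "distr (LP S \<Otimes>\<^sub>M LP (UNIV - S)) borel (\<lambda>(y, z). join S y z) = lborel"
proof -
  interpret product_sigma_finite "\<lambda>_. lborel :: real measure" by (rule product_sigma_finite_lborel)
  note meas = vec_lambda_borel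
  have "lborel = distr (distr (LP S \<Otimes>\<^sub>M LP (UNIV - S)) (LP (S \<union> (UNIV - S))) (merge S (UNIV - S))) borel (vec_lambda :: _ \<Rightarrow> real ^ 's)"
    by (subst distr_merge) (auto simp: lborel_vec)
  also have "\<dots> = distr (LP S \<Otimes>\<^sub>M LP (UNIV - S)) borel (vec_lambda \<circ> merge S (UNIV - S))"
    by (rule distr_distr) (use meas measurable_merge[of S "UNIV - S" "\<lambda>_. lborel :: real measure"] in auto)
  also have "vec_lambda \<circ> merge S (UNIV - S) = (\<lambda>(y, z). join S y z)"
    by (auto simp: fun_eq_iff join_def merge_def vec_eq_iff)
  finally show ?thesis by simp
qed

lemma distr_fun_upd:
  assumes "finite I" "i \<notin> I"
  shows "distr (LP I \<Otimes>\<^sub>M lborel) (LP (insert i I)) (\<lambda>(y, t). y(i := t)) = LP (insert i I)"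
proof -
  interpret product_sigma_finite "\<lambda>_. lborel :: real measure" by (rule product_sigma_finite_lborel)
  have m: "(\<lambda>(y, t). y(i := t)) \<in> measurable (LP I \<Otimes>\<^sub>M lborel) (LP (insert i I))"
    by (rule measurable_add_dim)
  show ?thesis
  proof (rule PiM_eqI)
    fix A :: "'a \<Rightarrow> real set" assume A: "\<And>j. j \<in> insert i I \<Longrightarrow> A j \<in> sets lborel"
    have "(\<lambda>(y, t). y(i := t)) -` Pi\<^sub>E (insert i I) A \<inter> space (LP I \<Otimes>\<^sub>M lborel) = Pi\<^sub>E I A \<times> A i"
      using assms(2) by (auto simp: space_pair_measure space_PiM PiE_iff extensional_def split: if_splits)
    then have "emeasure (distr (LP I \<Otimes>\<^sub>M lborel) (LP (insert i I)) (\<lambda>(y, t). y(i := t))) (Pi\<^sub>E (insert i I) A)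
        = emeasure (LP I \<Otimes>\<^sub>M lborel) (Pi\<^sub>E I A \<times> A i)"
      using A assms by (subst emeasure_distr[OF m]) (auto intro!: sets_PiM_I_finite)
    also have "\<dots> = emeasure (LP I) (Pi\<^sub>E I A) * emeasure lborel (A i)"
      using A assms by (intro lborel.emeasure_pair_measure_Times) (auto intro!: sets_PiM_I_finite)
    also have "emeasure (LP I) (Pi\<^sub>E I A) = (\<Prod>j\<in>I. emeasure lborel (A j))"
      using A assms by (intro emeasure_PiM) auto
    finally show "emeasure (distr (LP I \<Otimes>\<^sub>M lborel) (LP (insert i I)) (\<lambda>(y, t). y(i := t))) (Pi\<^sub>E (insert i I) A)
        = (\<Prod>j\<in>insert i I. emeasure lborel (A j))"
      using assms by (simp add: mult.commute del: fun_upd_apply)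
  qed (use assms in auto)
qed

lemma distr_fun_upd':
  assumes "finite I" "i \<notin> I"
  shows "distr (lborel \<Otimes>\<^sub>M LP I) (LP (insert i I)) (\<lambda>(t, y). y(i := t)) = LP (insert i I)"
proof -
  have m: "(\<lambda>(y, t). y(i := t)) \<in> measurable (LP I \<Otimes>\<^sub>M lborel) (LP (insert i I))"
    by (rule measurable_add_dim)
  have "LP (insert i I) = distr (distr (lborel \<Otimes>\<^sub>M LP I) (LP I \<Otimes>\<^sub>M lborel) (\<lambda>(x, y). (y, x))) (LP (insert i I)) (\<lambda>(y, t). y(i := t))"
    unfolding distr_fun_upd[OF assms] pair_sigma_finite.distr_pair_swap[OF pair_sigma_finiteI[OF sigma_finite_LP[OF assms(1)] sigma_finite_lborel], symmetric] ..
  also have "\<dots> = distr (lborel \<Otimes>\<^sub>M LP I) (LP (insert i I)) ((\<lambda>(y, t). y(i := t)) \<circ> (\<lambda>(x, y). (y, x)))"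
    by (rule distr_distr[OF m measurable_pair_swap'])
  also have "(\<lambda>(y, t). y(i := t)) \<circ> (\<lambda>(x, y). (y, x)) = (\<lambda>(t, y). y(i := t))"
    by (auto simp: fun_eq_iff)
  finally show ?thesis by simp
qed

lemma join_fun_upd:
  assumes "i \<notin> S"
  shows "join (insert i S) (y(i := t)) z = join S y (z(i := t))"
  using assms by (auto simp: join_def vec_eq_iff)

text \<open>Splits $\mathbb{R}^s$ into the coordinates in \<open>S\<close>, one further coordinate \<open>i\<close>, and the rest,
which is the form in which the one-coordinate integration by parts is applied on almost every line.\<close>
lemma distr_join_fun_upd:
  fixes S :: "'s::finite set"
  assumes i: "i \<notin> S"
  shows "distr (LP S \<Otimes>\<^sub>M (lborel \<Otimes>\<^sub>M LP (UNIV - insert i S))) borel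
      (\<lambda>(y, t, z). join (insert i S) (y(i := t)) z) = lborel" (is "?L = _")
    and "(\<lambda>(y, t, z). join (insert i S) (y(i := t)) z) \<in>
      borel_measurable (LP S \<Otimes>\<^sub>M (lborel \<Otimes>\<^sub>M LP (UNIV - insert i S)))"
proof -
  let ?J = "UNIV - insert i S"
  have J: "UNIV - S = insert i ?J" using i by auto
  have m: "(\<lambda>(t, y). y(i := t)) \<in> measurable (lborel \<Otimes>\<^sub>M LP ?J) (LP (UNIV - S))"
  proof -
    have "(\<lambda>(y, t). y(i := t)) \<in> measurable (LP ?J \<Otimes>\<^sub>M lborel) (LP (insert i ?J))"
      by (rule measurable_add_dim)
    from measurable_compose[OF measurable_pair_swap' this] show ?thesis
      unfolding J by (simp add: case_prod_unfold)
  qed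
  have m2: "(\<lambda>(y, p). (y, case p of (t, z) \<Rightarrow> z(i := t))) \<in>
      measurable (LP S \<Otimes>\<^sub>M (lborel \<Otimes>\<^sub>M LP ?J)) (LP S \<Otimes>\<^sub>M LP (UNIV - S))"
    using m by measurable
  have eq: "(\<lambda>(y, z). join S y z) \<circ> (\<lambda>(y, p). (y, case p of (t, z) \<Rightarrow> z(i := t)))
      = (\<lambda>(y, t, z). join (insert i S) (y(i := t)) z)"
    by (auto simp: fun_eq_iff join_fun_upd[OF i])
  show "(\<lambda>(y, t, z). join (insert i S) (y(i := t)) z) \<in>
      borel_measurable (LP S \<Otimes>\<^sub>M (lborel \<Otimes>\<^sub>M LP (UNIV - insert i S)))"
    using measurable_comp[OF m2 join_measurable] unfolding eq .
  have d: "distr (lborel \<Otimes>\<^sub>M LP ?J) (LP (UNIV - S)) (\<lambda>(t, y). y(i := t)) = LP (UNIV - S)"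
    unfolding J by (rule distr_fun_upd') auto
  have "LP S \<Otimes>\<^sub>M LP (UNIV - S) = distr (LP S) (LP S) (\<lambda>x. x) \<Otimes>\<^sub>M distr (lborel \<Otimes>\<^sub>M LP ?J) (LP (UNIV - S)) (\<lambda>(t, y). y(i := t))"
    by (simp add: d)
  also have "\<dots> = distr (LP S \<Otimes>\<^sub>M (lborel \<Otimes>\<^sub>M LP ?J)) (LP S \<Otimes>\<^sub>M LP (UNIV - S)) (\<lambda>(y, p). (y, case p of (t, z) \<Rightarrow> z(i := t)))"
    by (rule pair_measure_distr) (use m d sigma_finite_LP[of "UNIV - S"] in auto)
  finally have "lborel = distr (distr (LP S \<Otimes>\<^sub>M (lborel \<Otimes>\<^sub>M LP ?J)) (LP S \<Otimes>\<^sub>M LP (UNIV - S)) (\<lambda>(y, p). (y, case p of (t, z) \<Rightarrow> z(i := t)))) borel (\<lambda>(y, z). join S y z)"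
    by (metis distr_join)
  also have "\<dots> = ?L"
    by (subst distr_distr[OF join_measurable m2]) (simp add: eq)
  finally show "?L = lborel" by simp
qed

lemma integrable_mult_bounded:
  fixes f g :: "'a \<Rightarrow> real"
  assumes "integrable M f" "g \<in> borel_measurable M" "\<And>x. x \<in> space M \<Longrightarrow> \<bar>g x\<bar> \<le> B"
  shows "integrable M (\<lambda>x. f x * g x)"
proof (rule Bochner_Integration.integrable_bound)
  show "integrable M (\<lambda>x. B * f x)" using assms(1) by simp
  show "(\<lambda>x. f x * g x) \<in> borel_measurable M" using assms by measurable
  show "AE x in M. norm (f x * g x) \<le> norm (B * f x)"
  proof (rule AE_I2)
    fix x assume "x \<in> space M"
    then have "\<bar>g x\<bar> * \<bar>f x\<bar> \<le> B * \<bar>f x\<bar>" using assms(3) by (intro mult_right_mono) auto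
    also have "\<dots> \<le> \<bar>B\<bar> * \<bar>f x\<bar>" by (intro mult_right_mono) auto
    finally show "norm (f x * g x) \<le> norm (B * f x)" by (simp add: abs_mult mult.commute)
  qed
qed

lemma continuous_bounded_on_Icc:
  fixes f :: "real \<Rightarrow> real"
  assumes "continuous_on UNIV f"
  shows "\<exists>B\<ge>0. \<forall>t\<in>{-R..R}. \<bar>f t\<bar> \<le> B"
proof -
  have "bounded (f ` {-R..R})"
    by (intro compact_imp_bounded compact_continuous_image continuous_on_subset[OF assms]) auto
  then obtain B where "\<forall>t\<in>{-R..R}. \<bar>f t\<bar> \<le> B" unfolding bounded_iff by auto
  then show ?thesis by (intro exI[of _ "\<bar>B\<bar>"]) force
qed

lemma continuous_bounded_support:
  fixes f :: "real \<Rightarrow> real"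
  assumes "continuous_on UNIV f" "\<And>t. R \<le> \<bar>t\<bar> \<Longrightarrow> f t = 0"
  shows "\<exists>B\<ge>0. \<forall>t. \<bar>f t\<bar> \<le> B"
proof -
  obtain B where B: "0 \<le> B" "\<forall>t\<in>{-R..R}. \<bar>f t\<bar> \<le> B"
    using continuous_bounded_on_Icc[OF assms(1)] by blast
  have "\<bar>f t\<bar> \<le> B" for t
  proof (cases "R \<le> \<bar>t\<bar>")
    case True then show ?thesis using assms(2) B(1) by simp
  next
    case False
    then have "t \<in> {-R..R}" unfolding atLeastAtMost_iff by linarith
    then show ?thesis using B(2) by blast
  qed
  then show ?thesis using B(1) by blast
qed

section \<open>The second integration by parts in several coordinates\<close>

text \<open>\<open>D w\<close> stands for the derivative of one function in the directions \<open>w \<subseteq> v\<close>. The aim is to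
turn the kernel \<open>\<Prod>\<^sub>j V' j * \<rho>\<close>, \<open>j \<in> v\<close>, into \<open>(-1)^card v\<close> times the sum over \<open>w\<close> that
the product rule gives for the derivatives of \<open>D {} * \<Prod>\<^sub>j \<rho>\<close> against \<open>\<Prod>\<^sub>j V j\<close>.
The coordinates outside \<open>v\<close> carry the fixed kernels \<open>\<kappa>\<close> and are integrated out;
the functions \<open>D w\<close> are integrable only locally in the coordinates of \<open>v\<close>.\<close>
locale rough_ibp =
  fixes v :: "'s::finite set" and D :: "'s set \<Rightarrow> real ^ 's \<Rightarrow> real"
    and \<rho> \<rho>' :: "real \<Rightarrow> real" and V V' \<kappa> :: "'s \<Rightarrow> real \<Rightarrow> real" and R :: real
  assumes R: "0 < R"
    and D_meas: "\<And>w. w \<subseteq> v \<Longrightarrow> D w \<in> borel_measurable borel"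
    and D_deriv: "\<And>i w x t. i \<notin> w \<Longrightarrow> insert i w \<subseteq> v \<Longrightarrow>
      ((\<lambda>t. D w (x + t *\<^sub>R axis i 1)) has_real_derivative D (insert i w) (x + t *\<^sub>R axis i 1)) (at t)"
    and \<rho>: "\<And>t. (\<rho> has_real_derivative \<rho>' t) (at t)" "\<rho>' \<in> borel_measurable borel"
    and V: "\<And>j t. j \<in> v \<Longrightarrow> (V j has_real_derivative V' j t) (at t)"
      "\<And>j. j \<in> v \<Longrightarrow> continuous_on UNIV (V' j)"
      "\<And>j t. j \<in> v \<Longrightarrow> R \<le> \<bar>t\<bar> \<Longrightarrow> V j t = 0" "\<And>j t. j \<in> v \<Longrightarrow> R \<le> \<bar>t\<bar> \<Longrightarrow> V' j t = 0"
    and \<kappa>_meas: "\<And>j. j \<notin> v \<Longrightarrow> \<kappa> j \<in> borel_measurable borel"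
    and loc_int: "\<And>w. w \<subseteq> v \<Longrightarrow> integrable lborel
      (\<lambda>x. D w x * (\<Prod>j\<in>v. indicator {-R..R} (x $ j)) * (\<Prod>j\<in>UNIV - v. \<kappa> j (x $ j)))"
begin

definition K where "K j t = (if j \<in> v then V' j t * \<rho> t else \<kappa> j t)"

text \<open>The coordinates in \<open>S\<close> are already frozen and carry the differentiated factors; all others are
integrated out, those in \<open>v - S\<close> still with the original kernel.\<close>
definition G where "G S w y = (LINT z|LP (UNIV - S). D w (join S y z) * (\<Prod>j\<in>UNIV - S. K j (z j)))"

text \<open>One term of the product rule: in the directions of \<open>w\<close> the derivative falls on \<open>D\<close>, in those of
\<open>S - w\<close> on \<open>\<rho>\<close>.\<close>
definition c where "c S w y = (\<Prod>j\<in>w. V j (y j) * \<rho> (y j)) * (\<Prod>j\<in>S - w. V j (y j) * \<rho>' (y j))"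

definition T where "T S y = (\<Sum>w\<in>Pow S. c S w y * G S w y)"

lemma \<rho>_cont: "continuous_on UNIV \<rho>"
  by (intro continuous_at_imp_continuous_on ballI DERIV_isCont[OF \<rho>(1)])

lemma V_cont: "j \<in> v \<Longrightarrow> continuous_on UNIV (V j)"
  by (intro continuous_at_imp_continuous_on ballI DERIV_isCont[OF V(1)])

lemma \<rho>_meas: "\<rho> \<in> borel_measurable borel"
  using \<rho>_cont by (rule borel_measurable_continuous_onI)

lemma V_meas: "j \<in> v \<Longrightarrow> V j \<in> borel_measurable borel"
  using V_cont by (rule borel_measurable_continuous_onI)

lemma V'_meas: "j \<in> v \<Longrightarrow> V' j \<in> borel_measurable borel"
  using V(2) by (rule borel_measurable_continuous_onI)

lemma K_meas: "K j \<in> borel_measurable borel"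
  using \<rho>_meas V'_meas \<kappa>_meas unfolding K_def[abs_def] by (cases "j \<in> v") auto

lemma K_bounded:
  assumes "j \<in> v"
  shows "\<exists>B\<ge>0. \<forall>t. \<bar>K j t\<bar> \<le> B"
proof -
  have "continuous_on UNIV (\<lambda>t. V' j t * \<rho> t)"
    by (intro continuous_on_mult V(2) \<rho>_cont assms)
  from continuous_bounded_support[OF this, of R] show ?thesis
    using V(4)[OF assms] assms by (simp add: K_def)
qed

lemma K_outside: "j \<in> v \<Longrightarrow> t \<notin> {-R..R} \<Longrightarrow> K j t = 0"
  using V(4)[of j t] by (force simp: K_def)

lemma int_K:
  assumes S: "S \<subseteq> v" and w: "w \<subseteq> v"
  shows "integrable lborel (\<lambda>x. D w x * (\<Prod>j\<in>S. indicator {-R..R} (x $ j)) * (\<Prod>j\<in>UNIV - S. K j (x $ j)))"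
proof -
  have "\<forall>j\<in>v. \<exists>B\<ge>0. \<forall>t. \<bar>K j t\<bar> \<le> B" using K_bounded by blast
  then obtain B where B: "\<And>j. j \<in> v \<Longrightarrow> B j \<ge> 0 \<and> (\<forall>t. \<bar>K j t\<bar> \<le> B j)" by metis
  have "integrable lborel (\<lambda>x. (D w x * (\<Prod>j\<in>v. indicator {-R..R} (x $ j)) * (\<Prod>j\<in>UNIV - v. \<kappa> j (x $ j)))
      * (\<Prod>j\<in>v - S. K j (x $ j)))"
  proof (rule integrable_mult_bounded[OF loc_int[OF w]])
    show "(\<lambda>x. \<Prod>j\<in>v - S. K j (x $ j)) \<in> borel_measurable lborel"
      using K_meas by measurable
    show "\<bar>\<Prod>j\<in>v - S. K j (x $ j)\<bar> \<le> (\<Prod>j\<in>v - S. B j)" for x :: "real ^ 's"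
      unfolding abs_prod using B by (intro prod_mono) auto
  qed
  moreover have "(D w x * (\<Prod>j\<in>v. indicator {-R..R} (x $ j)) * (\<Prod>j\<in>UNIV - v. \<kappa> j (x $ j)))
      * (\<Prod>j\<in>v - S. K j (x $ j)) =
      D w x * (\<Prod>j\<in>S. indicator {-R..R} (x $ j)) * (\<Prod>j\<in>UNIV - S. K j (x $ j))" for x :: "real ^ 's"
  proof -
    have 1: "(\<Prod>j\<in>v. indicator {-R..R} (x $ j)) = (\<Prod>j\<in>S. indicator {-R..R} (x $ j) :: real) * (\<Prod>j\<in>v - S. indicator {-R..R} (x $ j))"
      using prod.subset_diff[OF S finite, of "\<lambda>j. indicator {-R..R} (x $ j) :: real"] by (simp add: mult.commute)
    have 2: "(\<Prod>j\<in>UNIV - S. K j (x $ j)) = (\<Prod>j\<in>UNIV - v. K j (x $ j)) * (\<Prod>j\<in>v - S. K j (x $ j))"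
    proof -
      have "UNIV - S = (UNIV - v) \<union> (v - S)" using S by auto
      then show ?thesis by (simp only:) (rule prod.union_disjoint, auto)
    qed
    have 3: "(\<Prod>j\<in>UNIV - v. K j (x $ j)) = (\<Prod>j\<in>UNIV - v. \<kappa> j (x $ j))"
      by (rule prod.cong) (auto simp: K_def)
    have 4: "(\<Prod>j\<in>v - S. indicator {-R..R} (x $ j)) * (\<Prod>j\<in>v - S. K j (x $ j)) = (\<Prod>j\<in>v - S. K j (x $ j))"
      unfolding prod.distrib[symmetric] using K_outside
      by (intro prod.cong) (auto simp: indicator_def)
    show ?thesis unfolding 1 2 3 using 4 by (simp add: mult_ac)
  qed
  ultimately show ?thesis by simp
qed

lemma G_meas:
  assumes w: "w \<subseteq> v"
  shows "G S w \<in> borel_measurable (LP S)"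
proof -
  interpret sigma_finite_measure "LP (UNIV - S)" by (rule sigma_finite_LP) simp
  have "(\<lambda>(y, z). D w (join S y z)) \<in> borel_measurable (LP S \<Otimes>\<^sub>M LP (UNIV - S))"
    using measurable_compose[OF join_measurable D_meas[OF w]] by (simp add: case_prod_unfold)
  moreover have "(\<lambda>(y, z). \<Prod>j\<in>UNIV - S. K j (z j)) \<in> borel_measurable (LP S \<Otimes>\<^sub>M LP (UNIV - S))"
    unfolding case_prod_unfold
    by (intro borel_measurable_prod measurable_compose[OF _ K_meas]
        measurable_compose[OF measurable_snd LP_component_measurable])
  ultimately have "(\<lambda>(y, z). D w (join S y z) * (\<Prod>j\<in>UNIV - S. K j (z j))) \<in> borel_measurable (LP S \<Otimes>\<^sub>M LP (UNIV - S))"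
    unfolding case_prod_unfold by (rule borel_measurable_times)
  then show ?thesis unfolding G_def[abs_def] by (rule borel_measurable_lebesgue_integral)
qed

lemma c_meas:
  assumes "S \<subseteq> v" "w \<subseteq> S"
  shows "c S w \<in> borel_measurable (LP S)"
  unfolding c_def[abs_def] using assms
  by (intro borel_measurable_times borel_measurable_prod measurable_compose[OF LP_component_measurable V_meas]
      measurable_compose[OF LP_component_measurable \<rho>_meas] measurable_compose[OF LP_component_measurable \<rho>(2)]) auto

lemma T_meas:
  assumes "S \<subseteq> v"
  shows "T S \<in> borel_measurable (LP S)"
  unfolding T_def[abs_def] using assms
  by (intro borel_measurable_sum borel_measurable_times c_meas G_meas) auto

text \<open>In the coordinate \<open>i\<close> each term of \<open>T\<close> branches once more, according to which factor is
differentiated in that direction.\<close>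
lemma T_insert:
  assumes "i \<notin> S"
  shows "T (insert i S) (y(i := t)) = (\<Sum>w\<in>Pow S. c S w y * (V i t * (\<rho> t * G (insert i S) (insert i w) (y(i := t))
      + \<rho>' t * G (insert i S) w (y(i := t)))))"
proof -
  have P: "Pow (insert i S) = Pow S \<union> insert i ` Pow S" "Pow S \<inter> insert i ` Pow S = {}"
    using assms by (auto simp: Pow_insert)
  have inj: "inj_on (insert i) (Pow S)" using assms by (auto simp: inj_on_def)
  have c1: "c (insert i S) w (y(i := t)) = c S w y * (V i t * \<rho>' t)" if "w \<subseteq> S" for w
  proof -
    have "insert i S - w = insert i (S - w)" using that assms by auto
    moreover have "i \<notin> w" using that assms by auto
    then have "(\<Prod>j\<in>w. V j ((y(i := t)) j) * \<rho> ((y(i := t)) j)) = (\<Prod>j\<in>w. V j (y j) * \<rho> (y j))"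
      by (intro prod.cong) auto
    moreover have "(\<Prod>j\<in>S - w. V j ((y(i := t)) j) * \<rho>' ((y(i := t)) j)) = (\<Prod>j\<in>S - w. V j (y j) * \<rho>' (y j))"
      using assms by (intro prod.cong) auto
    ultimately show ?thesis using assms by (simp add: c_def mult_ac)
  qed
  have c2: "c (insert i S) (insert i w) (y(i := t)) = c S w y * (V i t * \<rho> t)" if "w \<subseteq> S" for w
  proof -
    have "insert i S - insert i w = S - w" using that assms by auto
    moreover have "i \<notin> w" using that assms by auto
    then have "(\<Prod>j\<in>w. V j ((y(i := t)) j) * \<rho> ((y(i := t)) j)) = (\<Prod>j\<in>w. V j (y j) * \<rho> (y j))"
      by (intro prod.cong) auto
    moreover have "(\<Prod>j\<in>S - w. V j ((y(i := t)) j) * \<rho>' ((y(i := t)) j)) = (\<Prod>j\<in>S - w. V j (y j) * \<rho>' (y j))"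
      using assms by (intro prod.cong) auto
    ultimately show ?thesis using \<open>i \<notin> w\<close> by (simp add: c_def mult_ac)
  qed
  have "T (insert i S) (y(i := t)) = (\<Sum>w\<in>Pow S. c S w y * (V i t * \<rho>' t) * G (insert i S) w (y(i := t)))
      + (\<Sum>w\<in>Pow S. c S w y * (V i t * \<rho> t) * G (insert i S) (insert i w) (y(i := t)))"
    unfolding T_def P(1)
    by (subst sum.union_disjoint) (auto simp: P(2) sum.reindex[OF inj] c1 c2 intro!: arg_cong2[where f="(+)"] sum.cong)
  then show ?thesis by (simp add: sum.distrib[symmetric] algebra_simps)
qed

text \<open>On almost every line parallel to the \<open>i\<close>-axis \<open>T (insert i S)\<close> has the shape
\<open>V (\<rho> g' + \<rho>' g)\<close> and is integrable by Fubini, although its single terms need not be. One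
integration by parts on that line turns it into \<open>- V' \<rho> g\<close>, which is a contribution to
\<open>T S\<close>. In particular the integrability of \<open>T S\<close> is a conclusion: it passes from more frozen
coordinates to fewer.\<close>
lemma step:
  assumes iS: "insert i S \<subseteq> v" "i \<notin> S" and int: "integrable (LP (insert i S)) (T (insert i S))"
  shows "integrable (LP S) (T S)"
    and "(LINT y|LP (insert i S). T (insert i S) y) = - (LINT y|LP S. T S y)"
proof -
  let ?M = "LP (UNIV - insert i S)"
  define \<kappa>S where "\<kappa>S z = (\<Prod>j\<in>UNIV - insert i S. K j (z j))" for z
  have Siv: "S \<subseteq> v" "i \<in> v" using iS by auto
  have sfM: "sigma_finite_measure ?M" by (rule sigma_finite_LP) simp
  interpret M: sigma_finite_measure ?M by fact
  interpret P: pair_sigma_finite "lborel :: real measure" ?M ..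
  interpret S: sigma_finite_measure "LP S" by (rule sigma_finite_LP) simp
  interpret PM: sigma_finite_measure "lborel \<Otimes>\<^sub>M ?M"
    by (rule sigma_finite_pair_measure) (rule sigma_finite_lborel sfM)+
  interpret Q: pair_sigma_finite "LP S" "lborel \<Otimes>\<^sub>M ?M" ..
  interpret N: pair_sigma_finite "LP S" "lborel :: real measure" ..
  define J where "J t y z = join (insert i S) (y(i := t)) z" for t :: real and y z
  have J_shift: "J t y z = J 0 y z + t *\<^sub>R axis i 1" for t y z
    by (auto simp: J_def join_def vec_eq_iff axis_def)
  have int_I: "integrable (LP S \<Otimes>\<^sub>M (lborel \<Otimes>\<^sub>M ?M))
      (\<lambda>(y, t, z). D w (J t y z) * (\<Prod>j\<in>S. indicator {-R..R} (y j)) * indicator {-R..R} t * \<kappa>S z)"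
    if w: "w \<subseteq> v" for w
  proof -
    let ?h = "\<lambda>x. D w x * (\<Prod>j\<in>insert i S. indicator {-R..R} (x $ j)) * (\<Prod>j\<in>UNIV - insert i S. K j (x $ j))"
    have "integrable (distr (LP S \<Otimes>\<^sub>M (lborel \<Otimes>\<^sub>M ?M)) borel (\<lambda>(y, t, z). join (insert i S) (y(i := t)) z)) ?h"
      unfolding distr_join_fun_upd(1)[OF iS(2)] by (rule int_K[OF iS(1) w])
    then have "integrable (LP S \<Otimes>\<^sub>M (lborel \<Otimes>\<^sub>M ?M)) (\<lambda>p. ?h ((\<lambda>(y, t, z). join (insert i S) (y(i := t)) z) p))"
      by (rule integrable_distr[OF distr_join_fun_upd(2)[OF iS(2)]])
    moreover have "?h ((\<lambda>(y, t, z). join (insert i S) (y(i := t)) z) p) =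
      (\<lambda>(y, t, z). D w (J t y z) * (\<Prod>j\<in>S. indicator {-R..R} (y j)) * indicator {-R..R} t * \<kappa>S z) p" for p
    proof (cases p)
      case (fields y t z)
      have "(\<Prod>j\<in>S. indicator {-R..R} (J t y z $ j) :: real) = (\<Prod>j\<in>S. indicator {-R..R} (y j))"
        using iS(2) by (intro prod.cong) (auto simp: J_def join_def)
      moreover have "(\<Prod>j\<in>UNIV - insert i S. K j (J t y z $ j)) = \<kappa>S z"
        unfolding \<kappa>S_def by (intro prod.cong) (auto simp: J_def join_def)
      moreover have "J t y z $ i = t" by (simp add: J_def join_def)
      ultimately show ?thesis using iS(2) by (simp add: fields J_def[symmetric] mult_ac)
    qed
    ultimately show ?thesis by simp
  qed
  have AE1: "AE y in LP S. \<forall>w\<in>Pow (insert i S). integrable (lborel \<Otimes>\<^sub>M ?M)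
      (\<lambda>(t, z). D w (J t y z) * (\<Prod>j\<in>S. indicator {-R..R} (y j)) * indicator {-R..R} t * \<kappa>S z)"
  proof (rule AE_finite_allI)
    fix w assume "w \<in> Pow (insert i S)"
    then have "w \<subseteq> v" using iS by auto
    from Q.AE_integrable_fst'[OF int_I[OF this]]
    show "AE y in LP S. integrable (lborel \<Otimes>\<^sub>M ?M)
      (\<lambda>(t, z). D w (J t y z) * (\<Prod>j\<in>S. indicator {-R..R} (y j)) * indicator {-R..R} t * \<kappa>S z)"
      by (simp add: case_prod_unfold)
  qed simp
  have add_m: "(\<lambda>(y, t). y(i := t)) \<in> measurable (LP S \<Otimes>\<^sub>M lborel) (LP (insert i S))"
    by (rule measurable_add_dim)
  have int_T: "integrable (LP S \<Otimes>\<^sub>M lborel) (\<lambda>(y, t). T (insert i S) (y(i := t)))"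
    using integrable_distr[OF add_m, of "T (insert i S)"] int distr_fun_upd[of S i] iS(2)
    by (simp add: case_prod_unfold)
  have AE2: "AE y in LP S. integrable lborel (\<lambda>t. T (insert i S) (y(i := t)))"
    using N.AE_integrable_fst'[OF int_T] by simp
  have main: "(LINT t|lborel. T (insert i S) (y(i := t))) = - T S y"
    if y: "y \<in> space (LP S)" and y1: "\<forall>w\<in>Pow (insert i S). integrable (lborel \<Otimes>\<^sub>M ?M)
      (\<lambda>(t, z). D w (J t y z) * (\<Prod>j\<in>S. indicator {-R..R} (y j)) * indicator {-R..R} t * \<kappa>S z)"
      and y2: "integrable lborel (\<lambda>t. T (insert i S) (y(i := t)))" for y
  \<comment> \<open>outside the cube some factor \<open>V j\<close> vanishes, and nothing is known about \<open>D w\<close> there\<close>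
  proof (cases "\<forall>j\<in>S. y j \<in> {-R..R}")
    case False
    then obtain j where j: "j \<in> S" "y j \<notin> {-R..R}" by blast
    then have "V j (y j) = 0" using V(3)[of j "y j"] Siv by force
    then have c0: "c S w y = 0" if "w \<in> Pow S" for w
      using j that by (cases "j \<in> w") (auto simp: c_def intro!: prod_zero)
    have "T (insert i S) (y(i := t)) = 0" for t
      unfolding T_insert[OF iS(2)] using c0 by (intro sum.neutral) auto
    moreover have "T S y = 0" unfolding T_def using c0 by (intro sum.neutral) auto
    ultimately show ?thesis by simp
  next
    case True
    then have box: "(\<Prod>j\<in>S. indicator {-R..R} (y j)) = (1 :: real)" by (intro prod.neutral) auto
    have intD: "integrable (lborel \<Otimes>\<^sub>M ?M) (\<lambda>(t, z). D w (J t y z) * indicator {-R..R} t * \<kappa>S z)"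
      if "w \<subseteq> insert i S" for w
      using y1 that by (simp add: box)
    have G_J: "G (insert i S) w (y(i := t)) = (LINT z|?M. D w (J t y z) * \<kappa>S z)" for w t
      by (simp add: G_def J_def \<kappa>S_def)
    define f f' where "f t z = (\<Sum>w\<in>Pow S. c S w y * (D w (J t y z) * \<kappa>S z))"
      and "f' t z = (\<Sum>w\<in>Pow S. c S w y * (D (insert i w) (J t y z) * \<kappa>S z))" for t z
    define g g' where "g t = (LINT z|?M. f t z)" and "g' t = (LINT z|?M. f' t z)" for t
    have f_int: "integrable (lborel \<Otimes>\<^sub>M ?M) (\<lambda>(t, z). indicator {-R..R} t * f t z)"
    proof -
      have "integrable (lborel \<Otimes>\<^sub>M ?M) (\<lambda>p. \<Sum>w\<in>Pow S. c S w y * (case p of (t, z) \<Rightarrow> D w (J t y z) * indicator {-R..R} t * \<kappa>S z))"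
        by (intro Bochner_Integration.integrable_sum integrable_mult_right intD) auto
      then show ?thesis
        by (rule back_subst[where P="integrable _"]) (auto simp: fun_eq_iff f_def sum_distrib_left mult_ac)
    qed
    have f'_int: "integrable (lborel \<Otimes>\<^sub>M ?M) (\<lambda>(t, z). indicator {-R..R} t * f' t z)"
    proof -
      have "integrable (lborel \<Otimes>\<^sub>M ?M) (\<lambda>p. \<Sum>w\<in>Pow S. c S w y * (case p of (t, z) \<Rightarrow> D (insert i w) (J t y z) * indicator {-R..R} t * \<kappa>S z))"
        by (intro Bochner_Integration.integrable_sum integrable_mult_right intD) auto
      then show ?thesis
        by (rule back_subst[where P="integrable _"]) (auto simp: fun_eq_iff f'_def sum_distrib_left mult_ac)
    qed
    have AEt: "AE t in lborel. \<forall>w\<in>Pow (insert i S). integrable ?M (\<lambda>z. D w (J t y z) * indicator {-R..R} t * \<kappa>S z)"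
    proof (rule AE_finite_allI)
      fix w assume "w \<in> Pow (insert i S)"
      then show "AE t in lborel. integrable ?M (\<lambda>z. D w (J t y z) * indicator {-R..R} t * \<kappa>S z)"
        using P.AE_integrable_fst'[OF intD[of w]] by (simp add: case_prod_unfold)
    qed simp
    have gG: "g t = (\<Sum>w\<in>Pow S. c S w y * G (insert i S) w (y(i := t)))"
        "g' t = (\<Sum>w\<in>Pow S. c S w y * G (insert i S) (insert i w) (y(i := t)))"
      if tR: "t \<in> {-R..R}" and tint: "\<forall>w\<in>Pow (insert i S). integrable ?M (\<lambda>z. D w (J t y z) * indicator {-R..R} t * \<kappa>S z)" for t
    proof -
      have *: "integrable ?M (\<lambda>z. D w (J t y z) * \<kappa>S z)" if "w \<subseteq> insert i S" for w
        using tint[rule_format, of w] tR that by simp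
      show "g t = (\<Sum>w\<in>Pow S. c S w y * G (insert i S) w (y(i := t)))"
        unfolding g_def f_def G_J
        by (subst Bochner_Integration.integral_sum) (auto intro!: *)
      show "g' t = (\<Sum>w\<in>Pow S. c S w y * G (insert i S) (insert i w) (y(i := t)))"
        unfolding g'_def f'_def G_J
        by (subst Bochner_Integration.integral_sum) (auto intro!: *)
    qed
    have TV: "AE t in lborel. T (insert i S) (y(i := t)) = indicator {-R..R} t * (V i t * (\<rho> t * g' t + \<rho>' t * g t))"
      using AEt
    proof eventually_elim
      case (elim t)
      show ?case
      proof (cases "t \<in> {-R..R}")
        case True
        show ?thesis
          unfolding T_insert[OF iS(2)] gG[OF True elim] using True
          by (simp add: sum_distrib_left sum.distrib[symmetric] algebra_simps)
      next
        case False
        then have "V i t = 0" using V(3)[of i t] Siv by force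
        then show ?thesis by (simp add: T_insert[OF iS(2)])
      qed
    qed
    have mg: "(\<lambda>t. indicator {-R..R} t * g t) \<in> borel_measurable lborel"
      using borel_measurable_integrable[OF P.integrable_fst'[OF f_int]] by (simp add: g_def)
    have mg': "(\<lambda>t. indicator {-R..R} t * g' t) \<in> borel_measurable lborel"
      using borel_measurable_integrable[OF P.integrable_fst'[OF f'_int]] by (simp add: g'_def)
    have mV: "(\<lambda>t. indicator {-R..R} t * (V i t * (\<rho> t * g' t + \<rho>' t * g t))) \<in> borel_measurable lborel"
    proof -
      have "(\<lambda>t. V i t * (\<rho> t * (indicator {-R..R} t * g' t) + \<rho>' t * (indicator {-R..R} t * g t))) \<in> borel_measurable lborel"
        by (rule borel_measurable_times[OF _ borel_measurable_add[OF borel_measurable_times[OF _ mg'] borel_measurable_times[OF _ mg]]])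
           (use V_meas[OF Siv(2)] \<rho>_meas \<rho>(2) in auto)
      then show ?thesis
        by (rule back_subst[where P="\<lambda>h. h \<in> borel_measurable lborel"]) (auto simp: fun_eq_iff algebra_simps)
    qed
    have intV: "integrable lborel (\<lambda>t. indicator {-R..R} t * (V i t * (\<rho> t * g' t + \<rho>' t * g t)))"
      by (rule integrable_cong_AE_imp[OF y2 mV TV])
    have "(LINT t|lborel. T (insert i S) (y(i := t))) = (LINT t|lborel. indicator {-R..R} t * (V i t * (\<rho> t * g' t + \<rho>' t * g t)))"
      by (rule integral_cong_AE[OF borel_measurable_integrable[OF y2] mV TV])
    also have "\<dots> = - (LINT t|lborel. indicator {-R..R} t * (V' i t * \<rho> t * g t))"
      unfolding g_def g'_def
    proof (rule parametric_ibp[OF sfM R f_int f'_int])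
      show "((\<lambda>t. f t z) has_real_derivative f' t z) (at t)" for t z
        unfolding f_def f'_def
      proof (rule DERIV_sum)
        fix w assume "w \<in> Pow S"
        then have "((\<lambda>t. D w (J 0 y z + t *\<^sub>R axis i 1)) has_real_derivative D (insert i w) (J 0 y z + t *\<^sub>R axis i 1)) (at t)"
          using iS by (intro D_deriv) auto
        then have "((\<lambda>t. D w (J t y z)) has_real_derivative D (insert i w) (J t y z)) (at t)"
          by (subst (1 2) J_shift)
        then show "((\<lambda>t. c S w y * (D w (J t y z) * \<kappa>S z)) has_real_derivative c S w y * (D (insert i w) (J t y z) * \<kappa>S z)) (at t)"
          by (intro DERIV_cmult DERIV_cmult_right)
      qed
      show "continuous_on UNIV (V' i)" by (rule V(2)) fact
      show "V i (-R) = 0" "V i R = 0" using V(3)[OF Siv(2)] by auto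
      show "integrable lborel (\<lambda>t. indicator {-R..R} t * (V i t * (\<rho> t * (LINT z|?M. f' t z) + \<rho>' t * (LINT z|?M. f t z))))"
        using intV by (simp add: g_def g'_def)
    qed (intro \<rho> V Siv)+
    also have "(LINT t|lborel. indicator {-R..R} t * (V' i t * \<rho> t * g t)) = T S y"
    proof -
      have intK: "integrable (lborel \<Otimes>\<^sub>M ?M) (\<lambda>(t, z). D w (J t y z) * \<kappa>S z * K i t)" if w: "w \<subseteq> insert i S" for w
      proof -
        obtain B where B: "\<And>t. \<bar>K i t\<bar> \<le> B" using K_bounded[OF Siv(2)] by blast
        have "integrable (lborel \<Otimes>\<^sub>M ?M) (\<lambda>p. (case p of (t, z) \<Rightarrow> D w (J t y z) * indicator {-R..R} t * \<kappa>S z) * K i (fst p))"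
          by (rule integrable_mult_bounded[OF intD[OF w] _ B]) (use K_meas in measurable)
        then show ?thesis
          by (rule back_subst[where P="integrable _"])
             (use K_outside[OF Siv(2)] in \<open>auto simp: fun_eq_iff indicator_def\<close>)
      qed
      have GS: "G S w y = (LINT t|lborel. K i t * G (insert i S) w (y(i := t)))"
          "integrable lborel (\<lambda>t. K i t * G (insert i S) w (y(i := t)))" if w: "w \<subseteq> S" for w
      proof -
        have U: "UNIV - S = insert i (UNIV - insert i S)" using iS by auto
        let ?h = "\<lambda>z. D w (join S y z) * (\<Prod>j\<in>UNIV - S. K j (z j))"
        have m1: "?h \<in> borel_measurable (LP (UNIV - S))"
        proof (intro borel_measurable_times borel_measurable_prod measurable_compose[OF _ K_meas] LP_component_measurable)
          show "(\<lambda>z. D w (join S y z)) \<in> borel_measurable (LP (UNIV - S))"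
            using measurable_compose[OF measurable_compose[OF measurable_Pair1'[OF y] join_measurable] D_meas[of w]] w Siv
            by auto
        qed
        have m2: "(\<lambda>(t, y). y(i := t)) \<in> measurable (lborel \<Otimes>\<^sub>M ?M) (LP (UNIV - S))"
          using measurable_compose[OF measurable_pair_swap' measurable_add_dim[of i "UNIV - insert i S" "\<lambda>_. lborel :: real measure"]]
          unfolding U by (simp add: case_prod_unfold)
        have "G S w y = (LINT z|distr (lborel \<Otimes>\<^sub>M ?M) (LP (UNIV - S)) (\<lambda>(t, y). y(i := t)). ?h z)"
          unfolding G_def using distr_fun_upd'[of "UNIV - insert i S" i] U by simp
        also have "\<dots> = (LINT p|(lborel \<Otimes>\<^sub>M ?M). ?h ((\<lambda>(t, y). y(i := t)) p))"
          by (rule integral_distr[OF m2 m1])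
        also have "\<dots> = (LINT p|(lborel \<Otimes>\<^sub>M ?M). (case p of (t, z) \<Rightarrow> D w (J t y z) * \<kappa>S z * K i t))"
        proof (rule Bochner_Integration.integral_cong[OF refl])
          fix p :: "real \<times> ('s \<Rightarrow> real)"
          obtain t z where p: "p = (t, z)" by (cases p)
          have "(\<Prod>j\<in>UNIV - insert i S. K j ((z(i := t)) j)) = \<kappa>S z"
            unfolding \<kappa>S_def by (intro prod.cong) auto
          then have "(\<Prod>j\<in>UNIV - S. K j ((z(i := t)) j)) = K i t * \<kappa>S z"
            unfolding U by (subst prod.insert) (auto simp: U[symmetric])
          then show "?h ((\<lambda>(t, y). y(i := t)) p) = (case p of (t, z) \<Rightarrow> D w (J t y z) * \<kappa>S z * K i t)"
            unfolding p by (simp add: J_def join_fun_upd[OF iS(2)] del: fun_upd_apply)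
        qed
        also have "\<dots> = (LINT t|lborel. (LINT z|?M. D w (J t y z) * \<kappa>S z * K i t))"
          using P.integral_fst[OF intK[of w]] w by (simp add: subset_insertI2)
        finally show "G S w y = (LINT t|lborel. K i t * G (insert i S) w (y(i := t)))"
          by (simp add: G_J mult.commute)
        show "integrable lborel (\<lambda>t. K i t * G (insert i S) w (y(i := t)))"
          using P.integrable_fst[OF intK[of w]] w by (simp add: subset_insertI2 G_J mult.commute)
      qed
      have "(LINT t|lborel. indicator {-R..R} t * (V' i t * \<rho> t * g t)) =
          (LINT t|lborel. (\<Sum>w\<in>Pow S. c S w y * (K i t * G (insert i S) w (y(i := t)))))"
      proof (rule integral_cong_AE)
        have "(\<lambda>t. (V' i t * \<rho> t) * (indicator {-R..R} t * g t)) \<in> borel_measurable lborel"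
          by (rule borel_measurable_times[OF _ mg]) (use V'_meas[OF Siv(2)] \<rho>_meas in auto)
        then show "(\<lambda>t. indicator {-R..R} t * (V' i t * \<rho> t * g t)) \<in> borel_measurable lborel"
          by (rule back_subst[where P="\<lambda>h. h \<in> borel_measurable lborel"]) (auto simp: fun_eq_iff)
        show "(\<lambda>t. \<Sum>w\<in>Pow S. c S w y * (K i t * G (insert i S) w (y(i := t)))) \<in> borel_measurable lborel"
          by (intro borel_measurable_integrable Bochner_Integration.integrable_sum integrable_mult_right GS(2)) auto
        show "AE t in lborel. indicator {-R..R} t * (V' i t * \<rho> t * g t) =
            (\<Sum>w\<in>Pow S. c S w y * (K i t * G (insert i S) w (y(i := t))))"
          using AEt
        proof eventually_elim
          case (elim t)
          show ?case
          proof (cases "t \<in> {-R..R}")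
            case True
            then show ?thesis unfolding gG(1)[OF True elim]
              using Siv by (simp add: K_def sum_distrib_left mult_ac)
          next
            case False
            then show ?thesis using K_outside[OF Siv(2)] by simp
          qed
        qed
      qed
      also have "\<dots> = (\<Sum>w\<in>Pow S. c S w y * G S w y)"
        by (subst Bochner_Integration.integral_sum) (auto simp: GS)
      finally show ?thesis by (simp add: T_def)
    qed
    finally show ?thesis .
  qed
  have AEm: "AE y in LP S. (LINT t|lborel. T (insert i S) (y(i := t))) = - T S y"
    using AE1 AE2 AE_space by eventually_elim (rule main)
  have fst_int: "integrable (LP S) (\<lambda>y. LINT t|lborel. T (insert i S) (y(i := t)))"
    using N.integrable_fst'[OF int_T] by simp
  have "integrable (LP S) (\<lambda>y. - T S y)"
    by (rule integrable_cong_AE_imp[OF fst_int _ AEm]) (use T_meas[OF Siv(1)] in simp)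
  then show "integrable (LP S) (T S)" by simp
  have "(LINT y|LP (insert i S). T (insert i S) y) = (LINT p|(LP S \<Otimes>\<^sub>M lborel). T (insert i S) ((\<lambda>(y, t). y(i := t)) p))"
    using integral_distr[OF add_m, of "T (insert i S)"] distr_fun_upd[of S i] iS(2) int
    by (auto dest: borel_measurable_integrable)
  also have "\<dots> = (LINT y|LP S. LINT t|lborel. T (insert i S) (y(i := t)))"
    using N.integral_fst'[OF int_T] by (simp add: case_prod_unfold)
  also have "\<dots> = (LINT y|LP S. - T S y)"
    by (rule integral_cong_AE[OF borel_measurable_integrable[OF fst_int] _ AEm]) (use T_meas[OF Siv(1)] in simp)
  finally show "(LINT y|LP (insert i S). T (insert i S) y) = - (LINT y|LP S. T S y)" by simp
qed

lemma T_empty: "T {} y = G {} {} y"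
  by (simp add: T_def c_def)

text \<open>Coordinates are unfrozen one after the other; with none left, \<open>T {}\<close> is the full integral.\<close>
theorem rough_integration_by_parts:
  assumes "S \<subseteq> v" "integrable (LP S) (T S)"
  shows "(LINT y|LP S. T S y) = (-1) ^ card S * (LINT x|lborel. D {} x * (\<Prod>j\<in>UNIV. K j (x $ j)))"
proof -
  have "finite S" by simp
  then show ?thesis using assms
  proof (induction S rule: finite_induct)
    case empty
    interpret product_sigma_finite "\<lambda>_. lborel :: real measure" by (rule product_sigma_finite_lborel)
    note m = vec_lambda_borel
    have "(LINT y|LP {}. T {} y) = G {} {} (\<lambda>_. undefined)"
      by (simp add: PiM_empty lebesgue_integral_count_space_finite T_empty)
    also have "\<dots> = (LINT z|LP UNIV. D {} (vec_lambda z) * (\<Prod>j\<in>UNIV. K j (vec_lambda z $ j)))"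
      by (simp add: G_def join_def)
    also have "\<dots> = (LINT x|lborel. D {} x * (\<Prod>j\<in>UNIV. K j (x $ j)))"
      unfolding lborel_vec[symmetric]
      by (subst integral_distr[OF m]) (use D_meas[of "{}"] K_meas in \<open>auto intro!: borel_measurable_times borel_measurable_prod\<close>)
    finally show ?case by simp
  next
    case (insert i S)
    then show ?case using step[of i S] by simp
  qed
qed

end

section \<open>The first integration by parts in several coordinates\<close>

lemma integrable_bounded_compact_support:
  fixes f g :: "'a::euclidean_space \<Rightarrow> real"
  assumes "compact A" "continuous_on UNIV f" "g \<in> borel_measurable borel"
    and "\<And>x. \<bar>g x\<bar> \<le> B" and "\<And>x. x \<notin> A \<Longrightarrow> g x = 0"
  shows "integrable lborel (\<lambda>x. f x * g x)"
proof -
  have "integrable lborel (\<lambda>x. indicator A x *\<^sub>R f x)"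
    using assms(1,2) by (intro borel_integrable_compact) (auto intro: continuous_on_subset)
  then have "integrable lborel (\<lambda>x. (indicator A x *\<^sub>R f x) * g x)"
    by (rule integrable_mult_bounded) (use assms in auto)
  moreover have "(\<lambda>x. (indicator A x *\<^sub>R f x) * g x) = (\<lambda>x. f x * g x)"
    using assms(5) by (auto simp: indicator_def fun_eq_iff)
  ultimately show ?thesis by metis
qed

lemma compact_cube: "compact {x :: real ^ 's::finite. \<forall>j. \<bar>x $ j\<bar> \<le> R}"
proof -
  have "{x :: real ^ 's. \<forall>j. \<bar>x $ j\<bar> \<le> R} = cbox (\<chi> j. -R) (\<chi> j. R)"
    by (auto simp: mem_box_cart abs_le_iff minus_le_iff)
  then show ?thesis by (simp add: compact_cbox)
qed

lemma integrable_product_kernel: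
  fixes f :: "real ^ 's::finite \<Rightarrow> real" and k :: "'s \<Rightarrow> real \<Rightarrow> real"
  assumes "continuous_on UNIV f" and km: "\<And>j. k j \<in> borel_measurable borel"
    and kb: "\<And>j. \<exists>B. \<forall>t. \<bar>k j t\<bar> \<le> B" and k0: "\<And>j t. R < \<bar>t\<bar> \<Longrightarrow> k j t = 0"
  shows "integrable lborel (\<lambda>x. f x * (\<Prod>j\<in>UNIV. k j (x $ j)))"
proof -
  obtain B where B: "\<And>j t. \<bar>k j t\<bar> \<le> B j" using kb by metis
  show ?thesis
  proof (rule integrable_bounded_compact_support[OF compact_cube[of R] assms(1)])
    show "(\<lambda>x. \<Prod>j\<in>UNIV. k j (x $ j)) \<in> borel_measurable borel"
      using km by measurable
    show "\<bar>\<Prod>j\<in>UNIV. k j (x $ j)\<bar> \<le> (\<Prod>j\<in>UNIV. B j)" for x :: "real ^ 's"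
      unfolding abs_prod using B by (intro prod_mono) auto
    show "(\<Prod>j\<in>UNIV. k j (x $ j)) = 0" if "x \<notin> {x. \<forall>j. \<bar>x $ j\<bar> \<le> R}" for x :: "real ^ 's"
      using that k0 by (auto simp: not_le intro!: prod_zero)
  qed
qed

text \<open>On each line parallel to the \<open>i\<close>-axis the sum of both integrands is the derivative of
\<open>f * p\<close>, up to finitely many points, and \<open>p\<close> vanishes at both ends.\<close>
lemma coordinate_ibp:
  fixes f f' :: "real ^ 's::finite \<Rightarrow> real" and k :: "'s \<Rightarrow> real \<Rightarrow> real" and b p :: "real \<Rightarrow> real"
  assumes f: "continuous_on UNIV f" and f': "continuous_on UNIV f'"
    and der: "\<And>x t. ((\<lambda>t. f (x + t *\<^sub>R axis i 1)) has_real_derivative f' (x + t *\<^sub>R axis i 1)) (at t)"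
    and p: "continuous_on UNIV p" and X: "finite X"
    and pb: "\<And>t. t \<notin> X \<Longrightarrow> (p has_real_derivative b t) (at t)"
    and bm: "b \<in> borel_measurable borel" and bb: "\<And>t. \<bar>b t\<bar> \<le> B"
    and R: "0 < R" and b0: "\<And>t. R \<le> \<bar>t\<bar> \<Longrightarrow> b t = 0" and p0: "\<And>t. R \<le> \<bar>t\<bar> \<Longrightarrow> p t = 0"
    and km: "\<And>j. k j \<in> borel_measurable borel"
    and kb: "\<And>j. \<exists>B. \<forall>t. \<bar>k j t\<bar> \<le> B" and k0: "\<And>j t. R < \<bar>t\<bar> \<Longrightarrow> k j t = 0"
  shows "(LINT x|lborel. f x * (\<Prod>j\<in>UNIV. (k(i := b)) j (x $ j)))
      = - (LINT x|lborel. f' x * (\<Prod>j\<in>UNIV. (k(i := p)) j (x $ j)))"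
proof -
  interpret product_sigma_finite "\<lambda>_. lborel :: real measure" by (rule product_sigma_finite_lborel)
  obtain A where pA: "\<And>t. \<bar>p t\<bar> \<le> A" using continuous_bounded_support[OF p p0] by blast
  have pm: "p \<in> borel_measurable borel" using p by (rule borel_measurable_continuous_onI)
  have i1: "integrable lborel (\<lambda>x. f x * (\<Prod>j\<in>UNIV. (k(i := b)) j (x $ j)))"
    by (rule integrable_product_kernel[OF f, where R=R]) (use km kb k0 bm bb b0 in auto)
  have i2: "integrable lborel (\<lambda>x. f' x * (\<Prod>j\<in>UNIV. (k(i := p)) j (x $ j)))"
    by (rule integrable_product_kernel[OF f', where R=R]) (use km kb k0 pm pA p0 in auto)
  let ?H = "\<lambda>x. f x * (\<Prod>j\<in>UNIV. (k(i := b)) j (x $ j)) + f' x * (\<Prod>j\<in>UNIV. (k(i := p)) j (x $ j))"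
  have iH: "integrable lborel ?H" using i1 i2 by (rule Bochner_Integration.integrable_add)
  note m = vec_lambda_borel
  have U: "(UNIV :: 's set) = insert i (UNIV - {i})" by auto
  have "integral\<^sup>L lborel ?H = integral\<^sup>L (distr (LP UNIV) borel vec_lambda) ?H"
    by (simp add: lborel_vec)
  also have "\<dots> = (LINT y|LP UNIV. ?H (vec_lambda y))"
    by (rule integral_distr[OF m]) (use borel_measurable_integrable[OF iH] in simp)
  also have "\<dots> = (LINT y|LP (insert i (UNIV - {i})). ?H (vec_lambda y))"
    using U by simp
  also have "\<dots> = (LINT y|LP (UNIV - {i}). (LINT t|lborel. ?H (vec_lambda (y(i := t)))))"
  proof (rule product_integral_insert)
    have "integrable (LP UNIV) (\<lambda>y. ?H (vec_lambda y))"
      by (rule integrable_distr[OF m]) (use iH in \<open>simp add: lborel_vec\<close>)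
    then show "integrable (LP (insert i (UNIV - {i}))) (\<lambda>y. ?H (vec_lambda y))"
      using U by simp
  qed auto
  also have "\<dots> = (LINT y|LP (UNIV - {i}). 0)"
  proof (rule Bochner_Integration.integral_cong[OF refl])
    fix y :: "'s \<Rightarrow> real"
    define x0 :: "real ^ 's" where "x0 = vec_lambda (y(i := 0))"
    have shift: "vec_lambda (y(i := t)) = x0 + t *\<^sub>R axis i 1" for t
      by (auto simp: x0_def vec_eq_iff axis_def)
    let ?f = "\<lambda>t. f (x0 + t *\<^sub>R axis i 1)" and ?f' = "\<lambda>t. f' (x0 + t *\<^sub>R axis i 1)"
    let ?k = "\<Prod>j\<in>UNIV - {i}. k j (y j)"
    have pr: "(\<Prod>j\<in>UNIV. (k(i := q)) j (vec_lambda (y(i := t)) $ j)) = q t * ?k" for q t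
    proof -
      have "(\<Prod>j\<in>UNIV - {i}. (k(i := q)) j (vec_lambda (y(i := t)) $ j)) = ?k"
        by (intro prod.cong) auto
      then show ?thesis by (subst prod.remove[of _ i]) auto
    qed
    have cf: "continuous_on UNIV ?f" "continuous_on UNIV ?f'"
      by (intro continuous_on_compose2[OF f] continuous_on_compose2[OF f'] continuous_intros; simp)+
    have j1: "integrable lborel (\<lambda>t. ?f t * b t)"
      by (rule integrable_bounded_compact_support[of "{-R..R}" _ b B]) (use cf bm bb b0 in auto)
    have j2: "integrable lborel (\<lambda>t. ?f' t * p t)"
      by (rule integrable_bounded_compact_support[of "{-R..R}" _ p A]) (use cf pm pA p0 in auto)
    have "((\<lambda>t. ?f t * b t + ?f' t * p t) has_integral (?f R * p R - ?f (-R) * p (-R))) {-R..R}"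
    proof (rule fundamental_theorem_of_calculus_interior_strong[OF X])
      fix t assume "t \<in> {-R<..<R} - X"
      then have "((\<lambda>t. ?f t * p t) has_real_derivative ?f' t * p t + b t * ?f t) (at t)"
        by (intro DERIV_mult der pb) auto
      then show "((\<lambda>t. ?f t * p t) has_vector_derivative ?f t * b t + ?f' t * p t) (at t)"
        by (simp add: has_real_derivative_iff_has_vector_derivative[symmetric] algebra_simps)
    qed (use R in \<open>auto intro!: continuous_on_mult continuous_on_subset[OF cf(1)] continuous_on_subset[OF p]\<close>)
    then have h0: "((\<lambda>t. ?f t * b t + ?f' t * p t) has_integral 0) {-R..R}"
      using p0[of R] p0[of "-R"] R by simp
    have "((\<lambda>t. ?f t * b t + ?f' t * p t) has_integral 0) UNIV"
      by (rule has_integral_on_superset[OF h0]) (use b0 p0 in \<open>auto simp: not_le\<close>)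
    moreover have "((\<lambda>t. ?f t * b t + ?f' t * p t) has_integral (LINT t|lborel. ?f t * b t + ?f' t * p t)) UNIV"
      by (intro has_integral_integral_lborel Bochner_Integration.integrable_add j1 j2)
    ultimately have "(LINT t|lborel. ?f t * b t + ?f' t * p t) = 0"
      using has_integral_unique by blast
    then have "(LINT t|lborel. (?f t * b t + ?f' t * p t) * ?k) = 0" by simp
    then show "(LINT t|lborel. ?H (vec_lambda (y(i := t)))) = 0"
      unfolding pr unfolding shift by (simp add: algebra_simps)
  qed
  finally have "integral\<^sup>L lborel ?H = 0" by simp
  then show ?thesis using i1 i2 by simp
qed

text \<open>The intermediate derivatives of \<open>F\<close> are only continuous, with no integrability at infinity;
therefore all kernels have compact support here.\<close>
lemma iterated_ibp:
  fixes F :: "real ^ 's::finite \<Rightarrow> real" and b p k :: "'s \<Rightarrow> real \<Rightarrow> real"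
  assumes F: "suff_smooth F" and R: "0 < R"
    and p: "\<And>j. j \<in> u \<Longrightarrow> continuous_on UNIV (p j)" and X: "\<And>j. j \<in> u \<Longrightarrow> finite (X j)"
    and pb: "\<And>j t. j \<in> u \<Longrightarrow> t \<notin> X j \<Longrightarrow> (p j has_real_derivative b j t) (at t)"
    and bm: "\<And>j. j \<in> u \<Longrightarrow> b j \<in> borel_measurable borel" and bb: "\<And>j. j \<in> u \<Longrightarrow> \<exists>B. \<forall>t. \<bar>b j t\<bar> \<le> B"
    and b0: "\<And>j t. j \<in> u \<Longrightarrow> R \<le> \<bar>t\<bar> \<Longrightarrow> b j t = 0" and p0: "\<And>j t. j \<in> u \<Longrightarrow> R \<le> \<bar>t\<bar> \<Longrightarrow> p j t = 0"
    and km: "\<And>j. j \<notin> u \<Longrightarrow> k j \<in> borel_measurable borel"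
    and kb: "\<And>j. j \<notin> u \<Longrightarrow> \<exists>B. \<forall>t. \<bar>k j t\<bar> \<le> B" and k0: "\<And>j t. j \<notin> u \<Longrightarrow> R < \<bar>t\<bar> \<Longrightarrow> k j t = 0"
  shows "distinct js \<Longrightarrow> set js \<subseteq> u \<Longrightarrow>
      (LINT x|lborel. F x * (\<Prod>j\<in>UNIV. (if j \<in> u then b j else k j) (x $ j))) =
      (-1) ^ length js * (LINT x|lborel. iter_partial js F x *
        (\<Prod>j\<in>UNIV. (if j \<in> set js then p j else if j \<in> u then b j else k j) (x $ j)))"
proof (induction js)
  case Nil
  then show ?case by (simp add: iter_partial_def)
next
  case (Cons i js)
  define \<kappa> where "\<kappa> j = (if j \<in> set js then p j else if j \<in> u then b j else k j)" for j
  have pbnd: "\<exists>B. \<forall>t. \<bar>p j t\<bar> \<le> B" if "j \<in> u" for j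
    using continuous_bounded_support[OF p[OF that] p0[OF that]] by blast
  have i: "i \<in> u" "i \<notin> set js" using Cons.prems by auto
  obtain B where B: "\<And>t. \<bar>b i t\<bar> \<le> B" using bb[OF i(1)] by blast
  have "(LINT x|lborel. iter_partial js F x * (\<Prod>j\<in>UNIV. (\<kappa>(i := b i)) j (x $ j))) =
      - (LINT x|lborel. iter_partial (i # js) F x * (\<Prod>j\<in>UNIV. (\<kappa>(i := p i)) j (x $ j)))"
  proof (rule coordinate_ibp[OF _ _ _ p[OF i(1)] X[OF i(1)] pb[OF i(1)] bm[OF i(1)] B R b0[OF i(1)] p0[OF i(1)]])
    show "continuous_on UNIV (iter_partial js F)" "continuous_on UNIV (iter_partial (i # js) F)"
      using Cons.prems by (intro iter_partial_cont[OF F]; simp)+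
    show "((\<lambda>t. iter_partial js F (x + t *\<^sub>R axis i 1)) has_real_derivative iter_partial (i # js) F (x + t *\<^sub>R axis i 1)) (at t)" for x t
      using Cons.prems by (intro iter_partial_DERIV[OF F]) simp
    show "\<kappa> j \<in> borel_measurable borel" for j
      using Cons.prems p bm km by (auto simp: \<kappa>_def intro!: borel_measurable_continuous_onI)
    show "\<exists>B. \<forall>t. \<bar>\<kappa> j t\<bar> \<le> B" for j
      using Cons.prems pbnd[of j] bb[of j] kb[of j] by (auto simp: \<kappa>_def)
    show "\<kappa> j t = 0" if "R < \<bar>t\<bar>" for j t
      using that Cons.prems p0[of j t] b0[of j t] k0[of j t] by (auto simp: \<kappa>_def)
  qed
  moreover have "\<kappa>(i := b i) = \<kappa>" using i by (auto simp: \<kappa>_def fun_eq_iff)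
  moreover have "\<kappa>(i := p i) = (\<lambda>j. if j \<in> set (i # js) then p j else if j \<in> u then b j else k j)"
    by (auto simp: \<kappa>_def fun_eq_iff)
  ultimately show ?case using Cons by (simp add: \<kappa>_def)
qed

text \<open>The density in the coordinates outside \<open>u\<close> is cut off to \<open>{-n..n}\<close>, and dominated convergence
removes the cutoff on both sides: only the first and the last derivative occur there, and these two
are integrable against the density.\<close>
lemma smooth_integration_by_parts:
  fixes F :: "real ^ 's::finite \<Rightarrow> real" and b p :: "'s \<Rightarrow> real \<Rightarrow> real" and \<phi> :: "real \<Rightarrow> real"
  assumes F: "suff_smooth F" and R: "0 < R" and \<phi>: "continuous_on UNIV \<phi>"
    and p: "\<And>j. j \<in> u \<Longrightarrow> continuous_on UNIV (p j)" and X: "\<And>j. j \<in> u \<Longrightarrow> finite (X j)"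
    and pb: "\<And>j t. j \<in> u \<Longrightarrow> t \<notin> X j \<Longrightarrow> (p j has_real_derivative b j t) (at t)"
    and bm: "\<And>j. j \<in> u \<Longrightarrow> b j \<in> borel_measurable borel" and bb: "\<And>j. j \<in> u \<Longrightarrow> \<exists>B. \<forall>t. \<bar>b j t\<bar> \<le> B"
    and b0: "\<And>j t. j \<in> u \<Longrightarrow> R \<le> \<bar>t\<bar> \<Longrightarrow> b j t = 0" and p0: "\<And>j t. j \<in> u \<Longrightarrow> R \<le> \<bar>t\<bar> \<Longrightarrow> p j t = 0"
    and i1: "integrable lborel (\<lambda>x. F x * (\<Prod>j\<in>u. b j (x $ j)) * (\<Prod>j\<in>UNIV - u. \<phi> (x $ j)))"
    and i2: "integrable lborel (\<lambda>x. mixed_deriv {} u F x * (\<Prod>j\<in>u. p j (x $ j)) * (\<Prod>j\<in>UNIV - u. \<phi> (x $ j)))"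
  shows "(LINT x|lborel. F x * (\<Prod>j\<in>u. b j (x $ j)) * (\<Prod>j\<in>UNIV - u. \<phi> (x $ j))) =
    (-1) ^ card u * (LINT x|lborel. mixed_deriv {} u F x * (\<Prod>j\<in>u. p j (x $ j)) * (\<Prod>j\<in>UNIV - u. \<phi> (x $ j)))"
proof -
  define k where "k n t = indicator {-real n..real n} t * \<phi> t" for n t
  define D where "D = mixed_deriv {} u F"
  have split: "(\<Prod>j\<in>UNIV. (if j \<in> u then q j else r) (x $ j)) = (\<Prod>j\<in>u. q j (x $ j)) * (\<Prod>j\<in>UNIV - u. r (x $ j))"
    for q :: "'s \<Rightarrow> real \<Rightarrow> real" and r :: "real \<Rightarrow> real" and x :: "real ^ 's"
  proof -
    have "(\<Prod>j\<in>UNIV. (if j \<in> u then q j else r) (x $ j)) = (\<Prod>j\<in>UNIV - u. (if j \<in> u then q j else r) (x $ j)) * (\<Prod>j\<in>u. (if j \<in> u then q j else r) (x $ j))"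
      by (rule prod.subset_diff) auto
    then show ?thesis by (simp add: mult.commute)
  qed
  have trunc: "(LINT x|lborel. F x * (\<Prod>j\<in>u. b j (x $ j)) * (\<Prod>j\<in>UNIV - u. k n (x $ j))) =
    (-1) ^ card u * (LINT x|lborel. D x * (\<Prod>j\<in>u. p j (x $ j)) * (\<Prod>j\<in>UNIV - u. k n (x $ j)))" for n
  proof -
    have "(LINT x|lborel. F x * (\<Prod>j\<in>UNIV. (if j \<in> u then b j else k n) (x $ j))) =
      (-1) ^ length (enum_list u) * (LINT x|lborel. iter_partial (enum_list u) F x *
        (\<Prod>j\<in>UNIV. (if j \<in> set (enum_list u) then p j else if j \<in> u then b j else k n) (x $ j)))"
    proof (rule iterated_ibp[OF F, where R="max R (real n)" and X=X])
      show "k n \<in> borel_measurable borel"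
        unfolding k_def[abs_def] using borel_measurable_continuous_onI[OF \<phi>] by measurable
      show "\<exists>B. \<forall>t. \<bar>k n t\<bar> \<le> B"
        using continuous_bounded_on_Icc[OF \<phi>, of "real n"] by (force simp: k_def indicator_def)
    qed (use R p X pb bm bb b0 p0 in \<open>auto simp: enum_list k_def indicator_def\<close>)
    moreover have "length (enum_list u) = card u"
      using enum_list[of u] by (metis distinct_card)
    moreover have "(if j \<in> set (enum_list u) then p j else if j \<in> u then b j else k n) = (if j \<in> u then p j else k n)" for j
      by (simp add: enum_list)
    ultimately show ?thesis by (simp only: split D_def mixed_deriv_empty mult.assoc)
  qed
  have lim: "(\<lambda>n. LINT x|lborel. h x * (\<Prod>j\<in>UNIV - u. k n (x $ j))) \<longlonglongrightarrow> (LINT x|lborel. h x * (\<Prod>j\<in>UNIV - u. \<phi> (x $ j)))"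
    if h: "integrable lborel (\<lambda>x. h x * (\<Prod>j\<in>UNIV - u. \<phi> (x $ j)))" for h :: "real ^ 's \<Rightarrow> real"
  proof -
    have eq: "h x * (\<Prod>j\<in>UNIV - u. k n (x $ j)) = (h x * (\<Prod>j\<in>UNIV - u. \<phi> (x $ j))) * (\<Prod>j\<in>UNIV - u. indicator {-real n..real n} (x $ j))" for x n
      by (simp add: k_def prod.distrib mult_ac)
    show ?thesis unfolding eq
    proof (rule integral_dominated_convergence[where w="\<lambda>x. norm (h x * (\<Prod>j\<in>UNIV - u. \<phi> (x $ j)))"])
      have pi: "(0::real) \<le> (\<Prod>j\<in>UNIV - u. indicator {-real n..real n} (x $ j)) \<and> (\<Prod>j\<in>UNIV - u. indicator {-real n..real n} (x $ j)) \<le> (1::real)" for n and x :: "real ^ 's"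
        by (auto intro!: prod_nonneg prod_le_1)
      show "AE x in lborel. norm ((h x * (\<Prod>j\<in>UNIV - u. \<phi> (x $ j))) * (\<Prod>j\<in>UNIV - u. indicator {-real n..real n} (x $ j))) \<le> norm (h x * (\<Prod>j\<in>UNIV - u. \<phi> (x $ j)))" for n
      proof (intro AE_I2)
        fix x :: "real ^ 's"
        have "norm (h x * (\<Prod>j\<in>UNIV - u. \<phi> (x $ j))) * norm (\<Prod>j\<in>UNIV - u. indicator {-real n..real n} (x $ j) :: real) \<le> norm (h x * (\<Prod>j\<in>UNIV - u. \<phi> (x $ j))) * 1"
          using pi[of n x] by (intro mult_left_mono) auto
        then show "norm ((h x * (\<Prod>j\<in>UNIV - u. \<phi> (x $ j))) * (\<Prod>j\<in>UNIV - u. indicator {-real n..real n} (x $ j))) \<le> norm (h x * (\<Prod>j\<in>UNIV - u. \<phi> (x $ j)))"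
          by (simp only: norm_mult mult_1_right)
      qed
      show "AE x in lborel. (\<lambda>n. h x * (\<Prod>j\<in>UNIV - u. \<phi> (x $ j)) * (\<Prod>j\<in>UNIV - u. indicator {-real n..real n} (x $ j))) \<longlonglongrightarrow> h x * (\<Prod>j\<in>UNIV - u. \<phi> (x $ j))"
      proof (intro AE_I2)
        fix x :: "real ^ 's"
        obtain m :: nat where m: "norm x \<le> real m" using real_arch_simple by blast
        have "eventually (\<lambda>n. (\<Prod>j\<in>UNIV - u. indicator {-real n..real n} (x $ j)) = (1::real)) sequentially"
          using eventually_ge_at_top[of m]
        proof eventually_elim
          case (elim n)
          have "\<bar>x $ j\<bar> \<le> real n" for j
            using component_le_norm_cart[of x j] m elim by linarith
          then show ?case by (intro prod.neutral) (auto simp: indicator_def abs_le_iff minus_le_iff)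
        qed
        then have "(\<lambda>n. \<Prod>j\<in>UNIV - u. indicator {-real n..real n} (x $ j)) \<longlonglongrightarrow> (1::real)"
          by (rule tendsto_eventually)
        from tendsto_mult_left[OF this, of "h x * (\<Prod>j\<in>UNIV - u. \<phi> (x $ j))"]
        show "(\<lambda>n. h x * (\<Prod>j\<in>UNIV - u. \<phi> (x $ j)) * (\<Prod>j\<in>UNIV - u. indicator {-real n..real n} (x $ j))) \<longlonglongrightarrow> h x * (\<Prod>j\<in>UNIV - u. \<phi> (x $ j))"
          by simp
      qed
      show "(\<lambda>x. (h x * (\<Prod>j\<in>UNIV - u. \<phi> (x $ j))) * (\<Prod>j\<in>UNIV - u. indicator {-real n..real n} (x $ j))) \<in> borel_measurable lborel" for n
        by (rule borel_measurable_times[OF borel_measurable_integrable[OF h]]) measurable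
    qed (use h in auto)
  qed
  show ?thesis
  proof (rule LIMSEQ_unique[OF lim[of "\<lambda>x. F x * (\<Prod>j\<in>u. b j (x $ j))", OF i1]])
    show "(\<lambda>n. LINT x|lborel. F x * (\<Prod>j\<in>u. b j (x $ j)) * (\<Prod>j\<in>UNIV - u. k n (x $ j))) \<longlonglongrightarrow>
      (-1) ^ card u * (LINT x|lborel. mixed_deriv {} u F x * (\<Prod>j\<in>u. p j (x $ j)) * (\<Prod>j\<in>UNIV - u. \<phi> (x $ j)))"
      unfolding trunc D_def by (intro tendsto_mult_left lim i2)
  qed
qed

section \<open>Walsh functions as products of square waves\<close>

definition square_wave :: "real \<Rightarrow> real" where
  "square_wave t = (if even \<lfloor>t\<rfloor> then 1 else -1)"

text \<open>The distance to the nearest even integer, an antiderivative of \<open>square_wave\<close>. Written with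
\<open>arccos\<close> it is visibly continuous and periodic with period 2.\<close>
definition triangle_wave :: "real \<Rightarrow> real" where
  "triangle_wave t = arccos (cos (pi * t)) / pi"

lemma square_wave_measurable [measurable]: "square_wave \<in> borel_measurable borel"
  unfolding square_wave_def[abs_def] by measurable

lemma abs_square_wave [simp]: "\<bar>square_wave t\<bar> = 1"
  by (simp add: square_wave_def)

lemma square_wave_digit: "(-1) ^ binary_digit x i = square_wave (2 ^ i * x)"
proof -
  have "even (nat (\<lfloor>2 ^ i * x\<rfloor> mod 2)) \<longleftrightarrow> even \<lfloor>2 ^ i * x\<rfloor>"
    by (simp add: even_nat_iff even_mod_2_iff)
  then show ?thesis unfolding binary_digit_def square_wave_def by (simp add: minus_one_power_iff)
qed

lemma wal_power: "wal (2 ^ a) x = square_wave (2 ^ Suc a * x)"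
proof -
  have "{i. bit ((2::nat) ^ a) i} = {a}" by (auto simp: bit_exp_iff)
  then show ?thesis by (simp add: wal_def square_wave_digit del: power_Suc)
qed

lemma wal_sum_powers:
  assumes "a2 < a1"
  shows "wal (2 ^ a1 + 2 ^ a2) x = square_wave (2 ^ Suc a1 * x) * square_wave (2 ^ Suc a2 * x)"
proof -
  have "(2::nat) ^ a1 + 2 ^ a2 = or (2 ^ a1) (2 ^ a2)"
  proof (rule disjunctive_add_eq_or)
    show "and ((2::nat) ^ a1) (2 ^ a2) = 0"
      by (rule bit_eqI) (use assms in \<open>auto simp: bit_and_iff bit_exp_iff\<close>)
  qed
  then have "{i. bit ((2::nat) ^ a1 + 2 ^ a2) i} = {a1, a2}"
    by (auto simp: bit_or_iff bit_exp_iff)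
  then show ?thesis using assms
    by (simp add: wal_def power_add square_wave_digit del: power_Suc)
qed

text \<open>The smaller exponent is determined by the exact power of 2 that divides the number.\<close>
lemma low_exp_eq:
  assumes "a2 < a1"
  shows "low_exp (2 ^ a1 + 2 ^ a2) = a2"
proof -
  have no: "\<not> (2::nat) ^ Suc b dvd 2 ^ a + 2 ^ b" if "b < a" for a b
  proof
    assume *: "(2::nat) ^ Suc b dvd 2 ^ a + 2 ^ b"
    have "(2::nat) ^ Suc b dvd 2 ^ a" using that by (intro le_imp_power_dvd) simp
    then have "(2::nat) ^ Suc b dvd 2 ^ b" using * dvd_add_right_iff by blast
    then show False by (simp add: nat_dvd_not_less)
  qed
  have le: "b2 \<le> c2" if "b2 < b1" "c2 < c1" "(2::nat) ^ b1 + 2 ^ b2 = 2 ^ c1 + 2 ^ c2" for b1 b2 c1 c2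
  proof (rule ccontr)
    assume "\<not> b2 \<le> c2"
    then have "(2::nat) ^ Suc c2 dvd 2 ^ b1 + 2 ^ b2"
      using that by (intro dvd_add le_imp_power_dvd) auto
    then show False using no[OF that(2)] that(3) by simp
  qed
  show ?thesis unfolding low_exp_def
  proof (rule the_equality)
    show "\<exists>b1>a2. (2::nat) ^ a1 + 2 ^ a2 = 2 ^ b1 + 2 ^ a2" using assms by blast
    show "b2 = a2" if "\<exists>b1>b2. (2::nat) ^ a1 + 2 ^ a2 = 2 ^ b1 + 2 ^ b2" for b2
      using that le assms by (metis le_antisym)
  qed
qed

lemma triangle_wave_bounds: "0 \<le> triangle_wave t" "triangle_wave t \<le> 1"
  unfolding triangle_wave_def using arccos_bounded[of "cos (pi * t)"] by (auto simp: divide_simps)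

lemma continuous_triangle_wave: "continuous_on UNIV triangle_wave"
  unfolding triangle_wave_def[abs_def] by (intro continuous_intros) auto

lemma triangle_wave_shift: "triangle_wave (t + 2 * of_int n) = triangle_wave t"
proof -
  have "cos (pi * t + (2 * pi) * of_int n) = cos (pi * t)"
    unfolding cos_add cos_int_2pin sin_int_2pin by simp
  then show ?thesis by (simp add: triangle_wave_def algebra_simps)
qed

lemma triangle_wave_le: "triangle_wave t \<le> \<bar>t\<bar>"
proof (cases "\<bar>t\<bar> \<le> 1")
  case True
  have "cos (pi * t) = cos (pi * \<bar>t\<bar>)" by (cases "0 \<le> t") auto
  then have "triangle_wave t = \<bar>t\<bar>" unfolding triangle_wave_def using True by (simp add: arccos_cos)
  then show ?thesis by simp
next
  case False
  then show ?thesis using triangle_wave_bounds(2)[of t] by linarith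
qed

lemma triangle_wave_0 [simp]: "triangle_wave 0 = 0" using triangle_wave_le[of 0] triangle_wave_bounds[of 0] by simp

lemma triangle_wave_even: "triangle_wave (2 * of_int n) = 0"
  using triangle_wave_shift[of 0 n] by simp

lemma triangle_wave_formula: "triangle_wave t = (if even \<lfloor>t\<rfloor> then t - of_int \<lfloor>t\<rfloor> else of_int \<lfloor>t\<rfloor> + 1 - t)"
proof (cases "even \<lfloor>t\<rfloor>")
  case True
  then obtain n where n: "\<lfloor>t\<rfloor> = 2 * n" by blast
  have "triangle_wave t = triangle_wave (t - of_int \<lfloor>t\<rfloor>)" using triangle_wave_shift[of "t - of_int \<lfloor>t\<rfloor>" n] by (simp add: n)
  also have "\<dots> = t - of_int \<lfloor>t\<rfloor>"
    unfolding triangle_wave_def using floor_correct[of t]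
    by (subst arccos_cos) (auto intro!: mult_left_le, linarith?)
  finally show ?thesis using True by simp
next
  case False
  then obtain n where n: "\<lfloor>t\<rfloor> = 2 * n + 1" using oddE by blast
  have "triangle_wave t = triangle_wave (t - (of_int \<lfloor>t\<rfloor> + 1))" using triangle_wave_shift[of "t - (of_int \<lfloor>t\<rfloor> + 1)" "n + 1"] by (simp add: n)
  also have "\<dots> = triangle_wave (of_int \<lfloor>t\<rfloor> + 1 - t)"
    unfolding triangle_wave_def by (metis cos_minus minus_diff_eq mult_minus_right)
  also have "\<dots> = of_int \<lfloor>t\<rfloor> + 1 - t"
    unfolding triangle_wave_def using floor_correct[of t]
    by (subst arccos_cos) (auto intro!: mult_left_le, linarith?)
  finally show ?thesis using False by simp
qed

lemma floor_locally_constant: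
  assumes "t \<notin> \<int>"
  shows "eventually (\<lambda>s. \<lfloor>s\<rfloor> = \<lfloor>t\<rfloor>) (nhds (t :: real))"
proof -
  have "of_int \<lfloor>t\<rfloor> \<noteq> t" using assms by (metis Ints_of_int)
  then have "of_int \<lfloor>t\<rfloor> < t" "t < of_int \<lfloor>t\<rfloor> + 1"
    using floor_correct[of t] by linarith+
  then have "eventually (\<lambda>s. s \<in> {of_int \<lfloor>t\<rfloor> <..< of_int \<lfloor>t\<rfloor> + 1}) (nhds t)"
    by (intro eventually_nhds_in_open) auto
  then show ?thesis by eventually_elim (auto simp: floor_eq_iff)
qed

lemma triangle_wave_DERIV:
  assumes "t \<notin> \<int>"
  shows "(triangle_wave has_real_derivative square_wave t) (at t)"
proof -
  have "((\<lambda>s. if even \<lfloor>t\<rfloor> then s - of_int \<lfloor>t\<rfloor> else of_int \<lfloor>t\<rfloor> + 1 - s) has_real_derivative square_wave t) (at t)"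
    by (cases "even \<lfloor>t\<rfloor>") (auto simp: square_wave_def intro!: derivative_eq_intros)
  moreover have "eventually (\<lambda>s. triangle_wave s = (if even \<lfloor>t\<rfloor> then s - of_int \<lfloor>t\<rfloor> else of_int \<lfloor>t\<rfloor> + 1 - s)) (nhds t)"
    using floor_locally_constant[OF assms] by eventually_elim (simp add: triangle_wave_formula)
  ultimately show ?thesis by (subst DERIV_cong_ev[OF refl _ refl])
qed

text \<open>Evaluates the integrals that define the cumulated Walsh functions: the candidates are continuous and
fail to be differentiable at finitely many dyadic points only.\<close>
lemma set_integral_FTC:
  fixes f f' :: "real \<Rightarrow> real"
  assumes x: "0 \<le> x" and X: "finite X" and f: "continuous_on {0..x} f"
    and d: "\<And>t. t \<in> {0<..<x} - X \<Longrightarrow> (f has_real_derivative f' t) (at t)"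
    and m: "f' \<in> borel_measurable borel" and B: "\<And>t. \<bar>f' t\<bar> \<le> B"
  shows "(LINT y:{0..x}|lborel. f' y) = f x - f 0"
proof -
  have "set_integrable lborel {0..x} f'"
    unfolding set_integrable_def real_scaleR_def
    by (rule integrable_mult_bounded[OF _ _ B]) (use m x in \<open>auto intro!: integrable_real_indicator\<close>)
  then have "(LINT y:{0..x}|lborel. f' y) = integral {0..x} f'"
    by (rule set_borel_integral_eq_integral)
  also have "\<dots> = f x - f 0"
    by (intro integral_unique fundamental_theorem_of_calculus_interior_strong[OF X x _ f])
      (use d in \<open>auto simp: has_real_derivative_iff_has_vector_derivative\<close>)
  finally show ?thesis .
qed

text \<open>Outside these points the Walsh functions with largest exponent \<open>a\<close> are locally constant.\<close>
definition wal_nodes :: "nat \<Rightarrow> real set" where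
  "wal_nodes a = {x \<in> {0..1}. 2 ^ Suc a * x \<in> \<int>}"

lemma finite_scaled_Ints:
  assumes "0 < (c::real)"
  shows "finite {x \<in> {0..b}. c * x \<in> \<int>}"
proof -
  have "{x \<in> {0..b}. c * x \<in> \<int>} \<subseteq> (\<lambda>n. of_int n / c) ` {0..\<lfloor>c * b\<rfloor>}"
  proof
    fix x assume "x \<in> {x \<in> {0..b}. c * x \<in> \<int>}"
    then obtain n where n: "c * x = of_int n" "0 \<le> x" "x \<le> b" by (auto elim: Ints_cases)
    have "of_int n \<le> c * b" "(0::real) \<le> of_int n"
      using n assms by (auto simp flip: n(1) intro: mult_left_mono)
    then have "n \<in> {0..\<lfloor>c * b\<rfloor>}" by (simp add: le_floor_iff)
    moreover have "x = of_int n / c" using n assms by (simp add: field_simps)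
    ultimately show "x \<in> (\<lambda>n. of_int n / c) ` {0..\<lfloor>c * b\<rfloor>}" by blast
  qed
  then show ?thesis by (rule finite_subset) simp
qed

lemma finite_wal_nodes: "finite (wal_nodes a)"
  unfolding wal_nodes_def by (rule finite_scaled_Ints) simp

lemma scaled_triangle_wave_DERIV:
  assumes "c * x \<notin> \<int>" "c \<noteq> 0"
  shows "((\<lambda>x. triangle_wave (c * x) / c) has_real_derivative square_wave (c * x)) (at x)"
proof -
  have "((\<lambda>x. triangle_wave (c * x)) has_real_derivative square_wave (c * x) * c) (at x)"
    by (rule DERIV_chain2[where f=triangle_wave and g="\<lambda>x. c * x", OF triangle_wave_DERIV[OF assms(1)]])
      (auto intro!: derivative_eq_intros)
  from DERIV_cdivide[OF this, of c] show ?thesis using assms(2) by simp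
qed

lemma continuous_scaled_triangle_wave: "continuous_on A (\<lambda>x. triangle_wave (c * x) / c)"
  unfolding divide_inverse
  by (intro continuous_on_mult continuous_on_compose2[OF continuous_triangle_wave] continuous_intros) auto

context
  fixes a :: nat
begin

lemma power_in_N1: "(2::nat) ^ a \<in> N1" by (simp add: N1_def)

lemma loc_wal_N1: "loc_wal (2 ^ a) m x = square_wave (2 ^ Suc a * x)"
  by (simp add: loc_wal_def power_in_N1 wal_power del: power_Suc)

lemma cum_wal_N1:
  assumes "0 \<le> x"
  shows "cum_wal (2 ^ a) m x = triangle_wave (2 ^ Suc a * x) / 2 ^ Suc a"
proof -
  have "(LINT y:{0..x}|lborel. square_wave (2 ^ Suc a * y)) = triangle_wave (2 ^ Suc a * x) / 2 ^ Suc a - triangle_wave (2 ^ Suc a * 0) / 2 ^ Suc a"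
  proof (rule set_integral_FTC[OF assms finite_scaled_Ints[of "2 ^ Suc a" x] continuous_scaled_triangle_wave])
    show "((\<lambda>x. triangle_wave (2 ^ Suc a * x) / 2 ^ Suc a) has_real_derivative square_wave (2 ^ Suc a * t)) (at t)"
      if "t \<in> {0<..<x} - {t \<in> {0..x}. 2 ^ Suc a * t \<in> \<int>}" for t
      using that by (intro scaled_triangle_wave_DERIV) auto
    show "\<bar>square_wave (2 ^ Suc a * t)\<bar> \<le> 1" for t by simp
  qed (simp, measurable)
  then show ?thesis unfolding cum_wal_def loc_wal_N1 by (simp del: power_Suc)
qed

end

abbreviation (input) wal_amp :: "nat \<Rightarrow> real" where
  "wal_amp a2 \<equiv> 2 powr (real a2 / 2)"

text \<open>As a function of \<open>n = \<lfloor>2 ^ Suc a2 * x\<rfloor>\<close> this is the product of the indicator of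
\<open>[m / 2 ^ a2, (m + 1) / 2 ^ a2)\<close> and the low frequency square wave: \<open>+1\<close> on the left half of that
interval and \<open>-1\<close> on the right half.\<close>
definition half_sign :: "nat \<Rightarrow> int \<Rightarrow> real" where
  "half_sign m n = (if n div 2 = int m then if even n then 1 else -1 else 0)"

lemma abs_half_sign: "\<bar>half_sign m n\<bar> \<le> 1" by (simp add: half_sign_def)

context
  fixes k a1 a2 m :: nat
  assumes k: "k \<in> N2 - N1" and ka: "k = 2 ^ a1 + 2 ^ a2" and lt: "a2 < a1"
begin

lemma low_exp_k: "low_exp k = a2"
  unfolding ka by (rule low_exp_eq[OF lt])

lemma L2_idx_k: "L2_idx k = {0..<2 ^ a2}"
  using k by (simp add: L2_idx_def low_exp_k)

lemma floor_half: "\<lfloor>2 ^ a2 * x\<rfloor> = \<lfloor>2 ^ Suc a2 * x\<rfloor> div 2" for x :: real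
proof -
  have "\<lfloor>2 ^ a2 * x\<rfloor> = \<lfloor>(2 ^ Suc a2 * x) / of_int 2\<rfloor>" by simp
  also have "\<dots> = \<lfloor>2 ^ Suc a2 * x\<rfloor> div 2" by (rule floor_divide_real_eq_div) simp
  finally show ?thesis .
qed

lemma loc_wal_N2: "loc_wal k m x = wal_amp a2 * half_sign m \<lfloor>2 ^ Suc a2 * x\<rfloor> * square_wave (2 ^ Suc a1 * x)"
proof -
  have "x \<in> {real m / 2 ^ a2 ..< (real m + 1) / 2 ^ a2} \<longleftrightarrow> \<lfloor>2 ^ a2 * x\<rfloor> = int m"
    by (auto simp: floor_eq_iff field_simps)
  then have "indicator {real m / 2 ^ a2 ..< (real m + 1) / 2 ^ a2} x * square_wave (2 ^ Suc a2 * x)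
      = half_sign m \<lfloor>2 ^ Suc a2 * x\<rfloor>"
    unfolding floor_half by (simp add: indicator_def half_sign_def square_wave_def)
  then show ?thesis using k
    by (simp add: loc_wal_def low_exp_k) (simp add: ka wal_sum_powers[OF lt] mult_ac)
qed

text \<open>The low frequency factor changes sign only at zeros of the triangle wave of higher frequency, so
multiplying by it keeps the triangle wave continuous.\<close>
definition cum_wave :: "real \<Rightarrow> real" where
  "cum_wave x = wal_amp a2 * half_sign m \<lfloor>2 ^ Suc a2 * x\<rfloor> * (triangle_wave (2 ^ Suc a1 * x) / 2 ^ Suc a1)"

lemma triangle_wave_at_coarse_node:
  assumes "2 ^ Suc a2 * x \<in> \<int>"
  shows "triangle_wave (2 ^ Suc a1 * x) = 0"
proof -
  obtain n where n: "2 ^ Suc a2 * x = of_int n" using assms by (auto elim: Ints_cases)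
  obtain d where d: "a1 = Suc (a2 + d)" using lt less_imp_Suc_add by blast
  have "2 ^ Suc a1 * x = 2 * of_int (2 ^ d * n)"
  proof -
    have "2 ^ Suc a1 * x = 2 * 2 ^ d * (2 ^ Suc a2 * x)" by (simp add: d power_add)
    also have "\<dots> = 2 * of_int (2 ^ d * n)" unfolding n by simp
    finally show ?thesis .
  qed
  then show ?thesis by (simp only: triangle_wave_even)
qed

lemma half_sign_locally_constant:
  assumes "2 ^ Suc a2 * x \<notin> \<int>"
  shows "eventually (\<lambda>y. half_sign m \<lfloor>2 ^ Suc a2 * y\<rfloor> = half_sign m \<lfloor>2 ^ Suc a2 * x\<rfloor>) (nhds (x :: real))"
proof -
  have "filterlim (\<lambda>y. 2 ^ Suc a2 * y) (nhds (2 ^ Suc a2 * x)) (nhds x)"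
    by (intro tendsto_intros filterlim_ident)
  from eventually_compose_filterlim[OF floor_locally_constant[OF assms] this]
  show ?thesis by eventually_elim simp
qed

lemma cum_wave_DERIV:
  assumes "2 ^ Suc a1 * x \<notin> \<int>"
  shows "(cum_wave has_real_derivative loc_wal k m x) (at x)"
proof -
  have c: "2 ^ Suc a2 * x \<notin> \<int>"
  proof
    assume "2 ^ Suc a2 * x \<in> \<int>"
    moreover obtain d where "a1 = a2 + d" using lt less_imp_add_positive by blast
    then have "2 ^ Suc a1 * x = of_int (2 ^ d) * (2 ^ Suc a2 * x)"
      by (simp add: power_add)
    ultimately show False using assms by (metis Ints_mult Ints_of_int)
  qed
  have "((\<lambda>y. wal_amp a2 * half_sign m \<lfloor>2 ^ Suc a2 * x\<rfloor> * (triangle_wave (2 ^ Suc a1 * y) / 2 ^ Suc a1)) has_real_derivative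
      wal_amp a2 * half_sign m \<lfloor>2 ^ Suc a2 * x\<rfloor> * square_wave (2 ^ Suc a1 * x)) (at x)"
    by (intro DERIV_cmult scaled_triangle_wave_DERIV assms) simp
  moreover have "eventually (\<lambda>y. cum_wave y = wal_amp a2 * half_sign m \<lfloor>2 ^ Suc a2 * x\<rfloor> * (triangle_wave (2 ^ Suc a1 * y) / 2 ^ Suc a1)) (nhds x)"
    using half_sign_locally_constant[OF c] by eventually_elim (simp add: cum_wave_def del: power_Suc)
  ultimately show ?thesis unfolding loc_wal_N2 by (subst DERIV_cong_ev[OF refl _ refl])
qed

lemma cum_wave_cont: "continuous_on B cum_wave"
proof (rule continuous_at_imp_continuous_on, rule ballI)
  fix x
  let ?T = "\<lambda>x. triangle_wave (2 ^ Suc a1 * x) / 2 ^ Suc a1"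
  have T: "isCont ?T x"
    using continuous_scaled_triangle_wave[of UNIV "2 ^ Suc a1"] by (simp add: continuous_on_eq_continuous_at del: power_Suc)
  show "isCont cum_wave x"
  proof (cases "2 ^ Suc a2 * x \<in> \<int>")
    case True
    have T0: "?T x = 0" using triangle_wave_at_coarse_node[OF True] by simp
    have "(cum_wave \<longlongrightarrow> 0) (at x)"
    proof (rule Lim_null_comparison)
      show "eventually (\<lambda>y. norm (cum_wave y) \<le> wal_amp a2 * ?T y) (at x)"
      proof (intro always_eventually allI)
        fix y
        have "\<bar>half_sign m \<lfloor>2 ^ Suc a2 * y\<rfloor>\<bar> * (wal_amp a2 * ?T y) \<le> 1 * (wal_amp a2 * ?T y)"
          using triangle_wave_bounds[of "2 ^ Suc a1 * y"] abs_half_sign by (intro mult_right_mono) auto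
        then show "norm (cum_wave y) \<le> wal_amp a2 * ?T y"
          using triangle_wave_bounds[of "2 ^ Suc a1 * y"] by (simp add: cum_wave_def abs_mult mult_ac del: power_Suc)
      qed
      show "((\<lambda>y. wal_amp a2 * ?T y) \<longlongrightarrow> 0) (at x)"
        using tendsto_mult_left[OF T[unfolded isCont_def T0], of "wal_amp a2"] by simp
    qed
    then show ?thesis using T0 by (simp add: isCont_def cum_wave_def)
  next
    case False
    have "isCont (\<lambda>y. wal_amp a2 * half_sign m \<lfloor>2 ^ Suc a2 * x\<rfloor> * ?T y) x"
      by (intro isCont_mult T continuous_const)
    moreover have "eventually (\<lambda>y. cum_wave y = wal_amp a2 * half_sign m \<lfloor>2 ^ Suc a2 * x\<rfloor> * ?T y) (nhds x)"
      using half_sign_locally_constant[OF False] by eventually_elim (simp add: cum_wave_def del: power_Suc)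
    ultimately show ?thesis by (subst isCont_cong)
  qed
qed

lemma loc_wal_N2_measurable: "(\<lambda>x. loc_wal k m x) \<in> borel_measurable borel"
  unfolding loc_wal_N2 half_sign_def by measurable

lemma abs_loc_wal_N2: "\<bar>loc_wal k m x\<bar> \<le> wal_amp a2"
  using abs_half_sign[of m "\<lfloor>2 ^ Suc a2 * x\<rfloor>"] unfolding loc_wal_N2 by (simp add: abs_mult del: power_Suc)

lemma cum_wal_N2:
  assumes "0 \<le> x"
  shows "cum_wal k m x = cum_wave x"
proof -
  have "(LINT y:{0..x}|lborel. loc_wal k m y) = cum_wave x - cum_wave 0"
  proof (rule set_integral_FTC[OF assms finite_scaled_Ints[of "2 ^ Suc a1" x] cum_wave_cont _ loc_wal_N2_measurable abs_loc_wal_N2])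
    show "(cum_wave has_real_derivative loc_wal k m t) (at t)" if "t \<in> {0<..<x} - {t \<in> {0..x}. 2 ^ Suc a1 * t \<in> \<int>}" for t
      using that by (intro cum_wave_DERIV) auto
  qed simp
  moreover have "cum_wave 0 = 0" by (simp add: cum_wave_def)
  ultimately show ?thesis by (simp add: cum_wal_def)
qed

lemma cum2_wal_N2:
  assumes "0 \<le> x"
  shows "cum2_wal k m x = integral {0..x} cum_wave"
proof -
  have "cum2_wal k m x = (LINT y:{0..x}|lborel. cum_wave y)"
    unfolding cum2_wal_def by (rule set_lebesgue_integral_cong) (auto simp: cum_wal_N2)
  also have "\<dots> = integral {0..x} cum_wave"
    by (rule set_borel_integral_eq_integral) (auto intro!: borel_integrable_atLeastAtMost' cum_wave_cont)
  finally show ?thesis .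
qed

lemma cum_wave_outside:
  assumes "\<lfloor>2 ^ a2 * x\<rfloor> \<noteq> int m"
  shows "cum_wave x = 0"
  using assms unfolding cum_wave_def floor_half half_sign_def by simp

text \<open>The twice cumulated function vanishes off its interval: the two halves of the interval carry the same
triangles with opposite signs. This makes the supports for different \<open>m\<close> disjoint.\<close>
lemma integral_cum_wave_zero:
  assumes "0 \<le> x" "\<lfloor>2 ^ a2 * x\<rfloor> \<noteq> int m"
  shows "integral {0..x} cum_wave = 0"
proof -
  define l d where "l = real m / 2 ^ a2" and "d = 1 / (2 ^ Suc a2 :: real)"
  have ld: "0 \<le> l" "0 < d" "2 ^ Suc a2 * l = 2 * of_nat m" "2 ^ Suc a2 * d = 1" "2 ^ a2 * l = of_nat m"
      "2 ^ a2 * (l + d + d) = of_nat m + 1"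
    by (auto simp: l_def d_def field_simps)
  have left: "cum_wave y = 0" if "y < l" for y
  proof (rule cum_wave_outside)
    have "2 ^ a2 * y < of_nat m" using that by (simp add: l_def field_simps)
    then have "\<lfloor>2 ^ a2 * y\<rfloor> < int m" by (simp add: floor_less_iff)
    then show "\<lfloor>2 ^ a2 * y\<rfloor> \<noteq> int m" by simp
  qed
  have right: "cum_wave y = 0" if "l + d + d \<le> y" for y
  proof (rule cum_wave_outside)
    have "2 ^ a2 * (l + d + d) \<le> 2 ^ a2 * y" using that by (intro mult_left_mono) auto
    then have "of_int (int m + 1) \<le> 2 ^ a2 * y" unfolding ld(6) by simp
    then have "int m + 1 \<le> \<lfloor>2 ^ a2 * y\<rfloor>" by (simp only: le_floor_iff)
    then show "\<lfloor>2 ^ a2 * y\<rfloor> \<noteq> int m" by simp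
  qed
  have Ul: "cum_wave l = 0"
  proof -
    have "2 ^ Suc a2 * l \<in> \<int>" unfolding ld(3) by simp
    from triangle_wave_at_coarse_node[OF this] show ?thesis by (simp add: cum_wave_def del: power_Suc)
  qed
  have int: "cum_wave integrable_on {p..q}" for p q
    by (rule integrable_continuous_real[OF cum_wave_cont])
  show ?thesis
  proof (cases "x \<le> l")
    case True
    then have "integral {0..x} cum_wave = integral {0..x} (\<lambda>_. 0)"
      using left Ul by (intro integral_cong) (metis atLeastAtMost_iff le_less_trans not_le order.order_iff_strict)
    then show ?thesis by simp
  next
    case False
    have x: "l + d + d \<le> x"
    proof (rule ccontr)
      assume "\<not> l + d + d \<le> x"
      then have "2 ^ a2 * x < 2 ^ a2 * (l + d + d)" by (intro mult_strict_left_mono) auto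
      then have "2 ^ a2 * x < real m + 1" unfolding ld(6) .
      moreover have "2 ^ a2 * l < 2 ^ a2 * x" using False by simp
      ultimately have "\<lfloor>2 ^ a2 * x\<rfloor> = int m" using ld(5) by (simp add: floor_eq_iff)
      then show False using assms by simp
    qed
    have second: "cum_wave (y + d) = - cum_wave y" if "y \<in> {l..<l + d}" for y
    proof -
      have "2 ^ Suc a2 * l \<le> 2 ^ Suc a2 * y" "2 ^ Suc a2 * y < 2 ^ Suc a2 * (l + d)"
        using that by (auto intro: mult_left_mono)
      then have f: "\<lfloor>2 ^ Suc a2 * y\<rfloor> = 2 * int m"
        using ld by (simp add: floor_eq_iff distrib_left del: power_Suc)
      have e: "2 ^ Suc a2 * (y + d) = 2 ^ Suc a2 * y + 1" using ld(4) by (simp only: distrib_left)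
      have f': "\<lfloor>2 ^ Suc a2 * (y + d)\<rfloor> = 2 * int m + 1"
        unfolding e using f by linarith
      obtain q where q: "a1 = Suc (a2 + q)" using lt less_imp_Suc_add by blast
      have "2 ^ Suc a1 * (y + d) = 2 ^ Suc a1 * y + 2 * of_int (2 ^ q)"
        by (simp add: q d_def power_add field_simps)
      then have "triangle_wave (2 ^ Suc a1 * (y + d)) = triangle_wave (2 ^ Suc a1 * y)" by (simp only: triangle_wave_shift)
      then show ?thesis unfolding cum_wave_def f f' by (simp add: half_sign_def)
    qed
    have "cum_wave (l + d) = 0"
    proof -
      have "2 ^ Suc a2 * (l + d) \<in> \<int>" unfolding distrib_left ld(3,4) by simp
      from triangle_wave_at_coarse_node[OF this] show ?thesis by (simp add: cum_wave_def del: power_Suc)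
    qed
    have second': "cum_wave (y + d) = - cum_wave y" if "y \<in> {l..l + d}" for y
    proof (cases "y = l + d")
      case True
      then show ?thesis using right[of "l + d + d"] \<open>cum_wave (l + d) = 0\<close> by simp
    next
      case False
      then show ?thesis using that second by simp
    qed
    have "integral {l + d..l + d + d} cum_wave = integral {l..l + d} (cum_wave \<circ> (\<lambda>y. y + d))"
      by (rule integral_shift[symmetric]) (rule cum_wave_cont)
    also have "\<dots> = integral {l..l + d} (\<lambda>y. - cum_wave y)"
      by (rule integral_cong) (simp add: second')
    finally have "integral {l..l + d} cum_wave + integral {l + d..l + d + d} cum_wave = 0" by simp
    then have mid: "integral {l..l + d + d} cum_wave = 0"
      using Henstock_Kurzweil_Integration.integral_combine[of l "l + d" "l + d + d" cum_wave] ld int by simp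
    have "integral {0..l} cum_wave = integral {0..l} (\<lambda>_. 0)"
      using left Ul by (intro integral_cong) (metis atLeastAtMost_iff order.order_iff_strict)
    moreover have "integral {l + d + d..x} cum_wave = integral {l + d + d..x} (\<lambda>_. 0)"
      using right by (intro integral_cong) simp
    moreover have "integral {0..x} cum_wave = integral {0..l} cum_wave + (integral {l..l + d + d} cum_wave + integral {l + d + d..x} cum_wave)"
      using Henstock_Kurzweil_Integration.integral_combine[of 0 l x cum_wave]
        Henstock_Kurzweil_Integration.integral_combine[of l "l + d + d" x cum_wave] ld x int by simp
    ultimately show ?thesis using mid by simp
  qed
qed

end

section \<open>Cutoffs near the end points of the unit interval\<close>

lemma max_power_DERIV:
  "((\<lambda>t::real. (max 0 t) ^ Suc (Suc k)) has_real_derivative real (Suc (Suc k)) * (max 0 t) ^ Suc k) (at t)"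
proof -
  consider "t < 0" | "t = 0" | "t > 0" by linarith
  then show ?thesis
  proof cases
    case 1
    have "eventually (\<lambda>s. s < 0) (nhds t)" using eventually_nhds_in_open[of "{..<0}" t] 1 by simp
    then have "eventually (\<lambda>s. (max 0 s) ^ Suc (Suc k) = 0) (nhds t)" by eventually_elim simp
    then have "((\<lambda>t. (max 0 t) ^ Suc (Suc k)) has_real_derivative 0) (at t) \<longleftrightarrow> ((\<lambda>t. 0) has_real_derivative 0) (at t)"
      by (intro DERIV_cong_ev) auto
    then show ?thesis using 1 by simp
  next
    case 3
    have "eventually (\<lambda>s. s > 0) (nhds t)" using eventually_nhds_in_open[of "{0<..}" t] 3 by simp
    then have "eventually (\<lambda>s. (max 0 s) ^ Suc (Suc k) = s ^ Suc (Suc k)) (nhds t)" by eventually_elim simp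
    then have "((\<lambda>t. (max 0 t) ^ Suc (Suc k)) has_real_derivative real (Suc (Suc k)) * t ^ Suc k) (at t) \<longleftrightarrow>
        ((\<lambda>t. t ^ Suc (Suc k)) has_real_derivative real (Suc (Suc k)) * t ^ Suc k) (at t)"
      by (intro DERIV_cong_ev) auto
    moreover have "((\<lambda>t. t ^ Suc (Suc k)) has_real_derivative real (Suc (Suc k)) * t ^ Suc k) (at t)"
      using DERIV_pow[of "Suc (Suc k)" t UNIV] by simp
    ultimately show ?thesis using 3 by simp
  next
    case 2
    have "((\<lambda>h. ((max 0 h) ^ Suc (Suc k) - 0) / h) \<longlongrightarrow> 0) (at (0::real))"
    proof (rule Lim_null_comparison)
      show "eventually (\<lambda>h. norm (((max 0 h) ^ Suc (Suc k) - 0) / h) \<le> \<bar>h\<bar> ^ Suc k) (at (0::real))"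
        by (intro always_eventually allI) (auto simp: max_def abs_mult mult_nonpos_nonneg)
      show "((\<lambda>h. \<bar>h\<bar> ^ Suc k) \<longlongrightarrow> 0) (at (0::real))"
        by (auto intro!: tendsto_eq_intros)
    qed
    then show ?thesis using 2 by (simp add: DERIV_def)
  qed
qed

lemma max_cube_DERIV: "((\<lambda>t::real. (max 0 t) ^ 3) has_real_derivative 3 * (max 0 t)\<^sup>2) (at t)"
  using max_power_DERIV[of 1 t] by (simp add: eval_nat_numeral del: power_Suc)

lemma max_square_DERIV: "((\<lambda>t::real. (max 0 t)\<^sup>2) has_real_derivative 2 * max 0 t) (at t)"
  using max_power_DERIV[of 0 t] by (simp add: eval_nat_numeral)

text \<open>The cutoff is \<open>chi n y = (max 0 (1 - 1 / (N d)))\<^sup>3\<close> with \<open>N = n + 1\<close> and \<open>d = y (1 - y)\<close>. It is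
twice continuously differentiable on \<open>(0,1)\<close>, vanishes where \<open>N d \<le> 1\<close>, tends to 1, and its
derivatives of order one and two are \<open>O(1 / d)\<close> and \<open>O(1 / d\<^sup>2)\<close>, uniformly in \<open>n\<close>. The primed
names are its derivatives.\<close>
definition chi_arg :: "nat \<Rightarrow> real \<Rightarrow> real" where
  "chi_arg n y = 1 - 1 / (real (Suc n) * (y * (1 - y)))"

definition chi_arg' :: "nat \<Rightarrow> real \<Rightarrow> real" where
  "chi_arg' n y = (1 - 2 * y) / (real (Suc n) * (y * (1 - y))\<^sup>2)"

definition chi_arg'' :: "nat \<Rightarrow> real \<Rightarrow> real" where
  "chi_arg'' n y = - 2 / (real (Suc n) * (y * (1 - y))\<^sup>2) - 2 * (1 - 2 * y)\<^sup>2 / (real (Suc n) * (y * (1 - y)) ^ 3)"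

definition chi :: "nat \<Rightarrow> real \<Rightarrow> real" where
  "chi n y = (max 0 (chi_arg n y)) ^ 3"

definition chi' :: "nat \<Rightarrow> real \<Rightarrow> real" where
  "chi' n y = 3 * (max 0 (chi_arg n y))\<^sup>2 * chi_arg' n y"

definition chi'' :: "nat \<Rightarrow> real \<Rightarrow> real" where
  "chi'' n y = 6 * max 0 (chi_arg n y) * (chi_arg' n y)\<^sup>2 + 3 * (max 0 (chi_arg n y))\<^sup>2 * chi_arg'' n y"

context
  fixes y :: real
  assumes y: "y \<in> {0<..<1}"
begin

lemma d_pos: "0 < y * (1 - y)" using y by simp

lemma d_le: "y * (1 - y) \<le> 1" using y mult_mono[of y 1 "1 - y" 1] by simp

lemma chi_arg_DERIV: "(chi_arg n has_real_derivative chi_arg' n y) (at y)"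
proof -
  have nz: "y \<noteq> 0" "1 - y \<noteq> 0" using y by auto
  let ?N = "real (Suc n)" and ?d = "y * (1 - y)"
  have d: "((\<lambda>y. ?N * (y * (1 - y))) has_real_derivative ?N * (1 - 2 * y)) (at y)"
    by (auto intro!: derivative_eq_intros simp: algebra_simps simp del: of_nat_Suc)
  have "(chi_arg n has_real_derivative 0 - (0 * (?N * ?d) - 1 * (?N * (1 - 2 * y))) / ((?N * ?d) * (?N * ?d))) (at y)"
    unfolding chi_arg_def[abs_def]
    by (intro DERIV_diff DERIV_divide DERIV_const d) (use nz in auto)
  also have "0 - (0 * (?N * ?d) - 1 * (?N * (1 - 2 * y))) / ((?N * ?d) * (?N * ?d)) = chi_arg' n y"
  proof -
    have *: "0 - (0 * (N * d) - 1 * (N * e)) / ((N * d) * (N * d)) = e / (N * d\<^sup>2)"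
      if "N \<noteq> 0" "d \<noteq> 0" for N d e :: real
      using that by (simp add: divide_simps power2_eq_square)
    show ?thesis unfolding chi_arg'_def by (rule *) (use nz in auto)
  qed
  finally show ?thesis .
qed

lemma chi_arg'_DERIV: "(chi_arg' n has_real_derivative chi_arg'' n y) (at y)"
proof -
  have nz: "y \<noteq> 0" "1 - y \<noteq> 0" using y by auto
  let ?N = "real (Suc n)" and ?d = "y * (1 - y)"
  have "(chi_arg' n has_real_derivative
      ((-2) * (?N * ?d\<^sup>2) - (1 - 2 * y) * (?N * (2 * ?d * (1 - 2 * y)))) / ((?N * ?d\<^sup>2) * (?N * ?d\<^sup>2))) (at y)"
    unfolding chi_arg'_def[abs_def]
    by (rule DERIV_divide) (use nz in \<open>auto intro!: derivative_eq_intros simp: algebra_simps simp del: of_nat_Suc\<close>)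
  also have "((-2) * (?N * ?d\<^sup>2) - (1 - 2 * y) * (?N * (2 * ?d * (1 - 2 * y)))) / ((?N * ?d\<^sup>2) * (?N * ?d\<^sup>2)) = chi_arg'' n y"
  proof -
    have *: "((-2) * (N * d\<^sup>2) - e * (N * (2 * d * e))) / ((N * d\<^sup>2) * (N * d\<^sup>2)) = - 2 / (N * d\<^sup>2) - 2 * e\<^sup>2 / (N * d ^ 3)"
      if "N \<noteq> 0" "d \<noteq> 0" for N d e :: real
      using that by (simp add: divide_simps power2_eq_square power3_eq_cube) (simp add: algebra_simps)
    show ?thesis unfolding chi_arg''_def by (rule *) (use nz in auto)
  qed
  finally show ?thesis .
qed

lemma chi_DERIV: "(chi n has_real_derivative chi' n y) (at y)"
  using DERIV_chain2[where f="\<lambda>t. (max 0 t) ^ 3" and g="chi_arg n", OF max_cube_DERIV chi_arg_DERIV]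
  by (simp add: chi_def[abs_def] chi'_def)

lemma chi'_DERIV: "(chi' n has_real_derivative chi'' n y) (at y)"
proof -
  have "((\<lambda>y. (max 0 (chi_arg n y))\<^sup>2) has_real_derivative 2 * max 0 (chi_arg n y) * chi_arg' n y) (at y)"
    using DERIV_chain2[where f="\<lambda>t. (max 0 t)\<^sup>2" and g="chi_arg n", OF max_square_DERIV chi_arg_DERIV] by simp
  from DERIV_mult[OF DERIV_cmult[OF this, of 3] chi_arg'_DERIV[of n]]
  show ?thesis unfolding chi'_def[abs_def] chi''_def
    by (rule back_subst[where P="\<lambda>D. (_ has_real_derivative D) (at y)"]) (simp add: power2_eq_square algebra_simps)
qed

lemma chi_zero:
  assumes "y * (1 - y) \<le> 1 / real (Suc n)"
  shows "chi n y = 0" "chi' n y = 0" "chi'' n y = 0"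
proof -
  have "real (Suc n) * (y * (1 - y)) \<le> 1" using assms by (simp add: field_simps del: of_nat_Suc)
  moreover have "0 < real (Suc n) * (y * (1 - y))" using d_pos by simp
  ultimately have "max 0 (chi_arg n y) = 0" by (simp add: chi_arg_def del: of_nat_Suc)
  then show "chi n y = 0" "chi' n y = 0" "chi'' n y = 0" by (auto simp: chi_def chi'_def chi''_def)
qed

text \<open>Where the cutoff does not vanish, \<open>1 / N \<le> d\<close>, which absorbs one power of \<open>d\<close> in the
denominators.\<close>
lemma chi_bounds: "0 \<le> chi n y" "chi n y \<le> 1" "\<bar>chi' n y\<bar> \<le> 3 / (y * (1 - y))" "\<bar>chi'' n y\<bar> \<le> 18 / (y * (1 - y))\<^sup>2"
proof -
  let ?N = "real (Suc n)" and ?d = "y * (1 - y)"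
  define r where "r = max 0 (chi_arg n y)"
  have r: "0 \<le> r" "r \<le> 1" using d_pos by (auto simp: r_def chi_arg_def)
  show "0 \<le> chi n y" "chi n y \<le> 1" using r by (auto simp: chi_def r_def[symmetric] intro: power_le_one)
  have "\<bar>chi' n y\<bar> \<le> 3 / ?d \<and> \<bar>chi'' n y\<bar> \<le> 18 / ?d\<^sup>2"
  proof (cases "?d \<le> 1 / ?N")
    case True
    then show ?thesis using chi_zero[OF True] d_pos by (simp add: less_imp_le)
  next
    case False
    then have N: "1 / ?N \<le> ?d" by simp
    have e: "\<bar>1 - 2 * y\<bar> \<le> 1" using y by auto
    have e2: "(1 - 2 * y)\<^sup>2 \<le> 1" using e by (metis abs_square_le_1)
    have r1: "\<bar>chi_arg' n y\<bar> \<le> 1 / ?d"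
    proof -
      have "\<bar>chi_arg' n y\<bar> = \<bar>1 - 2 * y\<bar> * ((1 / ?N) * (1 / ?d\<^sup>2))"
        by (simp add: chi_arg'_def abs_mult)
      also have "\<dots> \<le> 1 * (?d * (1 / ?d\<^sup>2))"
        using e N d_pos by (intro mult_mono) auto
      also have "\<dots> = 1 / ?d" using d_pos by (simp add: power2_eq_square)
      finally show ?thesis .
    qed
    have r2: "\<bar>chi_arg'' n y\<bar> \<le> 4 / ?d\<^sup>2"
    proof -
      have "\<bar>chi_arg'' n y\<bar> \<le> 2 * ((1 / ?N) * (1 / ?d\<^sup>2)) + 2 * ((1 - 2 * y)\<^sup>2 * ((1 / ?N) * (1 / ?d ^ 3)))"
      proof -
        have *: "\<bar>- p - q\<bar> \<le> p + q" if "0 \<le> p" "0 \<le> q" for p q :: real using that by linarith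
        have "\<bar>- (2 / (?N * ?d\<^sup>2)) - 2 * (1 - 2 * y)\<^sup>2 / (?N * ?d ^ 3)\<bar> \<le> 2 / (?N * ?d\<^sup>2) + 2 * (1 - 2 * y)\<^sup>2 / (?N * ?d ^ 3)"
          by (rule *) (use d_pos in \<open>auto intro!: divide_nonneg_nonneg mult_nonneg_nonneg zero_le_power less_imp_le\<close>)
        then show ?thesis by (simp add: chi_arg''_def)
      qed
      also have "\<dots> \<le> 2 * (?d * (1 / ?d\<^sup>2)) + 2 * (1 * (?d * (1 / ?d ^ 3)))"
        using e2 N d_pos by (intro add_mono mult_left_mono mult_mono) auto
      also have "\<dots> = 2 / ?d + 2 / ?d\<^sup>2"
        using d_pos by (simp add: power2_eq_square power3_eq_cube)
      also have "2 / ?d \<le> 2 / ?d\<^sup>2"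
        using d_pos d_le by (intro divide_left_mono) (auto simp: power2_eq_square mult_left_le)
      finally show ?thesis by simp
    qed
    have rr: "r\<^sup>2 \<le> 1" using r by (simp add: power_le_one)
    have "\<bar>chi' n y\<bar> = 3 * (r\<^sup>2 * \<bar>chi_arg' n y\<bar>)"
      by (simp add: chi'_def r_def[symmetric] abs_mult)
    also have "\<dots> \<le> 3 * (1 * (1 / ?d))"
      using rr r1 by (intro mult_left_mono mult_mono) auto
    finally have 1: "\<bar>chi' n y\<bar> \<le> 3 / ?d" by simp
    have "\<bar>chi'' n y\<bar> \<le> 6 * (r * (chi_arg' n y)\<^sup>2) + 3 * (r\<^sup>2 * \<bar>chi_arg'' n y\<bar>)"
      unfolding chi''_def r_def[symmetric] using r
      by (intro order_trans[OF abs_triangle_ineq]) (simp add: abs_mult)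
    also have "\<dots> \<le> 6 * (1 * (1 / ?d)\<^sup>2) + 3 * (1 * (4 / ?d\<^sup>2))"
      using r rr r2 power_mono[OF r1, of 2] by (intro add_mono mult_left_mono mult_mono) auto
    also have "\<dots> = 18 / ?d\<^sup>2" by (simp add: power_divide)
    finally show ?thesis using 1 by simp
  qed
  then show "\<bar>chi' n y\<bar> \<le> 3 / ?d" "\<bar>chi'' n y\<bar> \<le> 18 / ?d\<^sup>2" by auto
qed

lemma chi_lim: "(\<lambda>n. chi n y) \<longlonglongrightarrow> 1" "(\<lambda>n. chi' n y) \<longlonglongrightarrow> 0" "(\<lambda>n. chi'' n y) \<longlonglongrightarrow> 0"
proof -
  have N: "(\<lambda>n. c / (real (Suc n) * e)) \<longlonglongrightarrow> 0" for c e :: real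
  proof -
    have "(\<lambda>n. (c / e) * (1 / real (Suc n))) \<longlonglongrightarrow> (c / e) * 0"
      by (intro tendsto_intros LIMSEQ_Suc[OF lim_1_over_n])
    then show ?thesis by (simp add: mult.commute)
  qed
  have a: "(\<lambda>n. max 0 (chi_arg n y)) \<longlonglongrightarrow> 1"
  proof -
    have "(\<lambda>n. max 0 (chi_arg n y)) \<longlonglongrightarrow> max 0 (1 - 0)"
      unfolding chi_arg_def by (intro tendsto_max tendsto_diff tendsto_const N)
    then show ?thesis by simp
  qed
  have b: "(\<lambda>n. chi_arg' n y) \<longlonglongrightarrow> 0" unfolding chi_arg'_def by (rule N)
  have c: "(\<lambda>n. chi_arg'' n y) \<longlonglongrightarrow> 0"
  proof -
    have "(\<lambda>n. chi_arg'' n y) \<longlonglongrightarrow> 0 - 0" unfolding chi_arg''_def by (intro tendsto_diff N)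
    then show ?thesis by simp
  qed
  show "(\<lambda>n. chi n y) \<longlonglongrightarrow> 1" unfolding chi_def using tendsto_power[OF a, of 3] by simp
  show "(\<lambda>n. chi' n y) \<longlonglongrightarrow> 0"
    unfolding chi'_def using tendsto_mult[OF tendsto_mult[OF tendsto_const[of 3] tendsto_power[OF a, of 2]] b] by simp
  show "(\<lambda>n. chi'' n y) \<longlonglongrightarrow> 0"
    unfolding chi''_def
    using tendsto_add[OF tendsto_mult[OF tendsto_mult[OF tendsto_const[of 6] a] tendsto_power[OF b, of 2]]
        tendsto_mult[OF tendsto_mult[OF tendsto_const[of 3] tendsto_power[OF a, of 2]] c]] by simp
qed

end

lemma chi_measurable: "chi n \<in> borel_measurable borel" "chi' n \<in> borel_measurable borel" "chi'' n \<in> borel_measurable borel"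
  unfolding chi_def[abs_def] chi'_def[abs_def] chi''_def[abs_def] chi_arg_def chi_arg'_def chi_arg''_def by measurable

section \<open>The distribution function\<close>

locale positive_density =
  fixes \<phi> :: "real \<Rightarrow> real"
  assumes dens: "diff_density \<phi>"
begin

abbreviation "\<Phi> \<equiv> CDF \<phi>"

lemma \<phi>_pos: "0 < \<phi> x" and \<phi>_int: "integrable lborel \<phi>" and \<phi>_one: "(LINT x|lborel. \<phi> x) = 1"
  using dens by (auto simp: diff_density_def)

lemma \<phi>_DERIV: "(\<phi> has_real_derivative deriv \<phi> x) (at x)"
  using dens by (simp add: diff_density_def DERIV_deriv_iff_real_differentiable)

lemma \<phi>_cont: "continuous_on A \<phi>"
  by (intro continuous_at_imp_continuous_on ballI DERIV_isCont[OF \<phi>_DERIV])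

lemma \<phi>_meas: "\<phi> \<in> borel_measurable borel"
  using \<phi>_cont by (rule borel_measurable_continuous_onI)

lemma set_int: "set_integrable lborel B \<phi>" if "B \<in> sets borel"
  using integrable_mult_indicator[OF _ \<phi>_int, of B] that by (simp add: set_integrable_def)

lemma CDF_split: "a \<le> x \<Longrightarrow> \<Phi> x = \<Phi> a + integral {a..x} \<phi>"
proof -
  assume "a \<le> x"
  then have "{..x} = {..a} \<union> {a<..x}" by auto
  then have "\<Phi> x = \<Phi> a + (LINT t:{a<..x}|lborel. \<phi> t)"
    unfolding CDF_def by (simp only:) (rule set_integral_Un, auto intro: set_int)
  also have "(LINT t:{a<..x}|lborel. \<phi> t) = integral {a<..x} \<phi>"
    by (intro set_borel_integral_eq_integral set_int) simp
  also have "\<dots> = integral {a..x} \<phi>"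
    by (rule integral_spike_set; rule negligible_subset[of "{a}"]) auto
  finally show ?thesis .
qed

lemma CDF_DERIV: "(\<Phi> has_real_derivative \<phi> x) (at x)"
proof -
  have "((\<lambda>u. integral {x - 1..u} \<phi>) has_real_derivative \<phi> x) (at x within {x - 1..x + 1})"
    by (rule integral_has_real_derivative) (auto intro: \<phi>_cont)
  then have "((\<lambda>u. integral {x - 1..u} \<phi>) has_real_derivative \<phi> x) (at x)"
    by (simp add: at_within_Icc_at)
  then have "((\<lambda>u. \<Phi> (x - 1) + integral {x - 1..u} \<phi>) has_real_derivative \<phi> x) (at x)"
    by (auto intro!: derivative_eq_intros)
  moreover have "eventually (\<lambda>u. \<Phi> u = \<Phi> (x - 1) + integral {x - 1..u} \<phi>) (nhds x)"
    using eventually_nhds_in_open[of "{x - 1<..}" x] by (auto elim!: eventually_mono intro!: CDF_split)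
  ultimately show ?thesis by (subst DERIV_cong_ev[OF refl _ refl])
qed

lemma CDF_strict_mono: "x < y \<Longrightarrow> \<Phi> x < \<Phi> y"
  by (rule DERIV_pos_imp_increasing) (use CDF_DERIV \<phi>_pos in blast)+

lemma CDF_mono: "x \<le> y \<Longrightarrow> \<Phi> x \<le> \<Phi> y"
  using CDF_strict_mono[of x y] by (cases "x = y") auto

lemma CDF_nonneg: "0 \<le> \<Phi> x"
  unfolding CDF_def set_lebesgue_integral_def
  by (rule integral_nonneg_AE) (use \<phi>_pos in \<open>auto simp: less_imp_le\<close>)

lemma CDF_le_1: "\<Phi> x \<le> 1"
proof -
  have "\<Phi> x \<le> (LINT t|lborel. \<phi> t)"
    unfolding CDF_def set_lebesgue_integral_def
    by (rule integral_mono) (use set_int[of "{..x}"] \<phi>_int \<phi>_pos in \<open>auto simp: set_integrable_def indicator_def less_imp_le\<close>)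
  then show ?thesis by (simp add: \<phi>_one)
qed

lemma CDF_range: "\<Phi> x \<in> {0<..<1}"
  using CDF_strict_mono[of "x - 1" x] CDF_strict_mono[of x "x + 1"] CDF_nonneg[of "x - 1"] CDF_le_1[of "x + 1"] by simp

lemma CDF_inj: "inj \<Phi>"
  by (rule injI) (metis CDF_strict_mono less_irrefl linorder_neqE)

lemma CDF_isCont: "isCont \<Phi> x" by (rule DERIV_isCont[OF CDF_DERIV])

lemma CDF_meas: "\<Phi> \<in> borel_measurable borel"
  by (intro borel_measurable_continuous_onI continuous_at_imp_continuous_on ballI CDF_isCont)

lemma CDF_lim_n: "(\<lambda>n. \<Phi> (real n)) \<longlonglongrightarrow> 1" "(\<lambda>n. \<Phi> (- real n)) \<longlonglongrightarrow> 0"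
proof -
  have "(\<lambda>n. LINT t|lborel. indicator {..real n} t *\<^sub>R \<phi> t) \<longlonglongrightarrow> (LINT t|lborel. \<phi> t)"
  proof (rule integral_dominated_convergence[where w=\<phi>])
    show "AE t in lborel. (\<lambda>n. indicator {..real n} t *\<^sub>R \<phi> t) \<longlonglongrightarrow> \<phi> t"
    proof (intro AE_I2 tendsto_eventually)
      fix t :: real
      obtain m :: nat where "t \<le> real m" using real_arch_simple by blast
      then show "eventually (\<lambda>n. indicator {..real n} t *\<^sub>R \<phi> t = \<phi> t) sequentially"
        by (intro eventually_sequentiallyI[of m]) (auto simp: indicator_def)
    qed
  qed (use \<phi>_int \<phi>_pos \<phi>_meas in \<open>auto simp: indicator_def less_imp_le\<close>)
  then show "(\<lambda>n. \<Phi> (real n)) \<longlonglongrightarrow> 1" by (simp add: \<phi>_one CDF_def set_lebesgue_integral_def)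
  have "(\<lambda>n. LINT t|lborel. indicator {..- real n} t *\<^sub>R \<phi> t) \<longlonglongrightarrow> (LINT t|(lborel :: real measure). (0::real))"
  proof (rule integral_dominated_convergence[where w=\<phi>])
    show "AE t in lborel. (\<lambda>n. indicator {..- real n} t *\<^sub>R \<phi> t) \<longlonglongrightarrow> 0"
    proof (intro AE_I2 tendsto_eventually)
      fix t :: real
      obtain m :: nat where "- t < real m" using reals_Archimedean2 by blast
      then show "eventually (\<lambda>n. indicator {..- real n} t *\<^sub>R \<phi> t = 0) sequentially"
        by (intro eventually_sequentiallyI[of m]) (auto simp: indicator_def)
    qed
  qed (use \<phi>_int \<phi>_pos \<phi>_meas in \<open>auto simp: indicator_def less_imp_le\<close>)
  then show "(\<lambda>n. \<Phi> (- real n)) \<longlonglongrightarrow> 0" by (simp add: CDF_def set_lebesgue_integral_def)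
qed

text \<open>Turns a cutoff near 0 and 1 into a compact support on the real line.\<close>
lemma CDF_tails:
  assumes "0 < e"
  shows "\<exists>R>0. \<forall>x. R \<le> \<bar>x\<bar> \<longrightarrow> \<Phi> x * (1 - \<Phi> x) \<le> e"
proof -
  have "eventually (\<lambda>n. 1 - e < \<Phi> (real n)) sequentially"
    using order_tendstoD(1)[OF CDF_lim_n(1), of "1 - e"] assms by simp
  moreover have "eventually (\<lambda>n. \<Phi> (- real n) < e) sequentially"
    using order_tendstoD(2)[OF CDF_lim_n(2), of e] assms by simp
  ultimately have "eventually (\<lambda>n. 1 - e < \<Phi> (real n) \<and> \<Phi> (- real n) < e \<and> 0 < n) sequentially"
    using eventually_gt_at_top[of 0] by eventually_elim auto
  then obtain n where n: "1 - e < \<Phi> (real n)" "\<Phi> (- real n) < e" "0 < n"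
    using eventually_happens'[OF sequentially_bot] by blast
  have "\<Phi> x * (1 - \<Phi> x) \<le> e" if xn: "real n \<le> \<bar>x\<bar>" for x
  proof -
    have r: "0 < \<Phi> x" "\<Phi> x < 1" using CDF_range[of x] by auto
    consider "real n \<le> x" | "x \<le> - real n" using xn by linarith
    then show ?thesis
    proof cases
      case 1
      then have "1 - \<Phi> x \<le> e" using CDF_mono[OF 1] n by linarith
      moreover have "\<Phi> x * (1 - \<Phi> x) \<le> 1 * (1 - \<Phi> x)" using r by (intro mult_right_mono) auto
      ultimately show ?thesis by simp
    next
      case 2
      then have "\<Phi> x \<le> e" using CDF_mono[OF 2] n by linarith
      moreover have "\<Phi> x * (1 - \<Phi> x) \<le> \<Phi> x * 1" using r by (intro mult_left_mono) auto
      ultimately show ?thesis by simp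
    qed
  qed
  then show ?thesis using n(3) by (intro exI[of _ "real n"]) auto
qed

end

section \<open>Truncated kernels on the real line\<close>

context positive_density begin

text \<open>\<open>w\<close>, \<open>W\<close>, \<open>W2\<close> stand for a function on \<open>(0,1)\<close> and its two successive antiderivatives.
The truncation of \<open>W2\<close> is pulled back to the line as \<open>cutV\<close>; its derivative is \<open>cutP * \<phi>\<close>, and,
up to finitely many points, \<open>cutB\<close> is the derivative of \<open>cutP\<close>. In the same way \<open>cutQ\<close>
truncates \<open>W\<close>, with derivative \<open>cutB1\<close>.\<close>
definition cutV where "cutV W2 n x = W2 (\<Phi> x) * chi n (\<Phi> x)"
definition cutP where "cutP W W2 n x = W (\<Phi> x) * chi n (\<Phi> x) + W2 (\<Phi> x) * chi' n (\<Phi> x)"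
definition cutB where "cutB w W W2 n x =
  (w (\<Phi> x) * chi n (\<Phi> x) + 2 * (W (\<Phi> x) * chi' n (\<Phi> x)) + W2 (\<Phi> x) * chi'' n (\<Phi> x)) * \<phi> x"
definition cutQ where "cutQ W n x = W (\<Phi> x) * chi n (\<Phi> x)"
definition cutB1 where "cutB1 w W n x = (w (\<Phi> x) * chi n (\<Phi> x) + W (\<Phi> x) * chi' n (\<Phi> x)) * \<phi> x"

lemma cut_zero:
  assumes "\<Phi> x * (1 - \<Phi> x) \<le> 1 / real (Suc n)"
  shows "cutV W2 n x = 0" "cutP W W2 n x = 0" "cutB w W W2 n x = 0" "cutQ W n x = 0" "cutB1 w W n x = 0"
  using chi_zero[OF CDF_range assms]
  by (simp_all add: cutV_def cutP_def cutB_def cutQ_def cutB1_def)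

lemma comp_meas:
  assumes "\<And>y. y \<in> {0<..<1} \<Longrightarrow> isCont W y"
  shows "(\<lambda>x. W (\<Phi> x)) \<in> borel_measurable borel"
  by (intro borel_measurable_continuous_onI continuous_at_imp_continuous_on ballI
      isCont_o2[OF CDF_isCont] assms CDF_range)

lemma chi_comp_DERIV: "((\<lambda>x. chi n (\<Phi> x)) has_real_derivative chi' n (\<Phi> x) * \<phi> x) (at x)"
  "((\<lambda>x. chi' n (\<Phi> x)) has_real_derivative chi'' n (\<Phi> x) * \<phi> x) (at x)"
  by (rule DERIV_chain2[OF chi_DERIV[OF CDF_range] CDF_DERIV] DERIV_chain2[OF chi'_DERIV[OF CDF_range] CDF_DERIV])+

lemma finite_preimage: "finite X \<Longrightarrow> finite {x. \<Phi> x \<in> X}"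
  using finite_vimageI[OF _ CDF_inj, of X] by (simp add: vimage_def)

context
  fixes w W W2 :: "real \<Rightarrow> real" and A :: real and X :: "real set"
  assumes W_cont: "\<And>y. y \<in> {0<..<1} \<Longrightarrow> isCont W y"
    and X: "finite X" and W_DERIV: "\<And>y. y \<in> {0<..<1} - X \<Longrightarrow> (W has_real_derivative w y) (at y)"
    and w_bound: "\<And>y. y \<in> {0<..<1} \<Longrightarrow> \<bar>w y\<bar> \<le> A"
    and W_bound: "\<And>y. y \<in> {0<..<1} \<Longrightarrow> \<bar>W y\<bar> \<le> 2 * A * (y * (1 - y))"
    and w_meas: "w \<in> borel_measurable borel"
begin

lemma A_nonneg: "0 \<le> A" using w_bound[of "1/2"] by (auto intro: order_trans[OF abs_ge_zero])

lemma W_chi'_bound: "\<bar>W (\<Phi> x) * chi' n (\<Phi> x)\<bar> \<le> 6 * A"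
proof -
  let ?y = "\<Phi> x"
  have d: "0 < ?y * (1 - ?y)" by (rule d_pos[OF CDF_range])
  have "\<bar>W ?y * chi' n ?y\<bar> \<le> (2 * A * (?y * (1 - ?y))) * (3 / (?y * (1 - ?y)))"
    unfolding abs_mult using A_nonneg d W_bound[OF CDF_range[of x]] chi_bounds(3)[OF CDF_range[of x]]
    by (intro mult_mono) auto
  also have "\<dots> = 6 * A" using CDF_range[of x] by auto
  finally show ?thesis .
qed

lemma w_chi_bound: "\<bar>w (\<Phi> x) * chi n (\<Phi> x)\<bar> \<le> A"
proof -
  have "\<bar>w (\<Phi> x) * chi n (\<Phi> x)\<bar> \<le> A * 1"
    unfolding abs_mult using A_nonneg w_bound[OF CDF_range[of x]] chi_bounds(1,2)[OF CDF_range[of x]]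
    by (intro mult_mono) auto
  then show ?thesis by simp
qed

text \<open>\<open>W\<close> is \<open>O(d)\<close>, which compensates the growth \<open>O(1 / d)\<close> of the derivative of the cutoff. Hence the
truncated kernels converge to \<open>w (\<Phi> x) * \<phi> x\<close> while staying below a fixed multiple of
\<open>\<phi>\<close>.\<close>
lemma cutQ_facts:
  "continuous_on UNIV (cutQ W n)"
  "\<Phi> x \<notin> X \<Longrightarrow> (cutQ W n has_real_derivative cutB1 w W n x) (at x)"
  "cutB1 w W n \<in> borel_measurable borel"
  "\<bar>cutB1 w W n x\<bar> \<le> 7 * A * \<phi> x"
  "(\<lambda>n. cutB1 w W n x) \<longlonglongrightarrow> w (\<Phi> x) * \<phi> x"
  "\<bar>cutQ W n x\<bar> \<le> \<bar>W (\<Phi> x)\<bar>"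
proof -
  show "continuous_on UNIV (cutQ W n)"
    unfolding cutQ_def[abs_def]
    by (intro continuous_at_imp_continuous_on ballI isCont_mult isCont_o2[OF CDF_isCont] W_cont CDF_range
        DERIV_isCont[OF chi_comp_DERIV(1)])
  show "(cutQ W n has_real_derivative cutB1 w W n x) (at x)" if "\<Phi> x \<notin> X"
  proof -
    have "((\<lambda>x. W (\<Phi> x)) has_real_derivative w (\<Phi> x) * \<phi> x) (at x)"
      by (rule DERIV_chain2[OF W_DERIV CDF_DERIV]) (use that CDF_range in auto)
    from DERIV_mult[OF this chi_comp_DERIV(1)[of n x]] show ?thesis
      unfolding cutQ_def[abs_def] cutB1_def
      by (rule back_subst[where P="\<lambda>D. (_ has_real_derivative D) (at x)"]) (simp add: algebra_simps)
  qed
  show "cutB1 w W n \<in> borel_measurable borel"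
    unfolding cutB1_def[abs_def]
    by (intro borel_measurable_times borel_measurable_add \<phi>_meas comp_meas[OF W_cont]
        measurable_compose[OF CDF_meas w_meas] measurable_compose[OF CDF_meas chi_measurable(1)]
        measurable_compose[OF CDF_meas chi_measurable(2)])
  have "\<bar>w (\<Phi> x) * chi n (\<Phi> x) + W (\<Phi> x) * chi' n (\<Phi> x)\<bar> \<le> 7 * A"
    using w_chi_bound[of x n] W_chi'_bound[of x n] by linarith
  then show "\<bar>cutB1 w W n x\<bar> \<le> 7 * A * \<phi> x"
    unfolding cutB1_def abs_mult using \<phi>_pos[of x] by (intro mult_mono) auto
  have "(\<lambda>n. (w (\<Phi> x) * chi n (\<Phi> x) + W (\<Phi> x) * chi' n (\<Phi> x)) * \<phi> x) \<longlonglongrightarrow> (w (\<Phi> x) * 1 + W (\<Phi> x) * 0) * \<phi> x"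
    by (intro tendsto_intros chi_lim CDF_range)
  then show "(\<lambda>n. cutB1 w W n x) \<longlonglongrightarrow> w (\<Phi> x) * \<phi> x" by (simp add: cutB1_def)
  show "\<bar>cutQ W n x\<bar> \<le> \<bar>W (\<Phi> x)\<bar>"
    unfolding cutQ_def abs_mult using chi_bounds(1,2)[OF CDF_range[of x], of n] by (intro mult_left_le) auto
qed

context
  assumes W2_DERIV: "\<And>y. y \<in> {0<..<1} \<Longrightarrow> (W2 has_real_derivative W y) (at y)"
    and W2_bound: "\<And>y. y \<in> {0<..<1} \<Longrightarrow> \<bar>W2 y\<bar> \<le> 4 * A * (y * (1 - y))\<^sup>2"
begin

text \<open>Now \<open>W2\<close> is \<open>O(d\<^sup>2)\<close>, which compensates the second derivative of the cutoff. This quadratic decay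
at both end points replaces every discussion of boundary terms at infinity.\<close>
lemma cutV_facts:
  "(cutV W2 n has_real_derivative cutP W W2 n x * \<phi> x) (at x)"
  "continuous_on UNIV (cutP W W2 n)"
  "\<Phi> x \<notin> X \<Longrightarrow> (cutP W W2 n has_real_derivative cutB w W W2 n x) (at x)"
  "cutB w W W2 n \<in> borel_measurable borel"
  "\<bar>cutB w W W2 n x\<bar> \<le> 85 * A * \<phi> x"
  "(\<lambda>n. cutB w W W2 n x) \<longlonglongrightarrow> w (\<Phi> x) * \<phi> x"
  "\<bar>cutV W2 n x\<bar> \<le> \<bar>W2 (\<Phi> x)\<bar>"
proof -
  have W2d: "((\<lambda>x. W2 (\<Phi> x)) has_real_derivative W (\<Phi> x) * \<phi> x) (at x)" for x
    by (rule DERIV_chain2[OF W2_DERIV[OF CDF_range] CDF_DERIV])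
  show "(cutV W2 n has_real_derivative cutP W W2 n x * \<phi> x) (at x)"
    using DERIV_mult[OF W2d[of x] chi_comp_DERIV(1)[of n x]]
    unfolding cutV_def[abs_def] cutP_def
    by (rule back_subst[where P="\<lambda>D. (_ has_real_derivative D) (at x)"]) (simp add: algebra_simps)
  show "continuous_on UNIV (cutP W W2 n)"
    unfolding cutP_def[abs_def]
    by (intro continuous_at_imp_continuous_on ballI isCont_mult isCont_add isCont_o2[OF CDF_isCont] W_cont CDF_range
        DERIV_isCont[OF chi_comp_DERIV(1)] DERIV_isCont[OF chi_comp_DERIV(2)] DERIV_isCont[OF W2_DERIV])
  show "(cutP W W2 n has_real_derivative cutB w W W2 n x) (at x)" if "\<Phi> x \<notin> X"
  proof -
    have "((\<lambda>x. W (\<Phi> x)) has_real_derivative w (\<Phi> x) * \<phi> x) (at x)"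
      by (rule DERIV_chain2[OF W_DERIV CDF_DERIV]) (use that CDF_range in auto)
    from DERIV_add[OF DERIV_mult[OF this chi_comp_DERIV(1)[of n x]] DERIV_mult[OF W2d[of x] chi_comp_DERIV(2)[of n x]]]
    show ?thesis
      unfolding cutP_def[abs_def] cutB_def
      by (rule back_subst[where P="\<lambda>D. (_ has_real_derivative D) (at x)"]) (simp add: algebra_simps)
  qed
  show "cutB w W W2 n \<in> borel_measurable borel"
    unfolding cutB_def[abs_def]
    by (intro borel_measurable_times borel_measurable_add borel_measurable_const \<phi>_meas comp_meas[OF W_cont]
        comp_meas[OF DERIV_isCont[OF W2_DERIV]]
        measurable_compose[OF CDF_meas w_meas] measurable_compose[OF CDF_meas chi_measurable(1)]
        measurable_compose[OF CDF_meas chi_measurable(2)] measurable_compose[OF CDF_meas chi_measurable(3)])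
  have "\<bar>W2 (\<Phi> x) * chi'' n (\<Phi> x)\<bar> \<le> 72 * A"
  proof -
    let ?y = "\<Phi> x"
    have d: "0 < ?y * (1 - ?y)" by (rule d_pos[OF CDF_range])
    have "\<bar>W2 ?y * chi'' n ?y\<bar> \<le> (4 * A * (?y * (1 - ?y))\<^sup>2) * (18 / (?y * (1 - ?y))\<^sup>2)"
      unfolding abs_mult using A_nonneg d W2_bound[OF CDF_range[of x]] chi_bounds(4)[OF CDF_range[of x]]
      by (intro mult_mono) auto
    also have "\<dots> = 72 * A" using CDF_range[of x] by auto
    finally show ?thesis .
  qed
  then have "\<bar>w (\<Phi> x) * chi n (\<Phi> x) + 2 * (W (\<Phi> x) * chi' n (\<Phi> x)) + W2 (\<Phi> x) * chi'' n (\<Phi> x)\<bar> \<le> 85 * A"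
    using w_chi_bound[of x n] W_chi'_bound[of x n] by linarith
  then show "\<bar>cutB w W W2 n x\<bar> \<le> 85 * A * \<phi> x"
    unfolding cutB_def abs_mult using \<phi>_pos[of x] by (intro mult_mono) auto
  have "(\<lambda>n. (w (\<Phi> x) * chi n (\<Phi> x) + 2 * (W (\<Phi> x) * chi' n (\<Phi> x)) + W2 (\<Phi> x) * chi'' n (\<Phi> x)) * \<phi> x)
      \<longlonglongrightarrow> (w (\<Phi> x) * 1 + 2 * (W (\<Phi> x) * 0) + W2 (\<Phi> x) * 0) * \<phi> x"
    by (intro tendsto_intros chi_lim CDF_range)
  then show "(\<lambda>n. cutB w W W2 n x) \<longlonglongrightarrow> w (\<Phi> x) * \<phi> x" by (simp add: cutB_def)
  show "\<bar>cutV W2 n x\<bar> \<le> \<bar>W2 (\<Phi> x)\<bar>"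
    unfolding cutV_def abs_mult using chi_bounds(1,2)[OF CDF_range[of x], of n] by (intro mult_left_le) auto
qed

end

end

end

text \<open>Combines separate bounds at the two end points into one by \<open>y * (1 - y)\<close>.\<close>
lemma min_le_twice:
  assumes "y \<in> {0<..<1::real}" "b \<le> y" "b \<le> 1 - y"
  shows "b \<le> 2 * (y * (1 - y))"
proof (cases "y \<le> 1 / 2")
  case True
  have "y * 1 \<le> y * (2 * (1 - y))" using True assms by (intro mult_left_mono) auto
  then show ?thesis using assms(2) by (simp add: algebra_simps)
next
  case False
  have "1 * (1 - y) \<le> (2 * y) * (1 - y)" using False assms by (intro mult_right_mono) auto
  then show ?thesis using assms(3) by simp
qed

lemma scaled_triangle_wave_bound:
  assumes y: "y \<in> {0<..<1}"
  shows "triangle_wave (2 ^ Suc a * y) / 2 ^ Suc a \<le> y" "triangle_wave (2 ^ Suc a * y) / 2 ^ Suc a \<le> 1 - y"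
proof -
  have "triangle_wave (2 ^ Suc a * y) \<le> 2 ^ Suc a * y" using triangle_wave_le[of "2 ^ Suc a * y"] y by simp
  then show "triangle_wave (2 ^ Suc a * y) / 2 ^ Suc a \<le> y" by (simp add: field_simps)
  have "triangle_wave (2 ^ Suc a * y) = triangle_wave (2 ^ Suc a * y - 2 ^ Suc a)"
    using triangle_wave_shift[of "2 ^ Suc a * y - 2 ^ Suc a" "2 ^ a"] by simp
  also have "\<dots> \<le> \<bar>2 ^ Suc a * y - 2 ^ Suc a\<bar>" by (rule triangle_wave_le)
  also have "\<dots> = 2 ^ Suc a * (1 - y)"
  proof -
    have "2 ^ Suc a * y - 2 ^ Suc a = - (2 ^ Suc a * (1 - y))" by (simp add: algebra_simps)
    then show ?thesis using y by (simp add: abs_mult)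
  qed
  finally show "triangle_wave (2 ^ Suc a * y) / 2 ^ Suc a \<le> 1 - y" by (simp add: field_simps)
qed

lemma eventually_positive: "y \<in> {0<..<1} \<Longrightarrow> eventually (\<lambda>x. 0 \<le> (x::real)) (nhds y)"
  using eventually_nhds_in_open[of "{0<..}" y] by (auto elim!: eventually_mono)

text \<open>The hypotheses of the truncation lemmas for \<open>k = 2 ^ a\<close>, and the bound that produces the factor
\<open>1 / 2\<close> in the constant.\<close>
lemma Walsh_N1_data:
  fixes a m :: nat
  shows "y \<in> {0<..<1} \<Longrightarrow> isCont (cum_wal (2 ^ a) m) y"
    and "y \<in> {0<..<1} - wal_nodes a \<Longrightarrow> (cum_wal (2 ^ a) m has_real_derivative loc_wal (2 ^ a) m y) (at y)"
    and "\<bar>loc_wal (2 ^ a) m y\<bar> \<le> 1"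
    and "y \<in> {0<..<1} \<Longrightarrow> \<bar>cum_wal (2 ^ a) m y\<bar> \<le> 2 * 1 * (y * (1 - y))"
    and "loc_wal (2 ^ a) m \<in> borel_measurable borel"
    and "y \<in> {0<..<1} \<Longrightarrow> \<bar>cum_wal (2 ^ a) m y\<bar> \<le> 1 / 2 * (1 / 2 ^ a)"
proof -
  let ?T = "\<lambda>x. triangle_wave (2 ^ Suc a * x) / 2 ^ Suc a"
  have ev: "eventually (\<lambda>x. cum_wal (2 ^ a) m x = ?T x) (nhds y)" if "y \<in> {0<..<1}"
    using eventually_positive[OF that] by eventually_elim (rule cum_wal_N1)
  show "isCont (cum_wal (2 ^ a) m) y" if y: "y \<in> {0<..<1}"
  proof -
    have "isCont ?T y"
      using continuous_scaled_triangle_wave[of UNIV "2 ^ Suc a"] by (simp add: continuous_on_eq_continuous_at del: power_Suc)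
    then show ?thesis using isCont_cong[OF ev[OF y]] by simp
  qed
  show "(cum_wal (2 ^ a) m has_real_derivative loc_wal (2 ^ a) m y) (at y)" if y: "y \<in> {0<..<1} - wal_nodes a"
  proof -
    have "(?T has_real_derivative square_wave (2 ^ Suc a * y)) (at y)"
      by (rule scaled_triangle_wave_DERIV) (use y in \<open>auto simp: wal_nodes_def simp del: power_Suc\<close>)
    then show ?thesis using DERIV_cong_ev[OF refl ev refl, of "loc_wal (2 ^ a) m y"] y by (simp add: loc_wal_N1 del: power_Suc)
  qed
  show "\<bar>loc_wal (2 ^ a) m y\<bar> \<le> 1" by (simp add: loc_wal_N1)
  show "\<bar>cum_wal (2 ^ a) m y\<bar> \<le> 2 * 1 * (y * (1 - y))" if y: "y \<in> {0<..<1}"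
    using min_le_twice[OF y scaled_triangle_wave_bound[OF y, of a]] cum_wal_N1[of y a m] y triangle_wave_bounds[of "2 ^ Suc a * y"]
    by (simp del: power_Suc)
  show "loc_wal (2 ^ a) m \<in> borel_measurable borel"
    unfolding loc_wal_N1[abs_def] by measurable
  show "\<bar>cum_wal (2 ^ a) m y\<bar> \<le> 1 / 2 * (1 / 2 ^ a)" if y: "y \<in> {0<..<1}"
    using cum_wal_N1[of y a m] y triangle_wave_bounds[of "2 ^ Suc a * y"] by (simp add: divide_simps)
qed

context
  fixes k a1 a2 m :: nat
  assumes k: "k \<in> N2 - N1" and ka: "k = 2 ^ a1 + 2 ^ a2" and lt: "a2 < a1"
begin

lemma abs_cum_wave_bound:
  assumes y: "y \<in> {0<..<1}"
  shows "\<bar>cum_wave a1 a2 m y\<bar> \<le> wal_amp a2 * y" "\<bar>cum_wave a1 a2 m y\<bar> \<le> wal_amp a2 * (1 - y)"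
proof -
  have "\<bar>cum_wave a1 a2 m y\<bar> = wal_amp a2 * (\<bar>half_sign m \<lfloor>2 ^ Suc a2 * y\<rfloor>\<bar> * (triangle_wave (2 ^ Suc a1 * y) / 2 ^ Suc a1))"
    using triangle_wave_bounds[of "2 ^ Suc a1 * y"] by (simp add: cum_wave_def[OF k ka lt] abs_mult del: power_Suc)
  also have "\<dots> \<le> wal_amp a2 * (1 * (triangle_wave (2 ^ Suc a1 * y) / 2 ^ Suc a1))"
    using abs_half_sign triangle_wave_bounds[of "2 ^ Suc a1 * y"] by (intro mult_left_mono mult_right_mono) auto
  finally have *: "\<bar>cum_wave a1 a2 m y\<bar> \<le> wal_amp a2 * (triangle_wave (2 ^ Suc a1 * y) / 2 ^ Suc a1)" by simp
  show "\<bar>cum_wave a1 a2 m y\<bar> \<le> wal_amp a2 * y"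
    by (rule order_trans[OF *]) (intro mult_left_mono scaled_triangle_wave_bound y, simp)
  show "\<bar>cum_wave a1 a2 m y\<bar> \<le> wal_amp a2 * (1 - y)"
    by (rule order_trans[OF *]) (intro mult_left_mono scaled_triangle_wave_bound y, simp)
qed

lemma integral_cum_wave_DERIV:
  assumes "y \<in> {0<..<1}"
  shows "((\<lambda>x. integral {0..x} (cum_wave a1 a2 m)) has_real_derivative cum_wave a1 a2 m y) (at y)"
proof -
  have "((\<lambda>x. integral {0..x} (cum_wave a1 a2 m)) has_real_derivative cum_wave a1 a2 m y) (at y within {0..1})"
    by (rule integral_has_real_derivative) (use assms cum_wave_cont[OF k ka lt] in auto)
  then show ?thesis using assms by (simp add: at_within_Icc_at)
qed

lemma Walsh_N2_data:
  shows "y \<in> {0<..<1} \<Longrightarrow> isCont (cum_wal k m) y"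
    and "y \<in> {0<..<1} - wal_nodes a1 \<Longrightarrow> (cum_wal k m has_real_derivative loc_wal k m y) (at y)"
    and "\<bar>loc_wal k m y\<bar> \<le> wal_amp a2"
    and "y \<in> {0<..<1} \<Longrightarrow> \<bar>cum_wal k m y\<bar> \<le> 2 * wal_amp a2 * (y * (1 - y))"
    and "loc_wal k m \<in> borel_measurable borel"
    and "y \<in> {0<..<1} \<Longrightarrow> (cum2_wal k m has_real_derivative cum_wal k m y) (at y)"
proof -
  have ev: "eventually (\<lambda>x. cum_wal k m x = cum_wave a1 a2 m x) (nhds y)" if "y \<in> {0<..<1}"
    using eventually_positive[OF that] by eventually_elim (rule cum_wal_N2[OF k ka lt])
  show "isCont (cum_wal k m) y" if y: "y \<in> {0<..<1}"
  proof -
    have "isCont (cum_wave a1 a2 m) y"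
      using cum_wave_cont[OF k ka lt, of UNIV] by (simp add: continuous_on_eq_continuous_at)
    then show ?thesis using isCont_cong[OF ev[OF y]] by simp
  qed
  show "(cum_wal k m has_real_derivative loc_wal k m y) (at y)" if y: "y \<in> {0<..<1} - wal_nodes a1"
  proof -
    have "(cum_wave a1 a2 m has_real_derivative loc_wal k m y) (at y)"
      by (rule cum_wave_DERIV[OF k ka lt]) (use y in \<open>auto simp: wal_nodes_def simp del: power_Suc\<close>)
    then show ?thesis using DERIV_cong_ev[OF refl ev refl, of "loc_wal k m y"] y by simp
  qed
  show "\<bar>loc_wal k m y\<bar> \<le> wal_amp a2" by (rule abs_loc_wal_N2[OF k ka lt])
  show "\<bar>cum_wal k m y\<bar> \<le> 2 * wal_amp a2 * (y * (1 - y))" if y: "y \<in> {0<..<1}"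
  proof -
    have A: "0 < wal_amp a2" by simp
    have "\<bar>cum_wave a1 a2 m y\<bar> / wal_amp a2 \<le> 2 * (y * (1 - y))"
      by (rule min_le_twice[OF y]) (use abs_cum_wave_bound[OF y] A in \<open>simp_all add: pos_divide_le_eq mult.commute\<close>)
    then have "\<bar>cum_wave a1 a2 m y\<bar> \<le> 2 * (y * (1 - y)) * wal_amp a2" using A by (simp only: pos_divide_le_eq)
    also have "\<dots> = 2 * wal_amp a2 * (y * (1 - y))" by (simp only: mult_ac)
    finally show ?thesis using y cum_wal_N2[OF k ka lt, of y m] by simp
  qed
  show "loc_wal k m \<in> borel_measurable borel" by (rule loc_wal_N2_measurable[OF k ka lt])
  show "(cum2_wal k m has_real_derivative cum_wal k m y) (at y)" if y: "y \<in> {0<..<1}"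
  proof -
    have "eventually (\<lambda>x. cum2_wal k m x = integral {0..x} (cum_wave a1 a2 m)) (nhds y)"
      using eventually_positive[OF y] by eventually_elim (rule cum2_wal_N2[OF k ka lt])
    from DERIV_cong_ev[OF refl this refl, of "cum_wal k m y"] show ?thesis
      using integral_cum_wave_DERIV[OF y] y cum_wal_N2[OF k ka lt, of y m] by simp
  qed
qed

lemma cum2_wal_vanish:
  assumes "0 \<le> x" "\<lfloor>2 ^ a2 * x\<rfloor> \<noteq> int m"
  shows "cum2_wal k m x = 0"
  using cum2_wal_N2[OF k ka lt assms(1)] integral_cum_wave_zero[OF k ka lt assms] by simp

text \<open>The twice cumulated function and its derivative vanish at 0 and at 1, and the second derivative is
bounded; the mean value theorem from either end point gives the quadratic decay.\<close>
lemma cum2_wal_bound: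
  assumes m: "m \<in> L2_idx k" and y: "y \<in> {0<..<1}"
  shows "\<bar>cum2_wal k m y\<bar> \<le> 4 * wal_amp a2 * (y * (1 - y))\<^sup>2"
proof -
  let ?I = "\<lambda>x. integral {0..x} (cum_wave a1 a2 m)"
  have A: "0 < wal_amp a2" by simp
  have y': "0 < y" "y < 1" using y by auto
  have cont: "continuous_on {0..1} ?I"
    by (intro indefinite_integral_continuous_1 integrable_continuous_real cum_wave_cont[OF k ka lt])
  have d: "(?I has_derivative (\<lambda>h. cum_wave a1 a2 m x * h)) (at x)" if "0 < x" "x < 1" for x
    using integral_cum_wave_DERIV[of x] that by (simp add: has_field_derivative_def)
  have I1: "?I 1 = 0"
    by (rule integral_cum_wave_zero[OF k ka lt]) (use m in \<open>auto simp: L2_idx_k[OF k ka lt]\<close>)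
  obtain x where x: "x \<in> {0<..<y}" "?I y - ?I 0 = cum_wave a1 a2 m x * (y - 0)"
    by (rule mvt[of 0 y ?I "\<lambda>x h. cum_wave a1 a2 m x * h"])
      (use y' d in \<open>auto intro!: continuous_on_subset[OF cont]\<close>)
  obtain z where z: "z \<in> {y<..<1}" "?I 1 - ?I y = cum_wave a1 a2 m z * (1 - y)"
    by (rule mvt[of y 1 ?I "\<lambda>x h. cum_wave a1 a2 m x * h"])
      (use y' d in \<open>auto intro!: continuous_on_subset[OF cont]\<close>)
  have "\<bar>?I y\<bar> \<le> (wal_amp a2 * y) * y"
  proof -
    have "\<bar>cum_wave a1 a2 m x\<bar> \<le> wal_amp a2 * x" using abs_cum_wave_bound(1)[of x] x(1) y' by simp
    also have "\<dots> \<le> wal_amp a2 * y" using x(1) A by (intro mult_left_mono) auto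
    finally have "\<bar>cum_wave a1 a2 m x\<bar> * \<bar>y\<bar> \<le> (wal_amp a2 * y) * \<bar>y\<bar>" by (intro mult_right_mono) auto
    then show ?thesis using x(2) y' by (simp add: abs_mult)
  qed
  then have b1: "\<bar>?I y\<bar> \<le> wal_amp a2 * y\<^sup>2" by (simp add: power2_eq_square)
  have "\<bar>?I y\<bar> \<le> (wal_amp a2 * (1 - y)) * (1 - y)"
  proof -
    have "\<bar>cum_wave a1 a2 m z\<bar> \<le> wal_amp a2 * (1 - z)" using abs_cum_wave_bound(2)[of z] z(1) y' by simp
    also have "\<dots> \<le> wal_amp a2 * (1 - y)" using z(1) A by (intro mult_left_mono) auto
    finally have "\<bar>cum_wave a1 a2 m z\<bar> * \<bar>1 - y\<bar> \<le> (wal_amp a2 * (1 - y)) * \<bar>1 - y\<bar>" by (intro mult_right_mono) auto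
    moreover have "\<bar>?I y\<bar> = \<bar>cum_wave a1 a2 m z\<bar> * \<bar>1 - y\<bar>" using z(2) I1 by (metis abs_minus_cancel abs_mult diff_0)
    ultimately show ?thesis using y' by simp
  qed
  then have b2: "\<bar>?I y\<bar> \<le> wal_amp a2 * (1 - y)\<^sup>2" by (simp add: power2_eq_square)
  \<comment> \<open>the two quadratic bounds are merged after taking square roots\<close>
  define s where "s = sqrt (\<bar>?I y\<bar> / wal_amp a2)"
  have "s \<le> 2 * (y * (1 - y))"
  proof (rule min_le_twice[OF y])
    show "s \<le> y" unfolding s_def
      by (rule real_le_lsqrt) (use b1 A y' in \<open>auto simp: pos_divide_le_eq mult.commute\<close>)
    show "s \<le> 1 - y" unfolding s_def
      by (rule real_le_lsqrt) (use b2 A y' in \<open>auto simp: pos_divide_le_eq mult.commute\<close>)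
  qed
  moreover have s: "0 \<le> s" "s\<^sup>2 = \<bar>?I y\<bar> / wal_amp a2" using A by (auto simp: s_def)
  ultimately have "\<bar>?I y\<bar> / wal_amp a2 \<le> (2 * (y * (1 - y)))\<^sup>2" using power_mono[of s _ 2] by metis
  then have "\<bar>?I y\<bar> \<le> (2 * (y * (1 - y)))\<^sup>2 * wal_amp a2" using A by (simp only: pos_divide_le_eq)
  moreover have "cum2_wal k m y = ?I y" by (rule cum2_wal_N2[OF k ka lt]) (use y in auto)
  moreover have "(2 * d)\<^sup>2 * wal_amp a2 = 4 * wal_amp a2 * d\<^sup>2" for d :: real by (simp add: power_mult_distrib)
  ultimately show ?thesis by (simp only:)
qed

end

text \<open>At most one \<open>m\<close> contributes at a given point, namely \<open>\<lfloor>2 ^ a2 * y\<rfloor>\<close>. This is why the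
sum over \<open>m\<close> costs nothing compared with a single coefficient.\<close>
lemma sum_abs_cum2_wal_le:
  assumes k: "k \<in> N2 - N1" and ka: "k = 2 ^ a1 + 2 ^ a2" and lt: "a2 < a1" and y: "0 \<le> y"
    and D: "\<And>m. m \<in> L2_idx k \<Longrightarrow> \<bar>cum2_wal k m y\<bar> * c \<le> D" "0 \<le> D"
  shows "(\<Sum>m\<in>L2_idx k. \<bar>cum2_wal k m y\<bar> * c) \<le> D"
proof (cases "nat \<lfloor>2 ^ a2 * y\<rfloor> \<in> L2_idx k")
  case True
  have fin: "finite (L2_idx k)" by (simp add: L2_idx_k[OF k ka lt])
  have f0: "0 \<le> \<lfloor>2 ^ a2 * y\<rfloor>" using y by simp
  have "(\<Sum>m\<in>L2_idx k. \<bar>cum2_wal k m y\<bar> * c) = \<bar>cum2_wal k (nat \<lfloor>2 ^ a2 * y\<rfloor>) y\<bar> * c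
      + (\<Sum>m\<in>L2_idx k - {nat \<lfloor>2 ^ a2 * y\<rfloor>}. \<bar>cum2_wal k m y\<bar> * c)"
    by (rule sum.remove[OF fin True])
  also have "(\<Sum>m\<in>L2_idx k - {nat \<lfloor>2 ^ a2 * y\<rfloor>}. \<bar>cum2_wal k m y\<bar> * c) = 0"
  proof (rule sum.neutral, rule ballI)
    fix m assume "m \<in> L2_idx k - {nat \<lfloor>2 ^ a2 * y\<rfloor>}"
    then have "\<lfloor>2 ^ a2 * y\<rfloor> \<noteq> int m" by auto
    from cum2_wal_vanish[OF k ka lt y this] show "\<bar>cum2_wal k m y\<bar> * c = 0" by simp
  qed
  finally show ?thesis using D(1)[OF True] by simp
next
  case False
  have "(\<Sum>m\<in>L2_idx k. \<bar>cum2_wal k m y\<bar> * c) = 0"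
  proof (rule sum.neutral, rule ballI)
    fix m assume "m \<in> L2_idx k"
    then have "\<lfloor>2 ^ a2 * y\<rfloor> \<noteq> int m" using False by auto
    from cum2_wal_vanish[OF k ka lt y this] show "\<bar>cum2_wal k m y\<bar> * c = 0" by simp
  qed
  then show ?thesis using D(2) by simp
qed

section \<open>Truncated Walsh coefficients\<close>

text \<open>The majorant \<open>g\<close> may be non-measurable, as are the integrands of the norm when the weights are;
the constant is therefore pulled out on the side of \<open>f\<close>.\<close>
lemma nn_integral_le_cmult:
  assumes f: "f \<in> borel_measurable M" and K: "0 \<le> (K::real)"
    and le: "\<And>x. x \<in> space M \<Longrightarrow> f x \<le> K * g x" and g: "\<And>x. x \<in> space M \<Longrightarrow> 0 \<le> g x"
  shows "(\<integral>\<^sup>+ x. ennreal (f x) \<partial>M) \<le> ennreal K * (\<integral>\<^sup>+ x. ennreal (g x) \<partial>M)"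
proof (cases "K = 0")
  case True
  have "(\<integral>\<^sup>+ x. ennreal (f x) \<partial>M) = (\<integral>\<^sup>+ x. 0 \<partial>M)"
    by (rule nn_integral_cong) (use le True in \<open>auto simp: ennreal_neg\<close>)
  then show ?thesis by simp
next
  case False
  then have K: "0 < K" using K by simp
  have "(\<integral>\<^sup>+ x. ennreal (f x) \<partial>M) = (\<integral>\<^sup>+ x. ennreal K * ennreal (f x / K) \<partial>M)"
    using K by (intro nn_integral_cong) (simp add: ennreal_mult'[symmetric])
  also have "\<dots> = ennreal K * (\<integral>\<^sup>+ x. ennreal (f x / K) \<partial>M)"
    by (rule nn_integral_cmult) (use f in measurable)
  also have "\<dots> \<le> ennreal K * (\<integral>\<^sup>+ x. ennreal (g x) \<partial>M)"
    using le K by (intro mult_left_mono nn_integral_mono ennreal_leI) (auto simp: pos_divide_le_eq mult.commute)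
  finally show ?thesis .
qed

locale walsh_setting = positive_density \<phi> for \<phi> :: "real \<Rightarrow> real" +
  fixes \<psi> \<omega> :: "real \<Rightarrow> real" and C \<beta> :: real and F :: "real ^ 's::finite \<Rightarrow> real"
    and u v :: "'s set" and k a1 a2 :: "'s \<Rightarrow> nat"
  assumes \<psi>: "\<And>x. 0 < \<psi> x" and \<omega>: "\<And>x. 0 < \<omega> x" and C: "0 < C"
    and assA: "assumption_A \<phi> \<psi> \<omega> C \<beta>"
    and L2: "in_L2 \<phi> F" and smooth: "suff_smooth F" and vu: "v \<subseteq> u"
    and inner: "inner_locally_integrable \<phi> u v F"
    and kv: "\<And>j. j \<in> v \<Longrightarrow> k j \<in> N2 - N1" "\<And>j. j \<in> v \<Longrightarrow> k j = 2 ^ a1 j + 2 ^ a2 j" "\<And>j. j \<in> v \<Longrightarrow> a2 j < a1 j"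
    and ku: "\<And>j. j \<in> u - v \<Longrightarrow> k j = 2 ^ a1 j"
begin

definition rho where "rho x = 1 / \<phi> x"
definition rho' where "rho' x = - deriv \<phi> x / (\<phi> x)\<^sup>2"

lemma rho_DERIV: "(rho has_real_derivative rho' x) (at x)"
proof -
  have "((\<lambda>x. 1 / \<phi> x) has_real_derivative (0 * \<phi> x - 1 * deriv \<phi> x) / (\<phi> x * \<phi> x)) (at x)"
    by (rule DERIV_divide[OF DERIV_const \<phi>_DERIV]) (use \<phi>_pos[of x] in simp)
  then show ?thesis by (simp add: rho_def[abs_def] rho'_def power2_eq_square)
qed

lemma deriv_meas: "deriv \<phi> \<in> borel_measurable borel"
proof (rule borel_measurable_LIMSEQ_real)
  fix x
  have "((\<lambda>h. (\<phi> (x + h) - \<phi> x) / h) \<longlongrightarrow> deriv \<phi> x) (at 0)"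
    using \<phi>_DERIV[of x] by (simp add: DERIV_def)
  moreover have "filterlim (\<lambda>n. 1 / real (Suc n)) (at 0) sequentially"
    unfolding filterlim_at using LIMSEQ_Suc[OF lim_1_over_n] by (auto intro!: always_eventually)
  ultimately show "(\<lambda>n. (\<phi> (x + 1 / real (Suc n)) - \<phi> x) / (1 / real (Suc n))) \<longlonglongrightarrow> deriv \<phi> x"
    by (rule filterlim_compose)
next
  show "(\<lambda>x. (\<phi> (x + 1 / real (Suc n)) - \<phi> x) / (1 / real (Suc n))) \<in> borel_measurable borel" for n
    using \<phi>_meas by measurable
qed

lemma rho'_meas: "rho' \<in> borel_measurable borel"
  unfolding rho'_def[abs_def] using deriv_meas \<phi>_meas by measurable

lemma rho_meas: "rho \<in> borel_measurable borel"
  unfolding rho_def[abs_def] using \<phi>_meas by measurable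

definition coef where "coef j = 2 powr (real (a2 j) / 2) / 2 powr (real (a1 j) + \<beta> * real (a2 j))"

lemma assA_bounds:
  assumes "j \<in> v" "m \<in> L2_idx (k j)"
  shows "\<bar>cum2_wal (k j) m (\<Phi> x)\<bar> * \<bar>rho x\<bar> \<le> C * coef j * \<psi> x"
    and "\<bar>cum2_wal (k j) m (\<Phi> x)\<bar> * \<bar>rho' x\<bar> \<le> C * coef j * \<omega> x"
proof -
  have A: "(SUP x. ereal (\<bar>cum2_wal (k j) m (\<Phi> x)\<bar> / (\<phi> x * \<psi> x))) \<le> ereal (C * coef j)"
     "(SUP x. ereal (\<bar>cum2_wal (k j) m (\<Phi> x) * deriv \<phi> x\<bar> / ((\<phi> x)\<^sup>2 * \<omega> x))) \<le> ereal (C * coef j)"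
    using assA assms kv[OF assms(1)] unfolding assumption_A_def coef_def by blast+
  have p: "0 < \<phi> x" "0 < \<psi> x" "0 < \<omega> x" using \<phi>_pos \<psi> \<omega> by auto
  have "ereal (\<bar>cum2_wal (k j) m (\<Phi> x)\<bar> / (\<phi> x * \<psi> x)) \<le> ereal (C * coef j)"
    by (rule order_trans[OF SUP_upper A(1)]) simp
  then show "\<bar>cum2_wal (k j) m (\<Phi> x)\<bar> * \<bar>rho x\<bar> \<le> C * coef j * \<psi> x"
    using p by (simp add: rho_def field_simps)
  have "ereal (\<bar>cum2_wal (k j) m (\<Phi> x) * deriv \<phi> x\<bar> / ((\<phi> x)\<^sup>2 * \<omega> x)) \<le> ereal (C * coef j)"
    by (rule order_trans[OF SUP_upper A(2)]) simp
  then show "\<bar>cum2_wal (k j) m (\<Phi> x)\<bar> * \<bar>rho' x\<bar> \<le> C * coef j * \<omega> x"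
    using p by (simp add: rho'_def abs_mult field_simps)
qed

lemma coef_pos: "0 < coef j" by (simp add: coef_def)

text \<open>The inner integral of the norm, as a function of the coordinates in \<open>u\<close>.\<close>
definition density_deriv where "density_deriv w y = (LINT z|LP (UNIV - u). mixed_deriv w u F (join u y z) * (\<Prod>j\<in>UNIV - u. \<phi> (z j)))"

text \<open>What two integrations by parts and absolute values under the integral sign leave of the coefficient
with index \<open>m\<close>; it may be infinite.\<close>
definition coeff_bound where "coeff_bound m = (\<Sum>w\<in>Pow v. \<integral>\<^sup>+ y. ennreal (\<bar>density_deriv w y\<bar> *
    ((\<Prod>j\<in>v. \<bar>cum2_wal (k j) (m j) (\<Phi> (y j))\<bar> * \<bar>if j \<in> w then rho (y j) else rho' (y j)\<bar>)
      * (\<Prod>j\<in>u - v. 1 / 2 * (1 / 2 ^ a1 j)))) \<partial>LP u)"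

lemma D_meas: "w \<subseteq> v \<Longrightarrow> mixed_deriv w u F \<in> borel_measurable borel"
  using mixed_deriv_cont[OF smooth, of w u] vu by (intro borel_measurable_continuous_onI) auto

lemma density_deriv_meas:
  assumes "w \<subseteq> v"
  shows "density_deriv w \<in> borel_measurable (LP u)"
proof -
  interpret sigma_finite_measure "LP (UNIV - u)" by (rule sigma_finite_LP) simp
  have "(\<lambda>(y, z). mixed_deriv w u F (join u y z)) \<in> borel_measurable (LP u \<Otimes>\<^sub>M LP (UNIV - u))"
    using measurable_compose[OF join_measurable D_meas[OF assms]] by (simp add: case_prod_unfold)
  moreover have "(\<lambda>(y, z). \<Prod>j\<in>UNIV - u. \<phi> (z j)) \<in> borel_measurable (LP u \<Otimes>\<^sub>M LP (UNIV - u))"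
    unfolding case_prod_unfold
    by (intro borel_measurable_prod measurable_compose[OF _ \<phi>_meas]
        measurable_compose[OF measurable_snd LP_component_measurable])
  ultimately have "(\<lambda>(y, z). mixed_deriv w u F (join u y z) * (\<Prod>j\<in>UNIV - u. \<phi> (z j))) \<in> borel_measurable (LP u \<Otimes>\<^sub>M LP (UNIV - u))"
    unfolding case_prod_unfold by (rule borel_measurable_times)
  then show ?thesis unfolding density_deriv_def[abs_def] by (rule borel_measurable_lebesgue_integral)
qed

text \<open>Square integrability with respect to a probability density implies integrability:
\<open>\<bar>F\<bar> \<le> F\<^sup>2 + 1\<close>.\<close>
lemma F\<phi>_integrable: "integrable lborel (\<lambda>x. F x * (\<Prod>j\<in>UNIV. \<phi> (x $ j)))"
proof (rule Bochner_Integration.integrable_bound)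
  have F2: "integrable lborel (\<lambda>x. (F x)\<^sup>2 * (\<Prod>j\<in>UNIV. \<phi> (x $ j)))" and Fm: "F \<in> borel_measurable lborel"
    using L2 by (auto simp: in_L2_def)
  interpret product_sigma_finite "\<lambda>_. lborel :: real measure" by (rule product_sigma_finite_lborel)
  note m = vec_lambda_borel
  have pm: "(\<lambda>x :: real ^ 's. \<Prod>j\<in>UNIV. \<phi> (x $ j)) \<in> borel_measurable borel"
    using \<phi>_meas by measurable
  have "integrable (LP (UNIV :: 's set)) (\<lambda>y. \<Prod>j\<in>UNIV. \<phi> (y j))"
    by (rule product_integrable_prod) (auto intro: \<phi>_int)
  then have "integrable lborel (\<lambda>x :: real ^ 's. \<Prod>j\<in>UNIV. \<phi> (x $ j))"
    unfolding lborel_vec[symmetric] by (subst integrable_distr_eq[OF m]) (use pm in auto)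
  with F2 show "integrable lborel (\<lambda>x. (F x)\<^sup>2 * (\<Prod>j\<in>UNIV. \<phi> (x $ j)) + (\<Prod>j\<in>UNIV. \<phi> (x $ j)))"
    by (rule Bochner_Integration.integrable_add)
  show "(\<lambda>x. F x * (\<Prod>j\<in>UNIV. \<phi> (x $ j))) \<in> borel_measurable lborel"
    using Fm pm by measurable
  show "AE x in lborel. norm (F x * (\<Prod>j\<in>UNIV. \<phi> (x $ j))) \<le> norm ((F x)\<^sup>2 * (\<Prod>j\<in>UNIV. \<phi> (x $ j)) + (\<Prod>j\<in>UNIV. \<phi> (x $ j)))"
  proof (intro AE_I2)
    fix x :: "real ^ 's"
    have P: "0 \<le> (\<Prod>j\<in>UNIV. \<phi> (x $ j))" using \<phi>_pos by (intro prod_nonneg) (auto simp: less_imp_le)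
    have "\<bar>F x\<bar> \<le> (F x)\<^sup>2 + 1"
      using sum_squares_bound[of "\<bar>F x\<bar>" 1] abs_ge_zero[of "F x"] by (simp add: power2_eq_square) 
    then have "\<bar>F x\<bar> * (\<Prod>j\<in>UNIV. \<phi> (x $ j)) \<le> ((F x)\<^sup>2 + 1) * (\<Prod>j\<in>UNIV. \<phi> (x $ j))"
      using P by (rule mult_right_mono)
    also have "\<dots> \<le> norm ((F x)\<^sup>2 * (\<Prod>j\<in>UNIV. \<phi> (x $ j)) + (\<Prod>j\<in>UNIV. \<phi> (x $ j)))"
      by (simp add: algebra_simps)
    finally show "norm (F x * (\<Prod>j\<in>UNIV. \<phi> (x $ j))) \<le> norm ((F x)\<^sup>2 * (\<Prod>j\<in>UNIV. \<phi> (x $ j)) + (\<Prod>j\<in>UNIV. \<phi> (x $ j)))"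
      using P by (simp add: abs_mult)
  qed
qed

lemma inner_integrable:
  assumes "w \<subseteq> v"
  shows "integrable lborel (\<lambda>x. indicator {x. \<forall>j\<in>u. \<bar>x $ j\<bar> \<le> R} x * (mixed_deriv w u F x * (\<Prod>j\<in>UNIV - u. \<phi> (x $ j))))"
  using inner assms unfolding inner_locally_integrable_def set_integrable_def by simp

lemma split_prod: "(\<Prod>j\<in>UNIV. f j) = (\<Prod>j\<in>u. f j) * (\<Prod>j\<in>UNIV - u. f j)" for f :: "'s \<Rightarrow> real"
  using prod.subset_diff[of u UNIV f] by (simp add: mult.commute)

context
  fixes m :: "'s \<Rightarrow> nat"
  assumes m: "\<And>j. j \<in> v \<Longrightarrow> m j \<in> L2_idx (k j)"
begin

text \<open>The kernels of the coordinate \<open>j\<close>. For \<open>j \<in> u - v\<close> the localization index is 0 and only one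
antiderivative is used. \<open>Bn\<close> approximates the Walsh factor times \<open>\<phi>\<close>, and \<open>Pn\<close> and \<open>Vn\<close>
are what it becomes after one and two integrations.\<close>
definition wj where "wj j = loc_wal (k j) (if j \<in> v then m j else 0)"
definition Wj where "Wj j = cum_wal (k j) (if j \<in> v then m j else 0)"
definition W2j where "W2j j = cum2_wal (k j) (m j)"
definition Pn where "Pn n j = (if j \<in> v then cutP (Wj j) (W2j j) n else cutQ (Wj j) n)"
definition Bn where "Bn n j = (if j \<in> v then cutB (wj j) (Wj j) (W2j j) n else cutB1 (wj j) (Wj j) n)"
definition Vn where "Vn n j = cutV (W2j j) n"
text \<open>Large enough for both kinds of coordinates in the uniform bounds on the truncated kernels.\<close>
definition Kb where "Kb j = 85 * (2 powr (real (a2 j) / 2)) + 7"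

lemma v_data:
  assumes j: "j \<in> v"
  shows "(Vn n j has_real_derivative Pn n j x * \<phi> x) (at x)"
    "continuous_on UNIV (Pn n j)"
    "\<Phi> x \<notin> wal_nodes (a1 j) \<Longrightarrow> (Pn n j has_real_derivative Bn n j x) (at x)"
    "Bn n j \<in> borel_measurable borel"
    "\<bar>Bn n j x\<bar> \<le> Kb j * \<phi> x"
    "(\<lambda>n. Bn n j x) \<longlonglongrightarrow> wj j (\<Phi> x) * \<phi> x"
    "\<bar>Vn n j x\<bar> \<le> \<bar>W2j j (\<Phi> x)\<bar>"
proof -
  note kj = kv[OF j]
  note d = Walsh_N2_data[OF kj] and b = cum2_wal_bound[OF kj m[OF j]]
  note * = cutV_facts[where w="wj j" and W="Wj j" and ?W2.0="W2j j" and X="wal_nodes (a1 j)" and A="2 powr (real (a2 j) / 2)"]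
  have eq: "wj j = loc_wal (k j) (m j)" "Wj j = cum_wal (k j) (m j)" "W2j j = cum2_wal (k j) (m j)"
      "Pn n j = cutP (Wj j) (W2j j) n" "Bn n j = cutB (wj j) (Wj j) (W2j j) n" "Vn n j = cutV (W2j j) n" for n
    using j by (auto simp: wj_def Wj_def W2j_def Pn_def Bn_def Vn_def)
  show "(Vn n j has_real_derivative Pn n j x * \<phi> x) (at x)"
    unfolding eq(4-6) by (rule *) (use d b finite_wal_nodes in \<open>auto simp: eq(1-3)\<close>)
  show "continuous_on UNIV (Pn n j)"
    unfolding eq(4-6) by (rule *) (use d b finite_wal_nodes in \<open>auto simp: eq(1-3)\<close>)
  show "(Pn n j has_real_derivative Bn n j x) (at x)" if "\<Phi> x \<notin> wal_nodes (a1 j)"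
    unfolding eq(4-6) by (rule *) (use d b finite_wal_nodes that in \<open>auto simp: eq(1-3)\<close>)
  show "Bn n j \<in> borel_measurable borel"
    unfolding eq(4-6) by (rule *) (use d b finite_wal_nodes in \<open>auto simp: eq(1-3)\<close>)
  have "\<bar>Bn n j x\<bar> \<le> 85 * 2 powr (real (a2 j) / 2) * \<phi> x"
    unfolding eq(4-6) by (rule *) (use d b finite_wal_nodes in \<open>auto simp: eq(1-3)\<close>)
  also have "\<dots> \<le> Kb j * \<phi> x" using \<phi>_pos[of x] by (intro mult_right_mono) (auto simp: Kb_def)
  finally show "\<bar>Bn n j x\<bar> \<le> Kb j * \<phi> x" .
  show "(\<lambda>n. Bn n j x) \<longlonglongrightarrow> wj j (\<Phi> x) * \<phi> x"
    unfolding eq(4-6) by (rule *) (use d b finite_wal_nodes in \<open>auto simp: eq(1-3)\<close>)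
  show "\<bar>Vn n j x\<bar> \<le> \<bar>W2j j (\<Phi> x)\<bar>"
    unfolding eq(4-6) by (rule *) (use d b finite_wal_nodes in \<open>auto simp: eq(1-3)\<close>)
qed

lemma uv_data:
  assumes j: "j \<in> u - v"
  shows "continuous_on UNIV (Pn n j)"
    "\<Phi> x \<notin> wal_nodes (a1 j) \<Longrightarrow> (Pn n j has_real_derivative Bn n j x) (at x)"
    "Bn n j \<in> borel_measurable borel"
    "\<bar>Bn n j x\<bar> \<le> Kb j * \<phi> x"
    "(\<lambda>n. Bn n j x) \<longlonglongrightarrow> wj j (\<Phi> x) * \<phi> x"
    "\<bar>Pn n j x\<bar> \<le> 1 / 2 * (1 / 2 ^ a1 j)"
proof -
  note kj = ku[OF j]
  note d = Walsh_N1_data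
  note * = cutQ_facts[where w="wj j" and W="Wj j" and X="wal_nodes (a1 j)" and A="1"]
  have eq: "wj j = loc_wal (2 ^ a1 j) 0" "Wj j = cum_wal (2 ^ a1 j) 0"
      "Pn n j = cutQ (Wj j) n" "Bn n j = cutB1 (wj j) (Wj j) n" for n
    using j kj by (auto simp: wj_def Wj_def Pn_def Bn_def)
  show "continuous_on UNIV (Pn n j)"
    unfolding eq(3,4) by (rule *) (use d finite_wal_nodes in \<open>auto simp: eq(1-2)\<close>)
  show "(Pn n j has_real_derivative Bn n j x) (at x)" if "\<Phi> x \<notin> wal_nodes (a1 j)"
    unfolding eq(3,4) by (rule *) (use d finite_wal_nodes that in \<open>auto simp: eq(1-2)\<close>)
  show "Bn n j \<in> borel_measurable borel"
    unfolding eq(3,4) by (rule *) (use d finite_wal_nodes in \<open>auto simp: eq(1-2)\<close>)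
  have "\<bar>Bn n j x\<bar> \<le> 7 * 1 * \<phi> x"
    unfolding eq(3,4) by (rule *) (use d finite_wal_nodes in \<open>auto simp: eq(1-2)\<close>)
  also have "\<dots> \<le> Kb j * \<phi> x" using \<phi>_pos[of x] by (intro mult_right_mono) (auto simp: Kb_def)
  finally show "\<bar>Bn n j x\<bar> \<le> Kb j * \<phi> x" .
  show "(\<lambda>n. Bn n j x) \<longlonglongrightarrow> wj j (\<Phi> x) * \<phi> x"
    unfolding eq(3,4) by (rule *) (use d finite_wal_nodes in \<open>auto simp: eq(1-2)\<close>)
  have "\<bar>Pn n j x\<bar> \<le> \<bar>Wj j (\<Phi> x)\<bar>"
    unfolding eq(3,4) by (rule *) (use d finite_wal_nodes in \<open>auto simp: eq(1-2)\<close>)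
  also have "\<dots> \<le> 1 / 2 * (1 / 2 ^ a1 j)" unfolding eq(2) by (rule d(6)[OF CDF_range])
  finally show "\<bar>Pn n j x\<bar> \<le> 1 / 2 * (1 / 2 ^ a1 j)" .
qed

lemma u_data:
  assumes j: "j \<in> u"
  shows "continuous_on UNIV (Pn n j)"
    "\<Phi> x \<notin> wal_nodes (a1 j) \<Longrightarrow> (Pn n j has_real_derivative Bn n j x) (at x)"
    "Bn n j \<in> borel_measurable borel"
    "\<bar>Bn n j x\<bar> \<le> Kb j * \<phi> x"
    "(\<lambda>n. Bn n j x) \<longlonglongrightarrow> wj j (\<Phi> x) * \<phi> x"
  using v_data[of j] uv_data[of j] j by (cases "j \<in> v"; auto)+

lemma support:
  "\<exists>R>0. \<forall>x. R \<le> \<bar>x\<bar> \<longrightarrow> (\<forall>j. Pn n j x = 0 \<and> Bn n j x = 0 \<and> Vn n j x = 0)"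
proof -
  obtain R where "0 < R" "\<forall>x. R \<le> \<bar>x\<bar> \<longrightarrow> \<Phi> x * (1 - \<Phi> x) \<le> 1 / real (Suc n)"
    using CDF_tails[of "1 / real (Suc n)"] by auto
  then show ?thesis
    by (intro exI[of _ R]) (auto simp: Pn_def Bn_def Vn_def cut_zero)
qed

lemma Pn_bounded:
  assumes "j \<in> u"
  shows "\<exists>B\<ge>0. \<forall>t. \<bar>Pn n j t\<bar> \<le> B"
proof -
  obtain R where "0 < R" "\<And>x. R \<le> \<bar>x\<bar> \<Longrightarrow> Pn n j x = 0" using support[of n] by blast
  with continuous_bounded_support[OF u_data(1)[OF assms]] show ?thesis by blast
qed

lemma inner_integrable_times_Pn:
  assumes "w \<subseteq> v" "S \<subseteq> u"
  shows "integrable lborel (\<lambda>x. indicator {x. \<forall>j\<in>u. \<bar>x $ j\<bar> \<le> R} x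
    * (mixed_deriv w u F x * (\<Prod>j\<in>UNIV - u. \<phi> (x $ j))) * (\<Prod>j\<in>S. Pn n j (x $ j)))"
proof -
  have "\<forall>j\<in>u. \<exists>B\<ge>0. \<forall>t. \<bar>Pn n j t\<bar> \<le> B" using Pn_bounded by blast
  then obtain B where B: "\<And>j. j \<in> u \<Longrightarrow> B j \<ge> 0 \<and> (\<forall>t. \<bar>Pn n j t\<bar> \<le> B j)" by metis
  show ?thesis
  proof (rule integrable_mult_bounded[OF inner_integrable[OF assms(1)]])
    show "(\<lambda>x. \<Prod>j\<in>S. Pn n j (x $ j)) \<in> borel_measurable lborel"
    proof (rule borel_measurable_prod)
      show "(\<lambda>x. Pn n j (x $ j)) \<in> borel_measurable lborel" if "j \<in> S" for j
      proof -
        have "j \<in> u" using that assms by auto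
        then have "Pn n j \<in> borel_measurable borel"
          by (intro borel_measurable_continuous_onI u_data(1))
        then show ?thesis by (rule measurable_compose[rotated]) measurable
      qed
    qed
    show "\<bar>\<Prod>j\<in>S. Pn n j (x $ j)\<bar> \<le> (\<Prod>j\<in>S. B j)" for x :: "real ^ 's"
      unfolding abs_prod using B assms by (intro prod_mono) auto
  qed
qed

definition truncated_coeff where "truncated_coeff n = (LINT x|lborel. F x * (\<Prod>j\<in>u. Bn n j (x $ j)) * (\<Prod>j\<in>UNIV - u. \<phi> (x $ j)))"

lemma Kb_nonneg: "0 \<le> Kb j" by (simp add: Kb_def)

lemma truncated_coeff_bound:
  "\<bar>F x * (\<Prod>j\<in>u. Bn n j (x $ j)) * (\<Prod>j\<in>UNIV - u. \<phi> (x $ j))\<bar> \<le> \<bar>(\<Prod>j\<in>u. Kb j) * (F x * (\<Prod>j\<in>UNIV. \<phi> (x $ j)))\<bar>"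
proof -
  have P: "0 \<le> (\<Prod>j\<in>A. \<phi> (x $ j))" for A using \<phi>_pos by (intro prod_nonneg) (auto simp: less_imp_le)
  have "\<bar>\<Prod>j\<in>u. Bn n j (x $ j)\<bar> \<le> (\<Prod>j\<in>u. Kb j * \<phi> (x $ j))"
    unfolding abs_prod using u_data(4) by (intro prod_mono) auto
  also have "\<dots> = (\<Prod>j\<in>u. Kb j) * (\<Prod>j\<in>u. \<phi> (x $ j))" by (rule prod.distrib)
  finally have "\<bar>\<Prod>j\<in>u. Bn n j (x $ j)\<bar> * (\<bar>F x\<bar> * (\<Prod>j\<in>UNIV - u. \<phi> (x $ j))) \<le>
      (\<Prod>j\<in>u. Kb j) * (\<Prod>j\<in>u. \<phi> (x $ j)) * (\<bar>F x\<bar> * (\<Prod>j\<in>UNIV - u. \<phi> (x $ j)))"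
    using P by (intro mult_right_mono) auto
  moreover have "0 \<le> (\<Prod>j\<in>u. Kb j)" by (intro prod_nonneg) (auto simp: Kb_nonneg)
  ultimately show ?thesis using P by (simp add: abs_mult split_prod mult_ac)
qed

lemma truncated_coeff_measurable: "(\<lambda>x. F x * (\<Prod>j\<in>u. Bn n j (x $ j)) * (\<Prod>j\<in>UNIV - u. \<phi> (x $ j))) \<in> borel_measurable lborel"
proof (intro borel_measurable_times borel_measurable_prod)
  show "F \<in> borel_measurable lborel" using L2 by (simp add: in_L2_def)
  show "(\<lambda>x. Bn n j (x $ j)) \<in> borel_measurable lborel" if "j \<in> u" for j
    by (rule measurable_compose[OF _ u_data(3)[OF that]]) measurable
  show "(\<lambda>x. \<phi> (x $ j)) \<in> borel_measurable lborel" for j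
    by (rule measurable_compose[OF _ \<phi>_meas]) measurable
qed

text \<open>The truncated kernels stay below \<open>Kb j * \<phi>\<close>, and \<open>F\<close> is integrable against the density, so
dominated convergence applies.\<close>
lemma coeff_limit: "truncated_coeff \<longlonglongrightarrow> loc_wal_coeff \<phi> F u v k m"
proof -
  have eq: "loc_wal_coeff \<phi> F u v k m =
      (LINT x|lborel. F x * (\<Prod>j\<in>u. wj j (\<Phi> (x $ j)) * \<phi> (x $ j)) * (\<Prod>j\<in>UNIV - u. \<phi> (x $ j)))"
    unfolding loc_wal_coeff_def
  proof (rule Bochner_Integration.integral_cong[OF refl])
    fix x :: "real ^ 's"
    have "(\<Prod>j\<in>u. wj j (\<Phi> (x $ j))) = (\<Prod>j\<in>u - v. wj j (\<Phi> (x $ j))) * (\<Prod>j\<in>v. wj j (\<Phi> (x $ j)))"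
      using vu by (intro prod.subset_diff) auto
    also have "(\<Prod>j\<in>u - v. wj j (\<Phi> (x $ j))) = (\<Prod>j\<in>u - v. loc_wal (k j) 0 (\<Phi> (x $ j)))"
      by (intro prod.cong) (auto simp: wj_def)
    also have "(\<Prod>j\<in>v. wj j (\<Phi> (x $ j))) = (\<Prod>j\<in>v. loc_wal (k j) (m j) (\<Phi> (x $ j)))"
      by (intro prod.cong) (auto simp: wj_def)
    finally show "F x * (\<Prod>j\<in>v. loc_wal (k j) (m j) (\<Phi> (x $ j))) * (\<Prod>j\<in>u - v. loc_wal (k j) 0 (\<Phi> (x $ j))) * (\<Prod>j\<in>UNIV. \<phi> (x $ j))
        = F x * (\<Prod>j\<in>u. wj j (\<Phi> (x $ j)) * \<phi> (x $ j)) * (\<Prod>j\<in>UNIV - u. \<phi> (x $ j))"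
      by (simp add: prod.distrib split_prod mult_ac)
  qed
  have lim: "(\<lambda>n. F x * (\<Prod>j\<in>u. Bn n j (x $ j)) * (\<Prod>j\<in>UNIV - u. \<phi> (x $ j)))
      \<longlonglongrightarrow> F x * (\<Prod>j\<in>u. wj j (\<Phi> (x $ j)) * \<phi> (x $ j)) * (\<Prod>j\<in>UNIV - u. \<phi> (x $ j))" for x
    by (intro tendsto_intros u_data(5))
  show ?thesis unfolding eq truncated_coeff_def
  proof (rule integral_dominated_convergence[where w="\<lambda>x. \<bar>(\<Prod>j\<in>u. Kb j) * (F x * (\<Prod>j\<in>UNIV. \<phi> (x $ j)))\<bar>"])
    show "(\<lambda>x. F x * (\<Prod>j\<in>u. wj j (\<Phi> (x $ j)) * \<phi> (x $ j)) * (\<Prod>j\<in>UNIV - u. \<phi> (x $ j))) \<in> borel_measurable lborel"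
      by (rule borel_measurable_LIMSEQ_real[OF lim truncated_coeff_measurable])
    show "integrable lborel (\<lambda>x. \<bar>(\<Prod>j\<in>u. Kb j) * (F x * (\<Prod>j\<in>UNIV. \<phi> (x $ j)))\<bar>)"
      by (intro integrable_abs integrable_mult_right F\<phi>_integrable)
  qed (use truncated_coeff_measurable lim truncated_coeff_bound in auto)
qed

text \<open>The compact support of \<open>Pn\<close> in every coordinate of \<open>u\<close> makes the local integrability of the mixed
derivative sufficient.\<close>
lemma integration_by_parts_first:
  "truncated_coeff n = (-1) ^ card u * (LINT x|lborel. mixed_deriv {} u F x * (\<Prod>j\<in>u. Pn n j (x $ j)) * (\<Prod>j\<in>UNIV - u. \<phi> (x $ j)))"
proof -
  obtain R where R: "0 < R" "\<And>j x. R \<le> \<bar>x\<bar> \<Longrightarrow> Pn n j x = 0 \<and> Bn n j x = 0 \<and> Vn n j x = 0"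
    using support[of n] by blast
  show ?thesis unfolding truncated_coeff_def
  proof (rule smooth_integration_by_parts[OF smooth R(1), where X="\<lambda>j. {x. \<Phi> x \<in> wal_nodes (a1 j)}"])
    show "continuous_on UNIV \<phi>" by (rule \<phi>_cont)
    show "continuous_on UNIV (Pn n j)" if "j \<in> u" for j by (rule u_data(1)[OF that])
    show "finite {x. \<Phi> x \<in> wal_nodes (a1 j)}" for j by (rule finite_preimage[OF finite_wal_nodes])
    show "(Pn n j has_real_derivative Bn n j t) (at t)" if "j \<in> u" "t \<notin> {x. \<Phi> x \<in> wal_nodes (a1 j)}" for j t
      using that by (intro u_data(2)) auto
    show "Bn n j \<in> borel_measurable borel" if "j \<in> u" for j by (rule u_data(3)[OF that])
    show "\<exists>B. \<forall>t. \<bar>Bn n j t\<bar> \<le> B" if j: "j \<in> u" for j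
    proof -
      obtain A where A: "\<forall>t\<in>{-R..R}. \<bar>\<phi> t\<bar> \<le> A" using continuous_bounded_on_Icc[OF \<phi>_cont, of R] by blast
      have "\<bar>Bn n j t\<bar> \<le> Kb j * \<bar>A\<bar>" for t
      proof (cases "t \<in> {-R..R}")
        case True
        then have "\<phi> t \<le> \<bar>A\<bar>" using A by force
        then have "Kb j * \<phi> t \<le> Kb j * \<bar>A\<bar>" using Kb_nonneg by (rule mult_left_mono)
        then show ?thesis using u_data(4)[OF j, of n t] by linarith
      next
        case False
        then have "R \<le> \<bar>t\<bar>" by auto
        then show ?thesis using R(2) Kb_nonneg by simp
      qed
      then show ?thesis by blast
    qed
    show "Bn n j t = 0" "Pn n j t = 0" if "R \<le> \<bar>t\<bar>" for j t using R(2)[OF that] by auto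
    show "integrable lborel (\<lambda>x. F x * (\<Prod>j\<in>u. Bn n j (x $ j)) * (\<Prod>j\<in>UNIV - u. \<phi> (x $ j)))"
      by (rule Bochner_Integration.integrable_bound[OF integrable_mult_right[OF F\<phi>_integrable, of "\<Prod>j\<in>u. Kb j"] truncated_coeff_measurable])
         (use truncated_coeff_bound in auto)
    show "integrable lborel (\<lambda>x. mixed_deriv {} u F x * (\<Prod>j\<in>u. Pn n j (x $ j)) * (\<Prod>j\<in>UNIV - u. \<phi> (x $ j)))"
    proof -
      have "integrable lborel (\<lambda>x. indicator {x. \<forall>j\<in>u. \<bar>x $ j\<bar> \<le> R} x * (mixed_deriv {} u F x * (\<Prod>j\<in>UNIV - u. \<phi> (x $ j)))
          * (\<Prod>j\<in>u. Pn n j (x $ j)))"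
        by (rule inner_integrable_times_Pn) auto
      moreover have "indicator {x. \<forall>j\<in>u. \<bar>x $ j\<bar> \<le> R} x * (mixed_deriv {} u F x * (\<Prod>j\<in>UNIV - u. \<phi> (x $ j)))
          * (\<Prod>j\<in>u. Pn n j (x $ j)) = mixed_deriv {} u F x * (\<Prod>j\<in>u. Pn n j (x $ j)) * (\<Prod>j\<in>UNIV - u. \<phi> (x $ j))" for x :: "real ^ 's"
      proof (cases "\<forall>j\<in>u. \<bar>x $ j\<bar> \<le> R")
        case False
        then obtain j where "j \<in> u" "R \<le> \<bar>x $ j\<bar>" by force
        then have "(\<Prod>j\<in>u. Pn n j (x $ j)) = 0" using R(2) by (intro prod_zero) auto
        then show ?thesis by simp
      qed simp
      ultimately show ?thesis by simp
    qed
  qed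
qed

text \<open>With \<open>\<rho> = 1 / \<phi>\<close> the kernel \<open>V' * \<rho>\<close> is exactly \<open>Pn\<close>, the kernel left by the first
integration by parts.\<close>
lemma rough_ibp_instance:
  assumes R: "0 < R" "\<And>j x. R \<le> \<bar>x\<bar> \<Longrightarrow> Pn n j x = 0 \<and> Bn n j x = 0 \<and> Vn n j x = 0"
  shows "rough_ibp v (\<lambda>w. mixed_deriv w u F) rho rho' (Vn n) (\<lambda>j x. Pn n j x * \<phi> x)
    (\<lambda>j. if j \<in> u then Pn n j else \<phi>) R"
proof
  show "0 < R" by (rule R)
  show "mixed_deriv w u F \<in> borel_measurable borel" if "w \<subseteq> v" for w by (rule D_meas[OF that])
  show "((\<lambda>t. mixed_deriv w u F (x + t *\<^sub>R axis i 1)) has_real_derivative mixed_deriv (insert i w) u F (x + t *\<^sub>R axis i 1)) (at t)"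
    if "i \<notin> w" "insert i w \<subseteq> v" for i w x t
    using that vu by (intro mixed_deriv_DERIV smooth) auto
  show "(rho has_real_derivative rho' t) (at t)" for t by (rule rho_DERIV)
  show "rho' \<in> borel_measurable borel" by (rule rho'_meas)
  show "(Vn n j has_real_derivative Pn n j t * \<phi> t) (at t)" if "j \<in> v" for j t by (rule v_data(1)[OF that])
  show "continuous_on UNIV (\<lambda>x. Pn n j x * \<phi> x)" if "j \<in> v" for j
    by (intro continuous_on_mult v_data(2)[OF that] \<phi>_cont)
  show "Vn n j t = 0" "Pn n j t * \<phi> t = 0" if "R \<le> \<bar>t\<bar>" for j t using R(2)[OF that] by auto
  show "(if j \<in> u then Pn n j else \<phi>) \<in> borel_measurable borel" for j
    using u_data(1)[of j n] \<phi>_meas by (auto intro: borel_measurable_continuous_onI)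
  show "integrable lborel (\<lambda>x. mixed_deriv w u F x * (\<Prod>j\<in>v. indicator {-R..R} (x $ j)) *
      (\<Prod>j\<in>UNIV - v. (if j \<in> u then Pn n j else \<phi>) (x $ j)))" if w: "w \<subseteq> v" for w
  proof -
    have "integrable lborel (\<lambda>x. indicator {x. \<forall>j\<in>u. \<bar>x $ j\<bar> \<le> R} x * (mixed_deriv w u F x * (\<Prod>j\<in>UNIV - u. \<phi> (x $ j)))
        * (\<Prod>j\<in>u - v. Pn n j (x $ j)))"
      by (rule inner_integrable_times_Pn[OF w]) auto
    moreover have "indicator {x. \<forall>j\<in>u. \<bar>x $ j\<bar> \<le> R} x * (mixed_deriv w u F x * (\<Prod>j\<in>UNIV - u. \<phi> (x $ j)))
        * (\<Prod>j\<in>u - v. Pn n j (x $ j)) = mixed_deriv w u F x * (\<Prod>j\<in>v. indicator {-R..R} (x $ j)) *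
      (\<Prod>j\<in>UNIV - v. (if j \<in> u then Pn n j else \<phi>) (x $ j))" for x :: "real ^ 's"
    proof -
      have "(\<Prod>j\<in>UNIV - v. (if j \<in> u then Pn n j else \<phi>) (x $ j)) =
          (\<Prod>j\<in>(UNIV - v) - (u - v). (if j \<in> u then Pn n j else \<phi>) (x $ j)) * (\<Prod>j\<in>u - v. (if j \<in> u then Pn n j else \<phi>) (x $ j))"
        by (rule prod.subset_diff) auto
      also have "(UNIV - v) - (u - v) = UNIV - u" using vu by auto
      finally have sp: "(\<Prod>j\<in>UNIV - v. (if j \<in> u then Pn n j else \<phi>) (x $ j)) = (\<Prod>j\<in>UNIV - u. \<phi> (x $ j)) * (\<Prod>j\<in>u - v. Pn n j (x $ j))"
        by simp
      show ?thesis
      proof (cases "\<forall>j\<in>u - v. \<bar>x $ j\<bar> \<le> R")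
        case False
        then obtain j where "j \<in> u - v" "R \<le> \<bar>x $ j\<bar>" by force
        then have "(\<Prod>j\<in>u - v. Pn n j (x $ j)) = 0" using R(2) by (intro prod_zero) auto
        then show ?thesis unfolding sp by simp
      next
        case True
        have "(\<Prod>j\<in>v. indicator {-R..R} (x $ j)) = (indicator {x. \<forall>j\<in>u. \<bar>x $ j\<bar> \<le> R} x :: real)"
        proof (cases "\<forall>j\<in>v. \<bar>x $ j\<bar> \<le> R")
          case T: True
          then have "(\<Prod>j\<in>v. indicator {-R..R} (x $ j)) = (1::real)"
            by (intro prod.neutral) (auto simp: indicator_def abs_le_iff minus_le_iff)
          moreover have "\<forall>j\<in>u. \<bar>x $ j\<bar> \<le> R" using T True by blast
          ultimately show ?thesis by simp
        next
          case N: False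
          then obtain j where j: "j \<in> v" "R < \<bar>x $ j\<bar>" by force
          then have "(\<Prod>j\<in>v. indicator {-R..R} (x $ j)) = (0::real)"
            by (intro prod_zero) (auto simp: indicator_def intro!: bexI[of _ j])
          moreover have "\<not> (\<forall>j\<in>u. \<bar>x $ j\<bar> \<le> R)" using j vu by force
          ultimately show ?thesis by simp
        qed
        then show ?thesis unfolding sp by (simp add: mult_ac)
      qed
    qed
    ultimately show ?thesis by simp
  qed
qed

end

end

section \<open>The bound for a single coefficient\<close>

lemma norm_integral_le_nn_integral:
  fixes f :: "'a \<Rightarrow> real"
  shows "ennreal \<bar>integral\<^sup>L M f\<bar> \<le> (\<integral>\<^sup>+ x. ennreal \<bar>f x\<bar> \<partial>M)"
  using integral_norm_bound_ennreal[of M f] not_integrable_integral_eq[of M f]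
  by (cases "integrable M f") auto

context walsh_setting begin

lemma cum2_comp_meas:
  assumes "j \<in> v"
  shows "(\<lambda>x. cum2_wal (k j) m (\<Phi> x)) \<in> borel_measurable borel"
  by (rule comp_meas) (rule DERIV_isCont[OF Walsh_N2_data(6)[OF kv[OF assms]]])

definition bound_density where
  "bound_density m w y = \<bar>density_deriv w y\<bar> *
    ((\<Prod>j\<in>v. \<bar>cum2_wal (k j) (m j) (\<Phi> (y j))\<bar> * \<bar>if j \<in> w then rho (y j) else rho' (y j)\<bar>)
      * (\<Prod>j\<in>u - v. 1 / 2 * (1 / 2 ^ a1 j)))"

lemma bound_density_meas:
  assumes "w \<subseteq> v"
  shows "bound_density m w \<in> borel_measurable (LP u)"
proof -
  have "(\<lambda>y. \<Prod>j\<in>v. \<bar>cum2_wal (k j) (m j) (\<Phi> (y j))\<bar> * \<bar>if j \<in> w then rho (y j) else rho' (y j)\<bar>) \<in> borel_measurable (LP u)"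
  proof (rule borel_measurable_prod)
    fix j assume j: "j \<in> v"
    have "(\<lambda>x. \<bar>cum2_wal (k j) (m j) (\<Phi> x)\<bar> * \<bar>if j \<in> w then rho x else rho' x\<bar>) \<in> borel_measurable borel"
      using cum2_comp_meas[OF j, of "m j"] rho_meas rho'_meas by (cases "j \<in> w") simp_all
    from measurable_compose[OF LP_component_measurable this, of j u]
    show "(\<lambda>y. \<bar>cum2_wal (k j) (m j) (\<Phi> (y j))\<bar> * \<bar>if j \<in> w then rho (y j) else rho' (y j)\<bar>) \<in> borel_measurable (LP u)"
      using j vu by auto
  qed
  then show ?thesis unfolding bound_density_def[abs_def] using density_deriv_meas[OF assms]
    by (intro borel_measurable_times borel_measurable_abs) auto
qed

text \<open>If \<open>coeff_bound m\<close> is infinite there is nothing to prove. Otherwise the integrand \<open>T v\<close> produced by the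
product rule is integrable, so the second integration by parts is available and expresses the truncated
coefficient through \<open>T v\<close>. Passing from \<open>v\<close> to \<open>u\<close>, the coordinates in \<open>u - v\<close>
are moved out of the inner integral by Fubini.\<close>
lemma truncated_coeff_le:
  assumes m: "\<And>j. j \<in> v \<Longrightarrow> m j \<in> L2_idx (k j)"
  shows "ennreal \<bar>truncated_coeff m n\<bar> \<le> coeff_bound m"
proof -
  obtain R where R: "0 < R" "\<And>j x. R \<le> \<bar>x\<bar> \<Longrightarrow> Pn m n j x = 0 \<and> Bn m n j x = 0 \<and> Vn m n j x = 0"
    using support[OF m, of n] by blast
  interpret RI: rough_ibp v "\<lambda>w. mixed_deriv w u F" rho rho' "Vn m n" "\<lambda>j x. Pn m n j x * \<phi> x"
    "\<lambda>j. if j \<in> u then Pn m n j else \<phi>" R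
    by (rule rough_ibp_instance[OF m R])
  interpret PS: product_sigma_finite "\<lambda>_. lborel :: real measure" by (rule product_sigma_finite_lborel)
  have K: "RI.K j t = (if j \<in> u then Pn m n j t else \<phi> t)" for j t
    using \<phi>_pos[of t] vu by (auto simp: RI.K_def rho_def)
  have KU: "(\<Prod>j\<in>UNIV. RI.K j (x $ j)) = (\<Prod>j\<in>u. Pn m n j (x $ j)) * (\<Prod>j\<in>UNIV - u. \<phi> (x $ j))" for x :: "real ^ 's"
    unfolding K split_prod by simp
  have part: "(\<integral>\<^sup>+ y. ennreal (\<bar>RI.c v w y\<bar> * \<bar>RI.G v w y\<bar>) \<partial>LP v) \<le> (\<integral>\<^sup>+ y. ennreal (bound_density m w y) \<partial>LP u)"
    if w: "w \<subseteq> v" for w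
  proof -
    have uv: "v \<union> (u - v) = u" "v \<inter> (u - v) = {}" using vu by auto
    have U: "UNIV - v = (u - v) \<union> (UNIV - u)" "(u - v) \<inter> (UNIV - u) = {}" using vu by auto
    have mm: "merge v (u - v) \<in> measurable (LP v \<Otimes>\<^sub>M LP (u - v)) (LP u)"
      using measurable_merge[of v "u - v" "\<lambda>_. lborel :: real measure"] unfolding uv(1) .
    have fold: "(\<integral>\<^sup>+ y. ennreal (bound_density m w y) \<partial>LP u) =
        (\<integral>\<^sup>+ y. (\<integral>\<^sup>+ y'. ennreal (bound_density m w (merge v (u - v) (y, y'))) \<partial>LP (u - v)) \<partial>LP v)"
      using PS.product_nn_integral_fold[OF uv(2), of "\<lambda>y. ennreal (bound_density m w y)"] bound_density_meas[OF w, of m]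
      unfolding uv(1) by simp
    let ?E = "\<lambda>y z. mixed_deriv w u F (join v y z) * (\<Prod>j\<in>UNIV - v. RI.K j (z j))"
    have AEy: "AE y in LP v. integrable (LP (UNIV - v)) (\<lambda>z. (\<Prod>j\<in>v. indicator {-R..R} (y j)) * ?E y z)"
    proof -
      interpret S1: sigma_finite_measure "LP v" by (rule sigma_finite_LP) simp
      interpret S2: sigma_finite_measure "LP (UNIV - v)" by (rule sigma_finite_LP) simp
      interpret Q: pair_sigma_finite "LP v" "LP (UNIV - v)" ..
      let ?h = "\<lambda>x. mixed_deriv w u F x * (\<Prod>j\<in>v. indicator {-R..R} (x $ j)) * (\<Prod>j\<in>UNIV - v. RI.K j (x $ j))"
      have "integrable (distr (LP v \<Otimes>\<^sub>M LP (UNIV - v)) borel (\<lambda>(y, z). join v y z)) ?h"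
        unfolding distr_join by (rule RI.int_K[OF order_refl w])
      then have "integrable (LP v \<Otimes>\<^sub>M LP (UNIV - v)) (\<lambda>p. ?h ((\<lambda>(y, z). join v y z) p))"
        by (rule integrable_distr[OF join_measurable])
      moreover have "?h ((\<lambda>(y, z). join v y z) p) = (\<lambda>(y, z). (\<Prod>j\<in>v. indicator {-R..R} (y j)) * ?E y z) p" for p
        by (cases p) (simp add: join_def mult_ac)
      ultimately have "integrable (LP v \<Otimes>\<^sub>M LP (UNIV - v)) (\<lambda>(y, z). (\<Prod>j\<in>v. indicator {-R..R} (y j)) * ?E y z)"
        by simp
      from Q.AE_integrable_fst'[OF this] show ?thesis by simp
    qed
    have "AE y in LP v. ennreal (\<bar>RI.c v w y\<bar> * \<bar>RI.G v w y\<bar>) \<le>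
        (\<integral>\<^sup>+ y'. ennreal (bound_density m w (merge v (u - v) (y, y'))) \<partial>LP (u - v))"
      using AEy AE_space
    proof eventually_elim
      case (elim y)
      show ?case
      proof (cases "\<forall>j\<in>v. y j \<in> {-R..R}")
        case False
        then obtain j where j: "j \<in> v" "R \<le> \<bar>y j\<bar>" by fastforce
        then have "Vn m n j (y j) = 0" using R(2) by auto
        then have "RI.c v w y = 0"
          using j by (cases "j \<in> w") (auto simp: RI.c_def intro!: prod_zero)
        then show ?thesis by simp
      next
        case True
        have box: "(\<Prod>j\<in>v. indicator {-R..R} (y j)) = (1::real)" using True by (intro prod.neutral) auto
        have iE: "integrable (LP ((u - v) \<union> (UNIV - u))) (?E y)"
          using elim(1) by (simp add: box U(1)[symmetric])
        have EE: "?E y (merge (u - v) (UNIV - u) (y', z)) =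
            (\<Prod>j\<in>u - v. Pn m n j (y' j)) * (mixed_deriv w u F (join u (merge v (u - v) (y, y')) z) * (\<Prod>j\<in>UNIV - u. \<phi> (z j)))"
          for y' z
        proof -
          have J: "join v y (merge (u - v) (UNIV - u) (y', z)) = join u (merge v (u - v) (y, y')) z"
            using vu by (auto simp: join_def merge_def vec_eq_iff)
          have "(\<Prod>j\<in>UNIV - v. RI.K j (merge (u - v) (UNIV - u) (y', z) j)) =
              (\<Prod>j\<in>u - v. RI.K j (merge (u - v) (UNIV - u) (y', z) j)) * (\<Prod>j\<in>UNIV - u. RI.K j (merge (u - v) (UNIV - u) (y', z) j))"
            unfolding U(1) by (rule prod.union_disjoint) (use U(2) in auto)
          also have "(\<Prod>j\<in>u - v. RI.K j (merge (u - v) (UNIV - u) (y', z) j)) = (\<Prod>j\<in>u - v. Pn m n j (y' j))"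
            by (intro prod.cong) (auto simp: K merge_def)
          also have "(\<Prod>j\<in>UNIV - u. RI.K j (merge (u - v) (UNIV - u) (y', z) j)) = (\<Prod>j\<in>UNIV - u. \<phi> (z j))"
            by (intro prod.cong) (auto simp: K merge_def)
          finally show ?thesis unfolding J by (simp add: mult_ac)
        qed
        have "RI.G v w y = integral\<^sup>L (LP ((u - v) \<union> (UNIV - u))) (?E y)"
          unfolding RI.G_def U(1)[symmetric] ..
        also have "\<dots> = (LINT y'|LP (u - v). (LINT z|LP (UNIV - u). ?E y (merge (u - v) (UNIV - u) (y', z))))"
          by (rule PS.product_integral_fold[OF U(2) _ _ iE]) auto
        also have "\<dots> = (LINT y'|LP (u - v). (\<Prod>j\<in>u - v. Pn m n j (y' j)) * density_deriv w (merge v (u - v) (y, y')))"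
          unfolding EE density_deriv_def by simp
        finally have G: "RI.G v w y = (LINT y'|LP (u - v). (\<Prod>j\<in>u - v. Pn m n j (y' j)) * density_deriv w (merge v (u - v) (y, y')))" .
        have cb: "\<bar>RI.c v w y\<bar> \<le> (\<Prod>j\<in>v. \<bar>cum2_wal (k j) (m j) (\<Phi> (y j))\<bar> * \<bar>if j \<in> w then rho (y j) else rho' (y j)\<bar>)"
        proof -
          have "\<bar>RI.c v w y\<bar> = (\<Prod>j\<in>v. \<bar>Vn m n j (y j)\<bar> * \<bar>if j \<in> w then rho (y j) else rho' (y j)\<bar>)"
          proof -
            have "(\<Prod>j\<in>v. \<bar>Vn m n j (y j)\<bar> * \<bar>if j \<in> w then rho (y j) else rho' (y j)\<bar>) =
              (\<Prod>j\<in>v - w. \<bar>Vn m n j (y j)\<bar> * \<bar>if j \<in> w then rho (y j) else rho' (y j)\<bar>) *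
              (\<Prod>j\<in>w. \<bar>Vn m n j (y j)\<bar> * \<bar>if j \<in> w then rho (y j) else rho' (y j)\<bar>)"
              by (rule prod.subset_diff[OF w]) simp
            then show ?thesis by (simp add: RI.c_def abs_mult abs_prod mult.commute)
          qed
          also have "\<dots> \<le> (\<Prod>j\<in>v. \<bar>cum2_wal (k j) (m j) (\<Phi> (y j))\<bar> * \<bar>if j \<in> w then rho (y j) else rho' (y j)\<bar>)"
            using v_data(7)[OF m, of _ n] by (intro prod_mono conjI mult_right_mono mult_nonneg_nonneg) (auto simp: W2j_def[OF m])
          finally show ?thesis .
        qed
        have mg: "(\<lambda>y'. density_deriv w (merge v (u - v) (y, y'))) \<in> borel_measurable (LP (u - v))"
          using measurable_compose[OF measurable_compose[OF measurable_Pair1'[OF elim(2)] mm] density_deriv_meas[OF w]] .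
        have mP: "(\<lambda>y'. \<Prod>j\<in>u - v. Pn m n j (y' j)) \<in> borel_measurable (LP (u - v))"
          by (intro borel_measurable_prod measurable_compose[OF LP_component_measurable]
              borel_measurable_continuous_onI[OF uv_data(1)[OF m]])
        have "ennreal (\<bar>RI.c v w y\<bar> * \<bar>RI.G v w y\<bar>) = ennreal \<bar>RI.c v w y\<bar> * ennreal \<bar>RI.G v w y\<bar>"
          by (rule ennreal_mult) auto
        also have "\<dots> \<le> ennreal \<bar>RI.c v w y\<bar> * (\<integral>\<^sup>+ y'. ennreal \<bar>(\<Prod>j\<in>u - v. Pn m n j (y' j)) * density_deriv w (merge v (u - v) (y, y'))\<bar> \<partial>LP (u - v))"
          unfolding G by (intro mult_left_mono norm_integral_le_nn_integral) simp
        also have "\<dots> = (\<integral>\<^sup>+ y'. ennreal \<bar>RI.c v w y\<bar> * ennreal \<bar>(\<Prod>j\<in>u - v. Pn m n j (y' j)) * density_deriv w (merge v (u - v) (y, y'))\<bar> \<partial>LP (u - v))"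
          by (rule nn_integral_cmult[symmetric]) (use mg mP in measurable)
        also have "\<dots> \<le> (\<integral>\<^sup>+ y'. ennreal (bound_density m w (merge v (u - v) (y, y'))) \<partial>LP (u - v))"
        proof (rule nn_integral_mono)
          fix y' :: "'s \<Rightarrow> real"
          have yv: "merge v (u - v) (y, y') j = y j" if "j \<in> v" for j using that by (simp add: merge_def)
          have pb: "\<bar>\<Prod>j\<in>u - v. Pn m n j (y' j)\<bar> \<le> (\<Prod>j\<in>u - v. 1 / 2 * (1 / 2 ^ a1 j))"
            unfolding abs_prod using uv_data(6)[OF m] by (intro prod_mono) auto
          have "\<bar>RI.c v w y\<bar> * \<bar>(\<Prod>j\<in>u - v. Pn m n j (y' j)) * density_deriv w (merge v (u - v) (y, y'))\<bar> =
              \<bar>density_deriv w (merge v (u - v) (y, y'))\<bar> * (\<bar>RI.c v w y\<bar> * \<bar>\<Prod>j\<in>u - v. Pn m n j (y' j)\<bar>)"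
            by (simp add: abs_mult mult_ac)
          also have "\<dots> \<le> \<bar>density_deriv w (merge v (u - v) (y, y'))\<bar> *
            ((\<Prod>j\<in>v. \<bar>cum2_wal (k j) (m j) (\<Phi> (y j))\<bar> * \<bar>if j \<in> w then rho (y j) else rho' (y j)\<bar>) * (\<Prod>j\<in>u - v. 1 / 2 * (1 / 2 ^ a1 j)))"
            by (intro mult_left_mono mult_mono cb pb) (auto intro!: prod_nonneg)
          also have "\<dots> = bound_density m w (merge v (u - v) (y, y'))"
            unfolding bound_density_def
            by (intro arg_cong2[where f="(*)"] prod.cong refl) (auto simp: yv)
          finally show "ennreal \<bar>RI.c v w y\<bar> * ennreal \<bar>(\<Prod>j\<in>u - v. Pn m n j (y' j)) * density_deriv w (merge v (u - v) (y, y'))\<bar>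
              \<le> ennreal (bound_density m w (merge v (u - v) (y, y')))"
            by (simp add: ennreal_mult[symmetric] ennreal_leI)
        qed
        finally show ?thesis .
      qed
    qed
    then show ?thesis unfolding fold by (rule nn_integral_mono_AE)
  qed
  have Tle: "(\<integral>\<^sup>+ y. ennreal \<bar>RI.T v y\<bar> \<partial>LP v) \<le> coeff_bound m"
  proof -
    have "(\<integral>\<^sup>+ y. ennreal \<bar>RI.T v y\<bar> \<partial>LP v) \<le> (\<integral>\<^sup>+ y. (\<Sum>w\<in>Pow v. ennreal (\<bar>RI.c v w y\<bar> * \<bar>RI.G v w y\<bar>)) \<partial>LP v)"
    proof (rule nn_integral_mono)
      fix y
      have "\<bar>RI.T v y\<bar> \<le> (\<Sum>w\<in>Pow v. \<bar>RI.c v w y\<bar> * \<bar>RI.G v w y\<bar>)"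
        unfolding RI.T_def by (rule order_trans[OF sum_abs]) (simp add: abs_mult)
      then show "ennreal \<bar>RI.T v y\<bar> \<le> (\<Sum>w\<in>Pow v. ennreal (\<bar>RI.c v w y\<bar> * \<bar>RI.G v w y\<bar>))"
        by (subst sum_ennreal) (auto intro: ennreal_leI)
    qed
    also have "\<dots> = (\<Sum>w\<in>Pow v. \<integral>\<^sup>+ y. ennreal (\<bar>RI.c v w y\<bar> * \<bar>RI.G v w y\<bar>) \<partial>LP v)"
    proof (rule nn_integral_sum)
      fix w assume "w \<in> Pow v"
      then have "RI.c v w \<in> borel_measurable (LP v)" "RI.G v w \<in> borel_measurable (LP v)"
        using RI.c_meas[of v w] RI.G_meas[of w v] by auto
      then show "(\<lambda>y. ennreal (\<bar>RI.c v w y\<bar> * \<bar>RI.G v w y\<bar>)) \<in> borel_measurable (LP v)"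
        by measurable
    qed
    also have "\<dots> \<le> coeff_bound m"
      unfolding coeff_bound_def bound_density_def[symmetric] by (intro sum_mono part) auto
    finally show ?thesis .
  qed
  show ?thesis
  proof (cases "coeff_bound m = \<infinity>")
    case False
    have "integrable (LP v) (RI.T v)"
      using Tle False by (intro integrableI_bounded RI.T_meas) (auto simp: less_top top.not_eq_extremum)
    from RI.rough_integration_by_parts[OF order_refl this]
    have "\<bar>LINT y|LP v. RI.T v y\<bar> = \<bar>LINT x|lborel. mixed_deriv {} u F x * (\<Prod>j\<in>UNIV. RI.K j (x $ j))\<bar>"
      by (simp add: abs_mult power_abs)
    also have "\<dots> = \<bar>truncated_coeff m n\<bar>"
    proof -
      have "truncated_coeff m n = (-1) ^ card u * (LINT x|lborel. mixed_deriv {} u F x * (\<Prod>j\<in>u. Pn m n j (x $ j)) * (\<Prod>j\<in>UNIV - u. \<phi> (x $ j)))"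
        by (rule integration_by_parts_first) (rule m)
      then show ?thesis unfolding KU by (simp add: abs_mult power_abs mult.assoc)
    qed
    finally have "ennreal \<bar>truncated_coeff m n\<bar> = ennreal \<bar>LINT y|LP v. RI.T v y\<bar>" by simp
    also have "\<dots> \<le> (\<integral>\<^sup>+ y. ennreal \<bar>RI.T v y\<bar> \<partial>LP v)" by (rule norm_integral_le_nn_integral)
    finally show ?thesis using Tle by simp
  qed simp
qed

text \<open>The bound does not involve the truncation, so it survives the limit.\<close>
lemma coeff_le:
  assumes m: "\<And>j. j \<in> v \<Longrightarrow> m j \<in> L2_idx (k j)"
  shows "ennreal \<bar>loc_wal_coeff \<phi> F u v k m\<bar> \<le> coeff_bound m"
proof (rule Lim_bounded)
  show "(\<lambda>n. ennreal \<bar>truncated_coeff m n\<bar>) \<longlonglongrightarrow> ennreal \<bar>loc_wal_coeff \<phi> F u v k m\<bar>"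
    by (intro tendsto_ennrealI tendsto_rabs coeff_limit m)
  show "\<forall>n\<ge>0. ennreal \<bar>truncated_coeff m n\<bar> \<le> coeff_bound m" using truncated_coeff_le[OF m] by blast
qed

section \<open>Summation over the localizations\<close>

text \<open>The sum over all \<open>m\<close> of products factors into a product of sums, one for each coordinate in \<open>v\<close>, and
each of these has at most one non-zero term at a given point. Assumption A bounds that term by the
weight \<open>\<psi>\<close> or \<open>\<omega>\<close>, depending on whether the coordinate lies in \<open>w\<close>.\<close>
lemma sum_bound_density:
  assumes w: "w \<subseteq> v"
  shows "(\<Sum>m\<in>(\<Pi>\<^sub>E j\<in>v. L2_idx (k j)). bound_density m w y) \<le>
    ((\<Prod>j\<in>v. C * coef j) * (\<Prod>j\<in>u - v. 1 / 2 * (1 / 2 ^ a1 j))) *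
      (\<bar>density_deriv w y\<bar> * (\<Prod>j\<in>w. \<psi> (y j)) * (\<Prod>j\<in>v - w. \<omega> (y j)))"
proof -
  let ?q = "\<lambda>j i. \<bar>cum2_wal (k j) i (\<Phi> (y j))\<bar> * \<bar>if j \<in> w then rho (y j) else rho' (y j)\<bar>"
  let ?P = "\<Prod>j\<in>u - v. 1 / 2 * (1 / 2 ^ a1 j) :: real"
  have P: "0 \<le> ?P" by (intro prod_nonneg) auto
  have "(\<Sum>m\<in>(\<Pi>\<^sub>E j\<in>v. L2_idx (k j)). bound_density m w y) =
      \<bar>density_deriv w y\<bar> * ?P * (\<Sum>m\<in>(\<Pi>\<^sub>E j\<in>v. L2_idx (k j)). \<Prod>j\<in>v. ?q j (m j))"
    by (simp add: bound_density_def sum_distrib_left mult_ac)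
  also have "(\<Sum>m\<in>(\<Pi>\<^sub>E j\<in>v. L2_idx (k j)). \<Prod>j\<in>v. ?q j (m j)) = (\<Prod>j\<in>v. \<Sum>i\<in>L2_idx (k j). ?q j i)"
    by (rule prod_sum_PiE[symmetric]) (auto simp: L2_idx_k[OF kv])
  also have "\<dots> \<le> (\<Prod>j\<in>v. C * coef j * (if j \<in> w then \<psi> (y j) else \<omega> (y j)))"
  proof (intro prod_mono conjI)
    fix j assume j: "j \<in> v"
    show "0 \<le> (\<Sum>i\<in>L2_idx (k j). ?q j i)" by (intro sum_nonneg) auto
    show "(\<Sum>i\<in>L2_idx (k j). ?q j i) \<le> C * coef j * (if j \<in> w then \<psi> (y j) else \<omega> (y j))"
    proof (rule sum_abs_cum2_wal_le[OF kv[OF j]])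
      show "0 \<le> \<Phi> (y j)" by (rule CDF_nonneg)
      show "?q j i \<le> C * coef j * (if j \<in> w then \<psi> (y j) else \<omega> (y j))" if "i \<in> L2_idx (k j)" for i
        using assA_bounds[OF j that] by (cases "j \<in> w") auto
      show "0 \<le> C * coef j * (if j \<in> w then \<psi> (y j) else \<omega> (y j))"
        using C coef_pos[of j] \<psi>[of "y j"] \<omega>[of "y j"] by (auto simp: less_imp_le)
    qed
  qed
  also have "(\<Prod>j\<in>v. C * coef j * (if j \<in> w then \<psi> (y j) else \<omega> (y j))) =
      (\<Prod>j\<in>v. C * coef j) * ((\<Prod>j\<in>w. \<psi> (y j)) * (\<Prod>j\<in>v - w. \<omega> (y j)))"
  proof -
    have "(\<Prod>j\<in>v. if j \<in> w then \<psi> (y j) else \<omega> (y j)) =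
        (\<Prod>j\<in>v - w. if j \<in> w then \<psi> (y j) else \<omega> (y j)) * (\<Prod>j\<in>w. if j \<in> w then \<psi> (y j) else \<omega> (y j))"
      by (rule prod.subset_diff[OF w]) simp
    then show ?thesis by (simp add: prod.distrib mult_ac)
  qed
  finally have "(\<Sum>m\<in>(\<Pi>\<^sub>E j\<in>v. L2_idx (k j)). bound_density m w y) \<le>
      \<bar>density_deriv w y\<bar> * ?P * ((\<Prod>j\<in>v. C * coef j) * ((\<Prod>j\<in>w. \<psi> (y j)) * (\<Prod>j\<in>v - w. \<omega> (y j))))"
    using P by (simp add: mult_left_mono)
  then show ?thesis by (simp only: mult_ac)
qed

text \<open>Each coordinate in \<open>v\<close> contributes the factor \<open>C\<close> and each one in \<open>u - v\<close> the factor \<open>1 / 2\<close>;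
\<open>C1\<close> dominates both.\<close>
theorem sum_coefficients_le:
  assumes C1: "C \<le> C1" "1 / 2 \<le> C1"
  shows "ennreal (\<Sum>m\<in>(\<Pi>\<^sub>E j\<in>v. L2_idx (k j)). \<bar>loc_wal_coeff \<phi> F u v k m\<bar>)
    \<le> ennreal (C1 ^ card u) * uv_norm \<phi> \<psi> \<omega> u v F * ennreal ((\<Prod>j\<in>v. coef j) * (\<Prod>j\<in>u - v. 1 / 2 ^ a1 j))"
proof -
  let ?I = "\<Pi>\<^sub>E j\<in>v. L2_idx (k j)"
  let ?K = "(\<Prod>j\<in>v. C * coef j) * (\<Prod>j\<in>u - v. 1 / 2 * (1 / 2 ^ a1 j)) :: real"
  let ?g = "\<lambda>w y. \<bar>density_deriv w y\<bar> * (\<Prod>j\<in>w. \<psi> (y j)) * (\<Prod>j\<in>v - w. \<omega> (y j))"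
  have K0: "0 \<le> ?K" using C coef_pos by (intro mult_nonneg_nonneg prod_nonneg) (auto simp: less_imp_le)
  have bd0: "0 \<le> bound_density m w y" for m w y
    unfolding bound_density_def by (intro mult_nonneg_nonneg prod_nonneg) auto
  have "ennreal (\<Sum>m\<in>?I. \<bar>loc_wal_coeff \<phi> F u v k m\<bar>) = (\<Sum>m\<in>?I. ennreal \<bar>loc_wal_coeff \<phi> F u v k m\<bar>)"
    by (rule sum_ennreal[symmetric]) simp
  also have "\<dots> \<le> (\<Sum>m\<in>?I. coeff_bound m)"
    by (intro sum_mono coeff_le) (auto simp: PiE_iff)
  also have "\<dots> = (\<Sum>w\<in>Pow v. \<Sum>m\<in>?I. \<integral>\<^sup>+ y. ennreal (bound_density m w y) \<partial>LP u)"
    unfolding coeff_bound_def bound_density_def[symmetric] by (rule sum.swap)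
  also have "\<dots> = (\<Sum>w\<in>Pow v. \<integral>\<^sup>+ y. ennreal (\<Sum>m\<in>?I. bound_density m w y) \<partial>LP u)"
  proof (rule sum.cong[OF refl])
    fix w assume "w \<in> Pow v"
    then have "w \<subseteq> v" by simp
    have "(\<Sum>m\<in>?I. \<integral>\<^sup>+ y. ennreal (bound_density m w y) \<partial>LP u) = (\<integral>\<^sup>+ y. (\<Sum>m\<in>?I. ennreal (bound_density m w y)) \<partial>LP u)"
      by (rule nn_integral_sum[symmetric]) (use bound_density_meas[OF \<open>w \<subseteq> v\<close>] in measurable)
    then show "(\<Sum>m\<in>?I. \<integral>\<^sup>+ y. ennreal (bound_density m w y) \<partial>LP u) = (\<integral>\<^sup>+ y. ennreal (\<Sum>m\<in>?I. bound_density m w y) \<partial>LP u)"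
      by (simp add: sum_ennreal bd0)
  qed
  also have "\<dots> \<le> (\<Sum>w\<in>Pow v. ennreal ?K * (\<integral>\<^sup>+ y. ennreal (?g w y) \<partial>LP u))"
  proof (intro sum_mono nn_integral_le_cmult K0)
    fix w assume "w \<in> Pow v"
    then have w: "w \<subseteq> v" by simp
    show "(\<lambda>y. \<Sum>m\<in>?I. bound_density m w y) \<in> borel_measurable (LP u)"
      by (intro borel_measurable_sum bound_density_meas w)
    show "(\<Sum>m\<in>?I. bound_density m w y) \<le> ?K * ?g w y" for y by (rule sum_bound_density[OF w])
    show "0 \<le> ?g w y" for y
      using \<psi> \<omega> by (intro mult_nonneg_nonneg prod_nonneg) (auto simp: less_imp_le)
  qed
  also have "\<dots> = ennreal ?K * uv_norm \<phi> \<psi> \<omega> u v F"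
    unfolding uv_norm_def density_deriv_def by (simp add: sum_distrib_left)
  also have "\<dots> \<le> ennreal (C1 ^ card u * ((\<Prod>j\<in>v. coef j) * (\<Prod>j\<in>u - v. 1 / 2 ^ a1 j))) * uv_norm \<phi> \<psi> \<omega> u v F"
  proof (intro mult_right_mono ennreal_leI)
    have C1': "0 \<le> C1" using C1 by simp
    have card: "card u = card v + card (u - v)" using vu by (simp add: card_Diff_subset card_mono)
    have "?K = (C ^ card v * (1 / 2) ^ card (u - v)) * ((\<Prod>j\<in>v. coef j) * (\<Prod>j\<in>u - v. 1 / 2 ^ a1 j))"
      by (simp only: prod.distrib prod_constant mult_ac)
    also have "\<dots> \<le> (C1 ^ card v * C1 ^ card (u - v)) * ((\<Prod>j\<in>v. coef j) * (\<Prod>j\<in>u - v. 1 / 2 ^ a1 j))"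
      using C C1 C1' coef_pos
      by (intro mult_right_mono mult_mono power_mono mult_nonneg_nonneg prod_nonneg) (auto simp: less_imp_le)
    also have "C1 ^ card v * C1 ^ card (u - v) = C1 ^ card u" by (simp add: card power_add)
    finally show "?K \<le> C1 ^ card u * ((\<Prod>j\<in>v. coef j) * (\<Prod>j\<in>u - v. 1 / 2 ^ a1 j))" .
  qed simp
  also have "\<dots> = ennreal (C1 ^ card u) * uv_norm \<phi> \<psi> \<omega> u v F * ennreal ((\<Prod>j\<in>v. coef j) * (\<Prod>j\<in>u - v. 1 / 2 ^ a1 j))"
    using C1 coef_pos by (subst ennreal_mult) (auto simp: mult_ac less_imp_le intro!: mult_nonneg_nonneg prod_nonneg)
  finally show ?thesis .
qed

end

theorem lemma4:
  fixes \<phi> \<psi> \<omega> :: "real \<Rightarrow> real" and C \<beta> C1 :: real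
    and F :: "real ^ 's::finite \<Rightarrow> real"
    and u v :: "'s set" and k a1 a2 :: "'s \<Rightarrow> nat"
  assumes "diff_density \<phi>"
    and "\<And>x. \<psi> x > 0" and "\<And>x. \<omega> x > 0"
    and "C > 0" and "0 < \<beta>" and "\<beta> \<le> 1"
    and "assumption_A \<phi> \<psi> \<omega> C \<beta>"
    and "C1 = max C (1 / 2)"
    and "in_L2 \<phi> F"
    and "suff_smooth F"
    and "u \<noteq> {}" and "v \<subseteq> u"
    and "inner_locally_integrable \<phi> u v F"
    and "\<And>j. j \<in> v \<Longrightarrow> k j \<in> N2 - N1 \<and> k j = 2 ^ a1 j + 2 ^ a2 j \<and> a1 j > a2 j"
    and "\<And>j. j \<in> u - v \<Longrightarrow> k j \<in> N1 - N0 \<and> k j = 2 ^ a1 j"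
  shows "ennreal (\<Sum>m\<in>(\<Pi>\<^sub>E j\<in>v. L2_idx (k j)). \<bar>loc_wal_coeff \<phi> F u v k m\<bar>)
    \<le> ennreal (C1 ^ card u) * uv_norm \<phi> \<psi> \<omega> u v F
      * ennreal ((\<Prod>j\<in>v. 2 powr (real (a2 j) / 2) / 2 powr (real (a1 j) + \<beta> * real (a2 j)))
                 * (\<Prod>j\<in>u - v. 1 / 2 ^ a1 j))"
proof -
  interpret walsh_setting \<phi> \<psi> \<omega> C \<beta> F u v k a1 a2
    by unfold_locales (use assms in blast)+
  show ?thesis
    using sum_coefficients_le[of C1] assms(8) by (simp add: coef_def)
qed

end
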